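(* A graph $G$ does not admit an orientation under which every even circuit is clockwise odd if and only if $G$ contains a subgraph which is, after the contraction of at most one odd circuit, an even subdivision of $K_{2,3}$; that is, if and only if there is a subgraph $K$ of $G$ such that either $K$ is an even subdivision of $K_{2,3}$, or $K$ has an odd circuit $A$ such that the graph obtained from $K$ by contracting $A$ is an even subdivision of $K_{2,3}$.
   Context: Graphs are finite and undirected; multiple edges are allowed. A circuit is even (odd) if its length, i.e. its number of edges, is even (odd). Clockwise parity: given an orientation of the edges, the clockwise parity of an even circuit is the parity of the number of its edges that are directed in agreement with a specified sense of traversal (since the length is even, this does not depend on the sense chosen). The circuit is clockwise even or clockwise odd accordingly. Contracting an odd circuit $A$ of $K$ means contracting all edges of $A$, so that the resulting graph has edge set $EK\setminus A$. An even subdivision of a graph $F$ is a graph obtained (up to isomorphism) from $F$ by a finite (possibly empty) sequence of steps, each of which subdivides an edge of the current graph twice (i.e. replaces it by a path of length $3$). *)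

theory Defs
  imports Main
begin

section \<open>Multigraphs\<close>

text \<open>Parallel edges are distinct elements of \<open>edges\<close> with the same value of
  \<open>ends\<close>; a loop is an edge whose set of ends is a singleton. The values of \<open>ends\<close> outside
  \<open>edges\<close> are irrelevant.\<close>

record ('v, 'e) mgraph =
  verts :: "'v set"
  edges :: "'e set"
  ends :: "'e \<Rightarrow> 'v set"

definition finite_mgraph :: "('v, 'e) mgraph \<Rightarrow> bool" where
  "finite_mgraph G \<longleftrightarrow> finite (verts G) \<and> finite (edges G) \<and>
     (\<forall>e\<in>edges G. \<exists>u\<in>verts G. \<exists>v\<in>verts G. ends G e = {u, v})"

definition subgraph :: "('v, 'e) mgraph \<Rightarrow> ('v, 'e) mgraph \<Rightarrow> bool" where
  "subgraph K G \<longleftrightarrow> finite_mgraph K \<and> verts K \<subseteq> verts G \<and> edges K \<subseteq> edges G \<and>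
     (\<forall>e\<in>edges K. ends K e = ends G e)"

definition isomorphic :: "('v, 'e) mgraph \<Rightarrow> ('w, 'f) mgraph \<Rightarrow> bool" where
  "isomorphic G H \<longleftrightarrow> (\<exists>f g. bij_betw f (verts G) (verts H) \<and> bij_betw g (edges G) (edges H) \<and>
     (\<forall>e\<in>edges G. ends H (g e) = f ` ends G e))"

section \<open>Circuits, orientations and clockwise parity\<close>

text \<open>The closed walk visits \<open>vs ! 0, vs ! 1, \<dots>\<close> in this order, and \<open>es ! i\<close> is the
  edge used to leave \<open>vs ! i\<close>. Distinctness of \<open>es\<close> is needed only for length 2.\<close>

definition traversal :: "('v, 'e) mgraph \<Rightarrow> 'v list \<Rightarrow> 'e list \<Rightarrow> bool" where
  "traversal G vs es \<longleftrightarrow> es \<noteq> [] \<and> length vs = length es \<and> distinct vs \<and> distinct es \<and>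
     set vs \<subseteq> verts G \<and> set es \<subseteq> edges G \<and>
     (\<forall>i<length es. ends G (es ! i) = {vs ! i, vs ! (Suc i mod length es)})"

text \<open>A circuit is identified with its edge set, so that its length is its cardinality.\<close>

definition circuit :: "('v, 'e) mgraph \<Rightarrow> 'e set \<Rightarrow> bool" where
  "circuit G A \<longleftrightarrow> (\<exists>vs es. traversal G vs es \<and> set es = A)"

definition even_circuit :: "('v, 'e) mgraph \<Rightarrow> 'e set \<Rightarrow> bool" where
  "even_circuit G A \<longleftrightarrow> circuit G A \<and> even (card A)"

definition odd_circuit :: "('v, 'e) mgraph \<Rightarrow> 'e set \<Rightarrow> bool" where
  "odd_circuit G A \<longleftrightarrow> circuit G A \<and> odd (card A)"

text \<open>\<open>D e = (u, v)\<close> means that \<open>e\<close> is directed from \<open>u\<close> to \<open>v\<close>.\<close>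

definition orientation :: "('v, 'e) mgraph \<Rightarrow> ('e \<Rightarrow> 'v \<times> 'v) \<Rightarrow> bool" where
  "orientation G D \<longleftrightarrow> (\<forall>e\<in>edges G. {fst (D e), snd (D e)} = ends G e)"

definition agreeing :: "('e \<Rightarrow> 'v \<times> 'v) \<Rightarrow> 'v list \<Rightarrow> 'e list \<Rightarrow> nat" where
  "agreeing D vs es =
     card {i. i < length es \<and> D (es ! i) = (vs ! i, vs ! (Suc i mod length es))}"

text \<open>For even circuits the choice of the traversal does not matter; see
  \<open>clockwise_odd_iff\<close> below.\<close>

definition clockwise_odd :: "('v, 'e) mgraph \<Rightarrow> ('e \<Rightarrow> 'v \<times> 'v) \<Rightarrow> 'e set \<Rightarrow> bool" where
  "clockwise_odd G D A \<longleftrightarrow> (\<exists>vs es. traversal G vs es \<and> set es = A \<and> odd (agreeing D vs es))"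

lemma traversal_direction:
  assumes T: "traversal G vs es" and T': "traversal G ws fs" and S: "set es = set fs"
    and n: "length es = n" "length fs = n" "2 \<le> n"
  shows "(\<forall>i<n. \<forall>j<n. es ! i = fs ! j \<longrightarrow> vs ! i = ws ! j \<and> vs ! (Suc i mod n) = ws ! (Suc j mod n)) \<or>
         (\<forall>i<n. \<forall>j<n. es ! i = fs ! j \<longrightarrow> vs ! i = ws ! (Suc j mod n) \<and> vs ! (Suc i mod n) = ws ! j)"
proof -
  let ?s = "\<lambda>i. Suc i mod n"
  have lt: "?s i < n" for i using n by simp
  have ne: "?s i \<noteq> i" if "i < n" for i using that n(3) by (cases "Suc i = n") auto
  have sinj: "i = j" if "?s i = ?s j" "i < n" "j < n" for i j
    using that by (metis mod_Suc nat.inject Suc_inject mod_less zero_neq_one nat.distinct(1))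
  have lv: "length vs = n" and lw: "length ws = n" and dv: "distinct vs" and dw: "distinct ws"
    and de: "distinct es" and df: "distinct fs"
    using T T' n by (auto simp: traversal_def)
  have ee: "ends G (es ! i) = {vs ! i, vs ! ?s i}" if "i < n" for i
    using T that n by (auto simp: traversal_def)
  have ef: "ends G (fs ! i) = {ws ! i, ws ! ?s i}" if "i < n" for i
    using T' that n by (auto simp: traversal_def)
  have vne: "vs ! i \<noteq> vs ! ?s i" if "i < n" for i
    using dv lv that ne[OF that] lt[of i] by (metis nth_eq_iff_index_eq)
  define J where "J i = (SOME j. j < n \<and> es ! i = fs ! j)" for i
  have J: "J i < n \<and> es ! i = fs ! J i" if "i < n" for i
  proof -
    have "\<exists>j. j < n \<and> es ! i = fs ! j" using that S n by (metis in_set_conv_nth)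
    then show ?thesis unfolding J_def by (rule someI_ex)
  qed
  have Ju: "j = J i" if "i < n" "j < n" "es ! i = fs ! j" for i j
    using J[OF that(1)] that df n by (metis nth_eq_iff_index_eq)
  define P where "P i \<longleftrightarrow> vs ! i = ws ! J i \<and> vs ! ?s i = ws ! ?s (J i)" for i
  define Q where "Q i \<longleftrightarrow> vs ! i = ws ! ?s (J i) \<and> vs ! ?s i = ws ! J i" for i
  have PQ: "P i \<or> Q i" if "i < n" for i
  proof -
    have "{vs ! i, vs ! ?s i} = {ws ! J i, ws ! ?s (J i)}"
      using ee[OF that] ef[of "J i"] J[OF that] by simp
    then show ?thesis unfolding P_def Q_def by (auto simp: doubleton_eq_iff)
  qed
  have Jne: "J (?s i) \<noteq> J i" if "i < n" for i
  proof
    assume "J (?s i) = J i"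
    then have "es ! ?s i = es ! i" using J[OF that] J[OF lt[of i]] by simp
    then show False using de n ne[OF that] that lt[of i] by (metis nth_eq_iff_index_eq)
  qed
  have wi: "a = b" if "ws ! a = ws ! b" "a < n" "b < n" for a b
    using that dw lw by (metis nth_eq_iff_index_eq)
  have PS: "P (?s i)" if "i < n" "P i" for i
  proof (rule ccontr)
    assume "\<not> P (?s i)"
    then have "Q (?s i)" using PQ[OF lt] by blast
    then have "ws ! ?s (J i) = ws ! ?s (J (?s i))" using that(2) by (simp add: P_def Q_def)
    then have "?s (J i) = ?s (J (?s i))" using wi lt by blast
    then show False using sinj J[OF that(1)] J[OF lt[of i]] Jne[OF that(1)] by metis
  qed
  have QS: "Q (?s i)" if "i < n" "Q i" for i
  proof (rule ccontr)
    assume "\<not> Q (?s i)"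
    then have "P (?s i)" using PQ[OF lt] by blast
    then have "ws ! J i = ws ! J (?s i)" using that(2) by (simp add: P_def Q_def)
    then show False using wi J[OF that(1)] J[OF lt[of i]] Jne[OF that(1)] by metis
  qed
  have all: "\<forall>i<n. R i" if "R 0" "\<And>i. i < n \<Longrightarrow> R i \<Longrightarrow> R (?s i)" for R :: "nat \<Rightarrow> bool"
  proof (intro allI impI)
    show "R i" if "i < n" for i using that
    proof (induction i)
      case (Suc i)
      then show ?case using \<open>\<And>i. i < n \<Longrightarrow> R i \<Longrightarrow> R (?s i)\<close>[of i] by simp
    qed (rule \<open>R 0\<close>)
  qed
  have "P 0 \<or> Q 0" using PQ n by simp
  then have "(\<forall>i<n. P i) \<or> (\<forall>i<n. Q i)" using all[of P] all[of Q] PS QS by blast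
  then show ?thesis using Ju unfolding P_def Q_def by metis
qed

lemma agreeing_parity:
  assumes T: "traversal G vs es" and T': "traversal G ws fs" and S: "set es = set fs"
    and ev: "even (length es)" and D: "orientation G D"
  shows "even (agreeing D vs es) \<longleftrightarrow> even (agreeing D ws fs)"
proof -
  define n where "n = length es"
  let ?s = "\<lambda>i. Suc i mod n"
  have de: "distinct es" and df: "distinct fs" and lv: "length vs = n" and dv: "distinct vs"
    using T T' by (auto simp: traversal_def n_def)
  have ln: "length es = n" "length fs = n"
    using S de df by (auto simp: n_def) (metis distinct_card)
  have "n \<noteq> 0" using T by (auto simp: traversal_def n_def)
  moreover have "even n" using ev by (simp add: n_def)
  ultimately have n2: "2 \<le> n" by presburger
  have lt: "?s i < n" for i using n2 by simp
  have ne: "?s i \<noteq> i" if "i < n" for i using that n2 by (cases "Suc i = n") auto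
  have vne: "vs ! i \<noteq> vs ! ?s i" if "i < n" for i
    using dv lv that ne[OF that] lt[of i] by (metis nth_eq_iff_index_eq)
  have Dor: "D (es ! i) = (vs ! i, vs ! ?s i) \<or> D (es ! i) = (vs ! ?s i, vs ! i)" if "i < n" for i
  proof -
    have "es ! i \<in> edges G" "ends G (es ! i) = {vs ! i, vs ! ?s i}"
      using T that nth_mem[of i es] ln by (auto simp: traversal_def)
    then have "{fst (D (es ! i)), snd (D (es ! i))} = {vs ! i, vs ! ?s i}"
      using D by (auto simp: orientation_def)
    then show ?thesis by (cases "D (es ! i)") (auto simp: doubleton_eq_iff)
  qed
  let ?I = "{i. i < n \<and> D (es ! i) = (vs ! i, vs ! ?s i)}"
  let ?J = "{j. j < n \<and> D (fs ! j) = (ws ! j, ws ! ?s j)}"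
  have a: "agreeing D vs es = card ?I" "agreeing D ws fs = card ?J"
    by (simp_all add: agreeing_def ln)
  have injs: "inj_on ((!) es) X" "inj_on ((!) fs) X" if "X \<subseteq> {..<n}" for X
    using that de df ln by (auto simp: inj_on_def nth_eq_iff_index_eq subset_eq)
  have cI: "card ?I = card ((!) es ` ?I)" and cJ: "card ?J = card ((!) fs ` ?J)"
    by (rule card_image[symmetric], rule injs, auto)+
  have ex: "\<exists>j<n. es ! i = fs ! j" if "i < n" for i
    using that S ln by (metis in_set_conv_nth)
  have ex': "\<exists>i<n. es ! i = fs ! j" if "j < n" for j
    using that S ln by (metis in_set_conv_nth)
  consider
    (same) "\<And>i j. i < n \<Longrightarrow> j < n \<Longrightarrow> es ! i = fs ! j \<Longrightarrow> vs ! i = ws ! j \<and> vs ! ?s i = ws ! ?s j"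
  | (opp) "\<And>i j. i < n \<Longrightarrow> j < n \<Longrightarrow> es ! i = fs ! j \<Longrightarrow> vs ! i = ws ! ?s j \<and> vs ! ?s i = ws ! j"
    using traversal_direction[OF T T' S ln n2] by blast
  then show ?thesis
  proof cases
    case same
    have "(!) es ` ?I = (!) fs ` ?J"
    proof (intro subset_antisym subsetI)
      fix e assume "e \<in> (!) es ` ?I"
      then obtain i where i: "i < n" "e = es ! i" "D (es ! i) = (vs ! i, vs ! ?s i)" by blast
      then obtain j where "j < n" "es ! i = fs ! j" using ex by blast
      then show "e \<in> (!) fs ` ?J" using i same[of i j] by (intro image_eqI[of _ _ j]) auto
    next
      fix e assume "e \<in> (!) fs ` ?J"
      then obtain j where j: "j < n" "e = fs ! j" "D (fs ! j) = (ws ! j, ws ! ?s j)" by blast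
      then obtain i where "i < n" "es ! i = fs ! j" using ex' by blast
      then show "e \<in> (!) es ` ?I" using j same[of i j] by (intro image_eqI[of _ _ i]) auto
    qed
    then show ?thesis using a cI cJ by simp
  next
    case opp
    let ?K = "{i. i < n \<and> D (es ! i) \<noteq> (vs ! i, vs ! ?s i)}"
    have "(!) es ` ?K = (!) fs ` ?J"
    proof (intro subset_antisym subsetI)
      fix e assume "e \<in> (!) es ` ?K"
      then obtain i where i: "i < n" "e = es ! i" "D (es ! i) = (vs ! ?s i, vs ! i)"
        using Dor by blast
      then obtain j where "j < n" "es ! i = fs ! j" using ex by blast
      then show "e \<in> (!) fs ` ?J" using i opp[of i j] by (intro image_eqI[of _ _ j]) auto
    next
      fix e assume "e \<in> (!) fs ` ?J"
      then obtain j where j: "j < n" "e = fs ! j" "D (fs ! j) = (ws ! j, ws ! ?s j)" by blast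
      then obtain i where i: "i < n" "es ! i = fs ! j" using ex' by blast
      then show "e \<in> (!) es ` ?K" using j opp[of i j] vne[OF i(1)]
        by (intro image_eqI[of _ _ i]) auto
    qed
    moreover have "card ?K = card ((!) es ` ?K)"
      by (rule card_image[symmetric], rule injs, auto)
    ultimately have KJ: "card ?K = card ?J" using cJ by simp
    have "card (?I \<union> ?K) = card ?I + card ?K" by (rule card_Un_disjoint) auto
    moreover have "?I \<union> ?K = {..<n}" by auto
    ultimately have "card ?I + card ?J = n" using KJ by simp
    then show ?thesis using a \<open>even n\<close> by (metis even_add)
  qed
qed

lemma clockwise_odd_iff:
  assumes "traversal G vs es" "even (length es)" "orientation G D"
  shows "clockwise_odd G D (set es) \<longleftrightarrow> odd (agreeing D vs es)"
  using assms agreeing_parity[of G vs es _ _ D] unfolding clockwise_odd_def by metis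

section \<open>Contraction of a circuit\<close>

text \<open>All vertices of the circuit are identified. Edges outside \<open>A\<close> that join two vertices of
  the circuit become loops.\<close>

definition contract_map :: "'v set \<Rightarrow> 'v \<Rightarrow> 'v set" where
  "contract_map W x = (if x \<in> W then W else {x})"

definition contract :: "('v, 'e) mgraph \<Rightarrow> 'e set \<Rightarrow> ('v set, 'e) mgraph" where
  "contract K A = (let c = contract_map (\<Union>e\<in>A. ends K e) in
     \<lparr>verts = c ` verts K, edges = edges K - A, ends = (\<lambda>e. c ` ends K e)\<rparr>)"

section \<open>Even subdivisions\<close>

text \<open>One step replaces an edge \<open>e\<close> with ends \<open>u, v\<close> by a path \<open>u, x, y, v\<close> of length 3 whose
  inner vertices and edges \<open>a, b, c\<close> are new.\<close>

inductive double_subdivide :: "('v, 'e) mgraph \<Rightarrow> ('v, 'e) mgraph \<Rightarrow> bool" where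
  "\<lbrakk>e \<in> edges F; ends F e = {u, v};
    x \<notin> verts F; y \<notin> verts F; x \<noteq> y;
    a \<notin> edges F; b \<notin> edges F; c \<notin> edges F; distinct [a, b, c]\<rbrakk>
   \<Longrightarrow> double_subdivide F
        \<lparr>verts = verts F \<union> {x, y},
         edges = edges F - {e} \<union> {a, b, c},
         ends = (ends F)(a := {u, x}, b := {x, y}, c := {y, v})\<rparr>"

text \<open>The steps are carried out on a copy of \<open>F\<close> with natural numbers as vertices and edges, so
  that new vertices and edges are always available, whatever the type of \<open>F\<close>.\<close>

definition even_subdivision :: "('v, 'e) mgraph \<Rightarrow> ('w, 'f) mgraph \<Rightarrow> bool" where
  "even_subdivision F H \<longleftrightarrow> (\<exists>F\<^sub>0 F\<^sub>1 :: (nat, nat) mgraph.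
     isomorphic F F\<^sub>0 \<and> double_subdivide\<^sup>*\<^sup>* F\<^sub>0 F\<^sub>1 \<and> isomorphic F\<^sub>1 H)"

definition complete_bipartite :: "nat \<Rightarrow> nat \<Rightarrow> (nat + nat, nat \<times> nat) mgraph" where
  "complete_bipartite m n =
     \<lparr>verts = {..<m} <+> {..<n}, edges = {..<m} \<times> {..<n}, ends = (\<lambda>(i, j). {Inl i, Inr j})\<rparr>"

end

theory Submission
  imports Defs
begin

text \<open>
  An orientation is good if every even circuit is clockwise odd. Good orientations are inherited by
  subgraphs, and by the contraction of an odd circuit \<open>A\<close>: any two vertices of \<open>A\<close> are joined by
  exactly one path of even length in \<open>A\<close>, and the parities of forward edges along these even arcs
  form a potential on the vertices of \<open>A\<close>, which tells how to reorient the edges at the contracted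
  vertex. Undoing a double subdivision also keeps goodness, and \<open>K\<^sub>2\<^sub>,\<^sub>3\<close> has no good orientation since
  its three even circuits would have an odd total number of forward edges.

  For the converse, an obstruction is either a theta graph with three even paths, or a subdivided
  \<open>K\<^sub>4\<close> with three even paths at one vertex and three odd paths forming the opposite triangle;
  contracting that triangle gives an even theta. A graph without obstructions is oriented edge by
  edge. If \<open>e = uv\<close> is added to \<open>E\<close>, one needs a good orientation of \<open>E\<close> for which all odd
  \<open>uv\<close>-paths have the same parity of forward edges. When no vertex separates \<open>u\<close> from \<open>v\<close>, every good
  orientation has this property: two such paths are transformed into each other by replacing a
  segment by an ear of the same parity, by exchanging two crossing odd ears, and by simultaneously
  exchanging two consecutive odd beads, the last move being reducible to the others and to circuits of
  \<open>E\<close> with the help of a path that bypasses an end of the first bead. When a vertex \<open>c\<close> separates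
  \<open>u\<close> from \<open>v\<close>, the two sides are treated separately; reversing all edges of one side changes the
  difference between its even and odd paths, so that the two sides can be matched.
\<close>

section \<open>Paths as lists of darts\<close>

text \<open>Goodness speaks of even circuits only, so two \<open>uv\<close>-paths can be compared
  only through intermediate paths of the same parity. This is the obstacle: if two stretches of a
  path are to be replaced by others of different parity, neither replacement is legal alone, and
  each pair of stretches bounds an odd circuit. The bypass links the two places. Its parity decides
  through which detours an intermediate path of the right parity runs, and its existence is exactly
  the absence of a separating vertex.

  Constancy can fail in the presence of a separating vertex \<open>c\<close>: an odd path is then
  odd before \<open>c\<close> and even after it, or conversely, and goodness does not relate the two
  kinds. The recursion therefore asks for even paths as well and works with a set
  \<open>\<Pi>\<close> of parities, although only odd paths matter when an edge is added.

  Both kinds of obstruction come from the same count: three paths with common ends and equal even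
  length parity would need pairwise different forward parities.\<close>

type_synonym ('v, 'e) dart = "'v \<times> 'e \<times> 'v"

text \<open>Read off from the darts, so the empty path has no vertices, not even its base point.
  Hence the recurring \<open>insert x (pverts p)\<close>, and every \<open>meet_in\<close> condition
  on an empty path holds trivially.\<close>

definition pverts :: "('v, 'e) dart list \<Rightarrow> 'v set" where
  "pverts p = fst ` set p \<union> (snd \<circ> snd) ` set p"

definition pedges :: "('v, 'e) dart list \<Rightarrow> 'e set" where
  "pedges p = (fst \<circ> snd) ` set p"

definition reverse :: "('v, 'e) dart list \<Rightarrow> ('v, 'e) dart list" where
  "reverse p = rev (map (\<lambda>(a, e, b). (b, e, a)) p)"

definition fwd :: "('e \<Rightarrow> 'v \<times> 'v) \<Rightarrow> ('v, 'e) dart list \<Rightarrow> bool" where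
  "fwd D p \<longleftrightarrow> odd (length (filter (\<lambda>(a, e, b). D e = (a, b)) p))"

abbreviation "edge_list \<equiv> map (fst \<circ> snd)"

abbreviation "meet_in p q X \<equiv> pverts p \<inter> pverts q \<subseteq> X"

lemma pverts_simps [simp]:
  "pverts [] = {}" "pverts ((a, e, b) # p) = {a, b} \<union> pverts p" "pverts (p @ q) = pverts p \<union> pverts q"
  by (auto simp: pverts_def)

lemma pedges_simps [simp]:
  "pedges [] = {}" "pedges ((a, e, b) # p) = insert e (pedges p)" "pedges (p @ q) = pedges p \<union> pedges q"
  by (auto simp: pedges_def)

lemma reverse_simps [simp]:
  "reverse [] = []" "reverse ((a, e, b) # p) = reverse p @ [(b, e, a)]"
  "reverse (p @ q) = reverse q @ reverse p" "length (reverse p) = length p"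
  by (auto simp: reverse_def)

lemma dart_pverts: "(a, e, b) \<in> set p \<Longrightarrow> a \<in> pverts p \<and> b \<in> pverts p"
  by (induction p) auto

lemma reverse_eq_Nil [simp]: "reverse p = [] \<longleftrightarrow> p = []"
  by (auto simp: reverse_def)

lemma pverts_reverse [simp]: "pverts (reverse p) = pverts p"
  by (induction p) auto

lemma pedges_reverse [simp]: "pedges (reverse p) = pedges p"
  by (induction p) auto

lemmas pverts_distrib = pverts_simps pverts_reverse Int_Un_distrib Int_Un_distrib2 Un_subset_iff Un_empty_left Un_empty_right

lemma fwd_simps [simp]:
  "fwd D [] = False" "fwd D ((a, e, b) # p) = ((D e = (a, b)) \<noteq> fwd D p)"
  "fwd D (p @ q) = (fwd D p \<noteq> fwd D q)"
  by (auto simp: fwd_def)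

lemma fwd_cong: "(\<And>e. e \<in> pedges p \<Longrightarrow> D e = D' e) \<Longrightarrow> fwd D p = fwd D' p"
  by (induction p) auto

locale incidence =
  fixes en :: "'e \<Rightarrow> 'v set"
begin

fun walk :: "'e set \<Rightarrow> 'v \<Rightarrow> ('v, 'e) dart list \<Rightarrow> 'v \<Rightarrow> bool" where
  "walk E x [] y \<longleftrightarrow> x = y" |
  "walk E x ((a, e, b) # p) y \<longleftrightarrow> a = x \<and> e \<in> E \<and> en e = {a, b} \<and> walk E b p y"

text \<open>The clause \<open>a \<noteq> b\<close> keeps a loop from being the last dart, where
  \<open>pverts p\<close> is empty.\<close>

fun path :: "'e set \<Rightarrow> 'v \<Rightarrow> ('v, 'e) dart list \<Rightarrow> 'v \<Rightarrow> bool" where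
  "path E x [] y \<longleftrightarrow> x = y" |
  "path E x ((a, e, b) # p) y \<longleftrightarrow>
     a = x \<and> e \<in> E \<and> en e = {a, b} \<and> a \<noteq> b \<and> a \<notin> pverts p \<and> path E b p y"

definition orients :: "'e set \<Rightarrow> ('e \<Rightarrow> 'v \<times> 'v) \<Rightarrow> bool" where
  "orients E D \<longleftrightarrow> (\<forall>e\<in>E. {fst (D e), snd (D e)} = en e)"

text \<open>Only the sources of the darts are required to be distinct, so a loop gives a closed path
  of length 1 and two parallel edges give one of length 2. Distinct edges rule out running back
  along the same edge.\<close>

definition closed_path :: "'e set \<Rightarrow> 'v \<Rightarrow> ('v, 'e) dart list \<Rightarrow> bool" where
  "closed_path E x c \<longleftrightarrow> walk E x c x \<and> c \<noteq> [] \<and> distinct (map fst c) \<and> distinct (edge_list c)"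

definition good :: "'e set \<Rightarrow> ('e \<Rightarrow> 'v \<times> 'v) \<Rightarrow> bool" where
  "good E D \<longleftrightarrow> orients E D \<and> (\<forall>x c. closed_path E x c \<longrightarrow> even (length c) \<longrightarrow> fwd D c)"

lemma walk_append: "walk E x (p @ q) z \<longleftrightarrow> (\<exists>y. walk E x p y \<and> walk E y q z)"
  by (induction p arbitrary: x) auto

lemma path_walk: "path E x p y \<Longrightarrow> walk E x p y"
  by (induction p arbitrary: x) auto

lemma dart_ends: "walk E x p y \<Longrightarrow> (a, e, b) \<in> set p \<Longrightarrow> en e = {a, b}"
  by (induction p arbitrary: x) auto

lemma path_ends: "path E x p y \<Longrightarrow> p \<noteq> [] \<Longrightarrow> x \<in> pverts p \<and> y \<in> pverts p \<and> x \<noteq> y"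
proof (induction p arbitrary: x)
  case (Cons d p)
  obtain a e b where "d = (a, e, b)" by (cases d)
  then show ?case using Cons by (cases "p = []") auto
qed simp

lemma path_Nil_iff: "path E x p y \<Longrightarrow> p = [] \<longleftrightarrow> x = y"
  using path_ends by fastforce

lemma path_append:
  "path E x p y \<Longrightarrow> path E y q z \<Longrightarrow> meet_in p q {y} \<Longrightarrow> path E x (p @ q) z"
proof (induction p arbitrary: x)
  case (Cons d p)
  obtain a e b where d: "d = (a, e, b)" by (cases d)
  then have "a \<notin> pverts q"
    using Cons.prems path_ends[OF Cons.prems(1)] by auto
  then show ?case using Cons d by auto
qed simp

lemma path_appendD:
  "path E x (p @ q) z \<Longrightarrow> \<exists>y. path E x p y \<and> path E y q z \<and> meet_in p q {y}"
proof (induction p arbitrary: x)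
  case (Cons d p)
  obtain a e b where d: "d = (a, e, b)" by (cases d)
  with Cons obtain y where "path E b p y" "path E y q z" "meet_in p q {y}"
    by (metis append_Cons path.simps(2))
  moreover have "b \<in> pverts q \<Longrightarrow> b = y"
    using calculation path_ends[of E b p y] by (cases "p = []") auto
  ultimately show ?case using Cons.prems d by (intro exI[of _ y]) auto
qed auto

lemma path_appendI:
  assumes "path E x (p @ q) z"
  obtains y where "path E x p y" "path E y q z" "meet_in p q {y}"
  using path_appendD[OF assms] by blast

lemma path_reverse: "path E x p y \<Longrightarrow> path E y (reverse p) x"
proof (induction p arbitrary: x)
  case (Cons d p)
  obtain a e b where d: "d = (a, e, b)" by (cases d)
  show ?case unfolding d reverse_simps
    by (rule path_append[of _ _ _ b]) (use Cons d in auto)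
qed simp

lemma path_mono: "path E x p y \<Longrightarrow> E \<subseteq> E' \<Longrightarrow> path E' x p y"
  by (induction p arbitrary: x) auto

lemma path_restrict: "path E x p y \<Longrightarrow> pedges p \<subseteq> E' \<Longrightarrow> path E' x p y"
  by (induction p arbitrary: x) auto

lemma path_pedges: "path E x p y \<Longrightarrow> pedges p \<subseteq> E"
  by (induction p arbitrary: x) fastforce+

lemma walk_unique: "walk E x p y \<Longrightarrow> walk E' x p z \<Longrightarrow> y = z"
  by (induction p arbitrary: x) auto

lemma path_unique: "path E x p y \<Longrightarrow> path E' x p z \<Longrightarrow> y = z"
  using walk_unique path_walk by blast

lemma path_split:
  assumes "path E x p y" "z \<in> insert x (pverts p)"
  obtains p1 p2 where "p = p1 @ p2" "path E x p1 z" "path E z p2 y" "meet_in p1 p2 {z}"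
proof -
  have "\<exists>p1 p2. p = p1 @ p2 \<and> path E x p1 z \<and> path E z p2 y \<and> meet_in p1 p2 {z}"
    using assms
  proof (induction p arbitrary: x)
    case (Cons d p)
    obtain a e b where d: "d = (a, e, b)" by (cases d)
    show ?case
    proof (cases "z = x")
      case True
      then show ?thesis using Cons.prems(1) by (intro exI[of _ "[]"] exI[of _ "d # p"]) simp
    next
      case False
      then have "z \<in> insert b (pverts p)" using Cons.prems d by auto
      then obtain p1 p2 where s: "p = p1 @ p2" "path E b p1 z" "path E z p2 y" "meet_in p1 p2 {z}"
        using Cons.IH[of b] Cons.prems d by auto
      have "b \<in> pverts p2 \<Longrightarrow> b = z"
        using s path_ends[of E b p1 z] by (cases "p1 = []") auto
      then show ?thesis using s Cons.prems d by (intro exI[of _ "d # p1"] exI[of _ p2]) auto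
    qed
  qed auto
  then show thesis using that by blast
qed

text \<open>The segment \<open>r\<close> is the shortest nonempty initial piece that ends in
  \<open>S\<close>. The start \<open>x\<close> may itself lie in \<open>S\<close>, which is why it
  appears in the bound on \<open>pverts r \<inter> S\<close>.\<close>

lemma first_return:
  assumes "path E x p v" "p \<noteq> []" "v \<in> S"
  obtains r p' y where "p = r @ p'" "r \<noteq> []" "path E x r y" "path E y p' v" "y \<in> S"
    "pverts r \<inter> S \<subseteq> {x, y}" "meet_in r p' {y}"
proof -
  have "\<exists>r p' y. p = r @ p' \<and> r \<noteq> [] \<and> path E x r y \<and> path E y p' v \<and> y \<in> S \<and> pverts r \<inter> S \<subseteq> {x, y}"
    using assms
  proof (induction p arbitrary: x)
    case (Cons d p)
    obtain a e b where d: "d = (a, e, b)" by (cases d)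
    show ?case
    proof (cases "b \<in> S")
      case True
      have "path E x [d] b" "path E b p v" "pverts [d] \<inter> S \<subseteq> {x, b}" using Cons.prems(1) d by auto
      then show ?thesis using True by (intro exI[of _ "[d]"] exI[of _ p] exI[of _ b]) simp
    next
      case False
      have pb: "path E b p v" using Cons.prems(1) d by simp
      with False have "p \<noteq> []" using Cons.prems(3) by auto
      then obtain r p' y where s: "p = r @ p'" "r \<noteq> []" "path E b r y" "path E y p' v" "y \<in> S"
        "pverts r \<inter> S \<subseteq> {b, y}"
        using Cons.IH[of b] pb Cons.prems(3) by blast
      have "pverts (d # r) \<inter> S \<subseteq> {x, y}" using s(6) False Cons.prems d by auto
      moreover have "path E x (d # r) y"
        using s(1,3) Cons.prems(1) d by auto
      ultimately show ?thesis using s(1,4,5) by (intro exI[of _ "d # r"] exI[of _ p'] exI[of _ y]) auto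
    qed
  qed auto
  then show thesis using that assms(1) path_appendD path_unique by (metis (no_types, lifting))
qed

text \<open>Cut the path at its successive visits to \<open>L \<union> R\<close>. The first piece
  that ends in \<open>R\<close> starts in \<open>L\<close>, and its interior avoids both
  sets.\<close>

lemma crossing_segment:
  assumes "path E u W v" "u \<in> L" "v \<in> R" "L \<inter> R = {}"
  obtains W1 S W2 s t where "W = W1 @ S @ W2" "path E u W1 s" "path E s S t" "path E t W2 v"
    "s \<in> L" "t \<in> R" "pverts S \<inter> L \<subseteq> {s}" "pverts S \<inter> R \<subseteq> {t}"
proof -
  have "\<exists>W1 S W2 s t. W = W1 @ S @ W2 \<and> path E u W1 s \<and> path E s S t \<and> path E t W2 v \<and>
    s \<in> L \<and> t \<in> R \<and> pverts S \<inter> L \<subseteq> {s} \<and> pverts S \<inter> R \<subseteq> {t}"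
    using assms
  proof (induction W arbitrary: u rule: length_induct)
    case (1 W)
    have ne: "W \<noteq> []" using 1(2-) by auto
    have "v \<in> L \<union> R" using 1(2-) by simp
    from first_return[OF 1(2) ne this] obtain r p' y where
      r: "W = r @ p'" "r \<noteq> []" "path E u r y" "path E y p' v" "y \<in> L \<union> R"
        "pverts r \<inter> (L \<union> R) \<subseteq> {u, y}" "meet_in r p' {y}" by blast
    show ?case
    proof (cases "y \<in> L")
      case False
      then have "y \<in> R" "pverts r \<inter> L \<subseteq> {u}" "pverts r \<inter> R \<subseteq> {y}" using r(5,6) 1(3-) by blast+
      then show ?thesis using r(1,3,4) 1(3)
        by (intro exI[of _ "[]"] exI[of _ r] exI[of _ p'] exI[of _ u] exI[of _ y]) simp
    next
      case True
      have "length p' < length W" using r by simp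
      then obtain W1 S W2 s t where s: "p' = W1 @ S @ W2" "path E y W1 s" "path E s S t" "path E t W2 v"
         "s \<in> L" "t \<in> R" "pverts S \<inter> L \<subseteq> {s}" "pverts S \<inter> R \<subseteq> {t}"
        using 1(1)[rule_format, of p' y] r True 1(2-) by blast
      have "path E u (r @ W1) s" using r s by (intro path_append[of _ _ _ y]) auto
      moreover have "W = (r @ W1) @ S @ W2" using r s by simp
      ultimately show ?thesis using s(3-) by blast
    qed
  qed
  then show thesis using that by blast
qed

text \<open>No edge of a path is a loop, so each is forward in exactly one of the two senses, and
  the two counts add up to the length.\<close>

lemma fwd_reverse:
  assumes "orients E D" "path E x p y"
  shows "fwd D (reverse p) \<longleftrightarrow> (fwd D p \<noteq> odd (length p))"
  using assms(2)
proof (induction p arbitrary: x)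
  case (Cons d p)
  obtain a e b where d: "d = (a, e, b)" by (cases d)
  have "{fst (D e), snd (D e)} = {a, b}" "a \<noteq> b" using Cons.prems assms(1) d by (auto simp: orients_def)
  then have "D e = (a, b) \<longleftrightarrow> D e \<noteq> (b, a)" by (cases "D e") (auto simp: doubleton_eq_iff)
  then show ?case using Cons d by auto
qed simp

lemma path_edge_between:
  assumes "path E x p y" "(a, e, b) \<in> set p" "{a, b} \<subseteq> {x, y}"
  shows "p = [(x, e, y)]"
proof -
  obtain p1 p2 where p: "p = p1 @ (a, e, b) # p2" using assms(2) split_list by metis
  then obtain "path E x p1 a" "path E b p2 y" "a \<noteq> b" "a \<notin> pverts p2" "meet_in p1 ((a,e,b)#p2) {a}"
    using assms(1) path_appendD by fastforce
  then show ?thesis using assms(3) p path_ends[of E x p1 a] path_ends[of E b p2 y]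
    by (cases "p1 = []"; cases "p2 = []") auto
qed

lemma path_distinct: "path E x p y \<Longrightarrow> distinct (map fst p) \<and> distinct (edge_list p) \<and> y \<notin> fst ` set p"
proof (induction p arbitrary: x)
  case (Cons d p)
  obtain a e b where d: "d = (a, e, b)" by (cases d)
  have "e \<notin> pedges p"
  proof
    assume "e \<in> pedges p"
    then obtain a' b' where m: "(a', e, b') \<in> set p" by (auto simp: pedges_def)
    then have "en e = {a', b'}" using Cons.prems d dart_ends path_walk by (metis path.simps(2))
    then have "a = a' \<or> a = b'" using Cons.prems d by auto
    then have "a \<in> pverts p" using dart_pverts[OF m] by auto
    then show False using Cons.prems d by auto
  qed
  moreover have "y \<noteq> a" using Cons.prems d path_ends[of E b p y] by (cases "p = []") auto
  ultimately show ?case using Cons d by (auto simp: pverts_def pedges_def)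
qed simp

text \<open>The path \<open>p\<close> followed by the reverse of \<open>q\<close> is an even
  circuit, and reversing \<open>q\<close> contributes the parity of its length. So parallel odd
  paths have equal forward parities and parallel even paths have different ones; this is the only
  way in which goodness is exploited later.\<close>

lemma good_cycle:
  assumes g: "good E D" and p: "path E x p y" and q: "path E x q y" and d: "meet_in p q {x, y}"
    and ev: "odd (length p) = odd (length q)" and xy: "x \<noteq> y"
  shows "fwd D p = fwd D q \<longleftrightarrow> odd (length q)"
\<comment> \<open>A common edge has both ends in \<open>{x, y}\<close>, so both paths consist of
  just this edge and the claim holds with length 1.\<close>
proof (cases "pedges p \<inter> pedges q = {}")
  case False
  then obtain e a b a' b' where m: "(a, e, b) \<in> set p" "(a', e, b') \<in> set q" by (auto simp: pedges_def)
  then have "{a, b} = {a', b'}" using dart_ends path_walk p q by metis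
  then have "a \<in> pverts p \<inter> pverts q" "b \<in> pverts p \<inter> pverts q"
    using dart_pverts[OF m(1)] dart_pverts[OF m(2)] by (simp_all, metis doubleton_eq_iff, metis doubleton_eq_iff)
  then have "{a, b} \<subseteq> {x, y}" using d by blast
  moreover have "{a', b'} \<subseteq> {x, y}" using calculation \<open>{a, b} = {a', b'}\<close> by simp
  ultimately have "p = [(x, e, y)]" "q = [(x, e, y)]" 
    using path_edge_between[OF p m(1)] path_edge_between[OF q m(2)] by simp_all
  then show ?thesis by auto
next
  case True
  have rq: "path E y (reverse q) x" using path_reverse q by auto
  have ne: "p \<noteq> []" "reverse q \<noteq> []" using p q xy path_Nil_iff by auto
  have "distinct (map fst (p @ reverse q))"
  proof -
    have "z \<noteq> x \<and> z \<noteq> y" if "z \<in> fst ` set p" "z \<in> fst ` set (reverse q)" for z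
      using that path_distinct[OF p] path_distinct[OF rq] by auto
    moreover have "z = x \<or> z = y" if "z \<in> fst ` set p" "z \<in> fst ` set (reverse q)" for z
    proof -
      have "z \<in> pverts p \<inter> pverts (reverse q)" using that by (auto simp: pverts_def simp del: pverts_reverse)
      then show ?thesis using d by auto
    qed
    ultimately show ?thesis using path_distinct[OF p] path_distinct[OF rq] by auto
  qed
  moreover have "distinct (edge_list (p @ reverse q))"
    using path_distinct[OF p] path_distinct[OF rq] True pedges_reverse[of q]
    by (auto simp: pedges_def simp del: pedges_reverse)
  moreover have "walk E x (p @ reverse q) x" using p rq path_walk walk_append by blast
  ultimately have "closed_path E x (p @ reverse q)" using ne by (simp add: closed_path_def)
  then have "fwd D (p @ reverse q)" using g ev unfolding good_def by (metis even_add length_append reverse_simps(4))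
  then show ?thesis using fwd_reverse[OF _ q, of D] g ev by (auto simp: good_def)
qed

end

section \<open>Exchanging ears\<close>

context incidence
begin

text \<open>Both conditions say that adding a \<open>uv\<close>-path of parity \<open>\<pi>\<close> outside \<open>E\<close> creates no obstruction:
  no even theta with branch vertices \<open>x, y\<close>, and no subdivided \<open>K\<^sub>4\<close> on \<open>x, x', y, y'\<close> with odd triangles
  in which the opposite paths \<open>A\<close> and \<open>C\<close> have different parities.\<close>

definition ear_cond :: "'e set \<Rightarrow> 'v \<Rightarrow> 'v \<Rightarrow> bool \<Rightarrow> bool" where
  "ear_cond E u v \<pi> \<longleftrightarrow> (\<forall>P q R S x y.
     path E u P x \<longrightarrow> path E x q y \<longrightarrow> path E x R y \<longrightarrow> path E y S v \<longrightarrow>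
     path E u (P @ q @ S) v \<longrightarrow> path E u (P @ R @ S) v \<longrightarrow> x \<noteq> y \<longrightarrow> meet_in q R {x, y} \<longrightarrow>
     odd (length (P @ q @ S)) = \<pi> \<longrightarrow> odd (length q) = odd (length R) \<longrightarrow> odd (length q))"

definition crossing_cond :: "'e set \<Rightarrow> 'v \<Rightarrow> 'v \<Rightarrow> bool \<Rightarrow> bool" where
  "crossing_cond E u v \<pi> \<longleftrightarrow> (\<forall>P A B C S R R' x x' y y'.
     path E u P x \<longrightarrow> path E x A x' \<longrightarrow> path E x' B y \<longrightarrow> path E y C y' \<longrightarrow> path E y' S v \<longrightarrow>
     path E u (P @ A @ B @ C @ S) v \<longrightarrow> path E x R y \<longrightarrow> path E x' R' y' \<longrightarrow>
     distinct [x, x', y, y'] \<longrightarrow>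
     meet_in R (P @ A @ B @ C @ S) {x, y} \<longrightarrow>
     meet_in R' (P @ A @ B @ C @ S) {x', y'} \<longrightarrow> pverts R \<inter> pverts R' = {} \<longrightarrow>
     odd (length (P @ A @ B @ C @ S)) = \<pi> \<longrightarrow>
     odd (length R) \<noteq> odd (length (A @ B)) \<longrightarrow> odd (length R') \<noteq> odd (length (B @ C)) \<longrightarrow>
     odd (length A) = odd (length C))"

text \<open>Among ears of equal parity \<open>ear_cond\<close> admits only odd ones, and these have
  equal forward parities by \<open>good_cycle\<close>.\<close>

lemma ear_exchange:
  assumes "ear_cond E u v \<pi>" "good E D"
    and "path E u P x" "path E x q y" "path E x R y" "path E y S v"
    and "path E u (P @ q @ S) v" "path E u (P @ R @ S) v" "x \<noteq> y" "meet_in q R {x, y}"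
    and "odd (length (P @ q @ S)) = \<pi>" "odd (length (P @ R @ S)) = \<pi>"
  shows "fwd D (P @ q @ S) = fwd D (P @ R @ S)"
proof -
  have l: "odd (length q) = odd (length R)" using assms(11,12) by auto
  have "odd (length q)"
    using assms(1)[unfolded ear_cond_def, rule_format, OF assms(3-11) l] .
  then have "fwd D q = fwd D R"
    using good_cycle[OF assms(2,4,5,10) l assms(9)] l by simp
  then show ?thesis by simp
qed

text \<open>The rerouted path runs through \<open>B\<close> backwards. The comparison is made on the
  circuit formed by \<open>A @ R'\<close> and \<open>R @ C\<close>, both from \<open>x\<close> to
  \<open>y'\<close>; it is even because \<open>crossing_cond\<close> gives \<open>A\<close> and
  \<open>C\<close> the same parity. Its contribution and the one from reversing \<open>B\<close>
  both depend on the parity of \<open>B\<close> alone, and they cancel.\<close>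

lemma crossing_exchange:
  assumes "crossing_cond E u v \<pi>" "good E D"
    and P: "path E u P x" and A: "path E x A x'" and B: "path E x' B y" and C: "path E y C y'"
    and S: "path E y' S v" and Q: "path E u (P @ A @ B @ C @ S) v" and R: "path E x R y"
    and R': "path E x' R' y'" and d: "distinct [x, x', y, y']"
    and i: "meet_in R (P @ A @ B @ C @ S) {x, y}"
      "meet_in R' (P @ A @ B @ C @ S) {x', y'}" "pverts R \<inter> pverts R' = {}"
    and l: "odd (length (P @ A @ B @ C @ S)) = \<pi>"
      "odd (length R) \<noteq> odd (length (A @ B))" "odd (length R') \<noteq> odd (length (B @ C))"
  shows "fwd D (P @ A @ B @ C @ S) = fwd D (P @ R @ reverse B @ R' @ S)"
    and "odd (length (P @ R @ reverse B @ R' @ S)) = \<pi>"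
proof -
  have ac: "odd (length A) = odd (length C)"
    using assms(1)[unfolded crossing_cond_def, rule_format, OF assms(3-17)] .
  show "odd (length (P @ R @ reverse B @ R' @ S)) = \<pi>" using l ac by auto
  have o: "orients E D" using assms(2) by (simp add: good_def)
  obtain y1 where y1: "path E x' B y1" "path E y1 (C @ S) v" "meet_in B (C @ S) {y1}" 
    using Q P A B by (metis path_appendI path_unique)
  have [simp]: "y1 = y" using y1 B path_unique by metis
  obtain x1 where x1: "path E x A x1" "path E x1 (B @ C @ S) v" "meet_in A (B @ C @ S) {x1}" 
    using Q P A by (metis path_appendI path_unique)
  have [simp]: "x1 = x'" using x1 A path_unique by metis
  have nc: "x' \<notin> pverts C" "y \<notin> pverts A" "pverts A \<inter> pverts C = {}" 
  proof -
    have "x' \<in> pverts B" "y \<in> pverts B" "y \<in> pverts C" "x' \<in> pverts A" using path_ends[OF B] path_ends[OF A] path_ends[OF C]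
      path_Nil_iff[OF A] path_Nil_iff[OF B] path_Nil_iff[OF C] d by auto
    then show "x' \<notin> pverts C" "y \<notin> pverts A" "pverts A \<inter> pverts C = {}" using y1(3) x1(3) d by auto
  qed
  have p: "path E x (A @ R') y'" 
    by (rule path_append[OF A R']) (use i(2) nc path_ends[OF C] path_Nil_iff[OF C] d in auto)
  have q: "path E x (R @ C) y'" 
    by (rule path_append[OF R C]) (use i(1) nc path_ends[OF A] path_Nil_iff[OF A] d in auto)
  have "meet_in (A @ R') (R @ C) {x, y'}" using i nc by auto
  then have "fwd D (A @ R') = fwd D (R @ C) \<longleftrightarrow> odd (length (R @ C))"
    using good_cycle[OF assms(2) p q] l ac d by auto
  moreover have "fwd D (reverse B) = (fwd D B \<noteq> odd (length B))" using fwd_reverse[OF o B] .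
  ultimately show "fwd D (P @ A @ B @ C @ S) = fwd D (P @ R @ reverse B @ R' @ S)"
    using l ac by auto
qed

lemma crossing_path:
  assumes P: "path E u P x" and A: "path E x A x'" and B: "path E x' B y" and C: "path E y C y'"
    and S: "path E y' S v" and Q: "path E u (P @ A @ B @ C @ S) v" and R: "path E x R y"
    and R': "path E x' R' y'" and d: "distinct [x, x', y, y']"
    and i: "meet_in R (P @ A @ B @ C @ S) {x, y}"
      "meet_in R' (P @ A @ B @ C @ S) {x', y'}" "pverts R \<inter> pverts R' = {}"
  shows "path E u (P @ R @ reverse B @ R' @ S) v"
proof -
  have ne: "A \<noteq> []" "B \<noteq> []" "C \<noteq> []" using d path_Nil_iff A B C by auto
  obtain z where z: "path E u P z" "path E z (A @ B @ C @ S) v" "meet_in P (A @ B @ C @ S) {z}"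
    using Q path_appendI by metis
  then have [simp]: "z = x" using path_unique P by metis
  obtain z' where z': "path E x A z'" "path E z' (B @ C @ S) v" "meet_in A (B @ C @ S) {z'}"
    using z(2) path_appendI by (metis \<open>z = x\<close>)
  then have [simp]: "z' = x'" using path_unique A by metis
  obtain w where w: "path E x' B w" "path E w (C @ S) v" "meet_in B (C @ S) {w}"
    using z'(2) path_appendI by (metis \<open>z' = x'\<close>)
  then have [simp]: "w = y" using path_unique B by metis
  obtain t where t: "path E y C t" "path E t S v" "meet_in C S {t}"
    using w(2) path_appendI by (metis \<open>w = y\<close>)
  then have [simp]: "t = y'" using path_unique C by metis
  have e: "x \<in> pverts A" "x' \<in> pverts A" "x' \<in> pverts B" "y \<in> pverts B" "y \<in> pverts C" "y' \<in> pverts C"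
    using path_ends[OF A] path_ends[OF B] path_ends[OF C] ne by auto
  have 1: "path E x' (R' @ S) v" by (rule path_append[OF R' S]) (use i e t w z' d in auto)
  have 2: "path E y (reverse B @ R' @ S) v" 
    by (rule path_append[OF path_reverse[OF B] 1]) (use i e t w z' d in auto)
  have 3: "path E x (R @ reverse B @ R' @ S) v"
    by (rule path_append[OF R 2]) (use i e t w z' d in auto)
  show ?thesis by (rule path_append[OF P 3]) (use i e t w z z' d in auto)
qed

end

section \<open>Two odd beads\<close>

context incidence
begin

lemma path3:
  assumes "path E u P x" "path E x q y" "path E y S v" "x \<noteq> y"
    "meet_in P q {x}" "meet_in P S {}" "meet_in q S {y}"
  shows "path E u (P @ q @ S) v"
  by (rule path_append[OF assms(1) path_append[OF assms(2,3,7)]]) (use assms in auto)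

end

text \<open>These rules turn an intersection fact about whole paths into facts about their pieces,
  in either order. The \<open>drop\<close> versions also remove an end vertex that one of the pieces
  misses.\<close>

lemma Int_subset_mono1: "A \<inter> B \<subseteq> X \<Longrightarrow> A' \<subseteq> A \<Longrightarrow> B' \<subseteq> B \<Longrightarrow> X \<subseteq> Y \<Longrightarrow> A' \<inter> B' \<subseteq> Y"
  by blast

lemma Int_subset_mono2: "A \<inter> B \<subseteq> X \<Longrightarrow> A' \<subseteq> A \<Longrightarrow> B' \<subseteq> B \<Longrightarrow> X \<subseteq> Y \<Longrightarrow> B' \<inter> A' \<subseteq> Y"
  by blast

lemma Int_notin1: "A \<inter> B \<subseteq> X \<Longrightarrow> a \<in> A \<Longrightarrow> a \<notin> X \<Longrightarrow> a \<notin> B"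
  by blast

lemma Int_notin2: "A \<inter> B \<subseteq> X \<Longrightarrow> a \<in> B \<Longrightarrow> a \<notin> X \<Longrightarrow> a \<notin> A"
  by blast

lemma Int_subset_drop1: "A \<inter> B \<subseteq> X \<Longrightarrow> A' \<subseteq> A \<Longrightarrow> B' \<subseteq> B \<Longrightarrow> c \<notin> A' \<or> c \<notin> B' \<Longrightarrow> X \<subseteq> insert c Y \<Longrightarrow> A' \<inter> B' \<subseteq> Y"
  by blast

lemma Int_subset_drop2: "A \<inter> B \<subseteq> X \<Longrightarrow> A' \<subseteq> A \<Longrightarrow> B' \<subseteq> B \<Longrightarrow> c \<notin> A' \<or> c \<notin> B' \<Longrightarrow> X \<subseteq> insert c Y \<Longrightarrow> B' \<inter> A' \<subseteq> Y"
  by blast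

text \<open>The chain from \<open>u\<close> to \<open>v\<close> is \<open>P\<close>, the bead \<open>q, R\<close>, \<open>M\<close>, the bead \<open>q', R'\<close>, \<open>S\<close>. Since empty paths have
  no vertices here, the beads touch in \<open>y = x'\<close> if \<open>M\<close> is empty.\<close>

locale beads = incidence en for en :: "'e \<Rightarrow> 'v set" +
  fixes E :: "'e set" and D :: "'e \<Rightarrow> 'v \<times> 'v" and u v :: 'v and \<pi> :: bool
    and P q R M q' R' S :: "('v, 'e) dart list" and x y x' y' :: 'v
  assumes ear: "ear_cond E u v \<pi>" and crossing: "crossing_cond E u v \<pi>" and good: "good E D"
    and pP: "path E u P x" and pq: "path E x q y" and pR: "path E x R y" and pM: "path E y M x'"
    and pq': "path E x' q' y'" and pR': "path E x' R' y'" and pS: "path E y' S v"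
    and xy: "x \<noteq> y" "x' \<noteq> y'"
    and dP: "meet_in P q {x}" "meet_in P R {x}" "meet_in P M {}"
      "meet_in P q' {}" "meet_in P R' {}" "meet_in P S {}"
    and dq: "meet_in q R {x, y}" "meet_in q M {y}"
      "meet_in q q' {y}" "meet_in q q' {x'}"
      "meet_in q R' {y}" "meet_in q R' {x'}" "meet_in q S {}"
    and dR: "meet_in R M {y}"
      "meet_in R q' {y}" "meet_in R q' {x'}"
      "meet_in R R' {y}" "meet_in R R' {x'}" "meet_in R S {}"
    and dM: "meet_in M q' {x'}" "meet_in M R' {x'}" "meet_in M S {}"
    and dq': "meet_in q' R' {x', y'}" "meet_in q' S {y'}" "meet_in R' S {y'}"
    and l: "odd (length q) \<noteq> odd (length R)" "odd (length q') \<noteq> odd (length R')"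
      "odd (length (P @ q @ M @ q' @ S)) = \<pi>"
begin

lemmas table = dP dq dR dM dq'

text \<open>The ear move with its path conditions replaced by pairwise intersections, the form in
  which the locale supplies them.\<close>

lemma ears:
  assumes "path E u P' a" "path E a r b" "path E a r' b" "path E b S' v" "a \<noteq> b"
    "meet_in P' r {a}" "meet_in P' r' {a}" "meet_in P' S' {}"
    "meet_in r S' {b}" "meet_in r' S' {b}" "meet_in r r' {a, b}"
    "odd (length (P' @ r @ S')) = \<pi>" "odd (length (P' @ r' @ S')) = \<pi>"
  shows "fwd D (P' @ r @ S') = fwd D (P' @ r' @ S')"
  using assms by (intro ear_exchange[OF ear good assms(1-4) _ _ assms(5,11)] path3[where x=a and y=b])

lemma crossings:
  assumes "path E u P' a" "path E a A a'" "path E a' B b" "path E b C b'" "path E b' S' v"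
    "path E a r b" "path E a' r' b'" "a \<noteq> a'" "a \<noteq> b" "a \<noteq> b'" "a' \<noteq> b" "a' \<noteq> b'" "b \<noteq> b'"
    "meet_in P' A {a}" "meet_in P' B {}" "meet_in P' C {}" "meet_in P' S' {}"
    "meet_in A B {a'}" "meet_in A C {}" "meet_in A S' {}"
    "meet_in B C {b}" "meet_in B S' {}" "meet_in C S' {b'}"
    "meet_in r (P' @ A @ B @ C @ S') {a, b}"
    "meet_in r' (P' @ A @ B @ C @ S') {a', b'}" "meet_in r r' {}"
    "odd (length (P' @ A @ B @ C @ S')) = \<pi>"
    "odd (length r) \<noteq> odd (length (A @ B))" "odd (length r') \<noteq> odd (length (B @ C))"
  shows "fwd D (P' @ A @ B @ C @ S') = fwd D (P' @ r @ reverse B @ r' @ S')"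
proof -
  have "path E u (P' @ A @ B @ C @ S') v"
    by (intro path_append[OF assms(1)] path_append[OF assms(2)] path_append[OF assms(3)]
        path_append[OF assms(4) assms(5)]) (use assms in \<open>simp_all add: Int_Un_distrib\<close>)
  moreover have "distinct [a, a', b, b']" "pverts r \<inter> pverts r' = {}" using assms by auto
  ultimately show ?thesis
    by (rule crossing_exchange(1)[OF crossing good assms(1-5) _ assms(6,7) _ assms(24,25) _ assms(27-29)])
qed

lemma ne: "q \<noteq> []" "R \<noteq> []" "q' \<noteq> []" "R' \<noteq> []"
  using path_Nil_iff[OF pq] path_Nil_iff[OF pR] path_Nil_iff[OF pq'] path_Nil_iff[OF pR'] xy by auto

lemma ends: "x \<in> pverts q" "y \<in> pverts q" "x \<in> pverts R" "y \<in> pverts R"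
  "x' \<in> pverts q'" "y' \<in> pverts q'" "x' \<in> pverts R'" "y' \<in> pverts R'"
  using path_ends[OF pq] path_ends[OF pR] path_ends[OF pq'] path_ends[OF pR'] ne by auto

lemmas notin = table[THEN Int_notin1] table[THEN Int_notin2]

lemma points: "x \<noteq> x'" "x \<noteq> y'" "y \<noteq> y'" "y \<notin> pverts P" "x' \<notin> pverts P" "x \<notin> pverts M" "y' \<notin> pverts M"
  "x \<notin> pverts q'" "x \<notin> pverts R'" "x \<notin> pverts S" "y \<notin> pverts S" "x' \<notin> pverts S" "y' \<notin> pverts P"
  "y' \<notin> pverts q" "y' \<notin> pverts R"
proof -
  show 1: "x \<notin> pverts M" "y' \<notin> pverts M" "y \<notin> pverts P" "x' \<notin> pverts P" "x \<notin> pverts S" "y \<notin> pverts S"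
    "x' \<notin> pverts S" "y' \<notin> pverts P" "x \<notin> pverts q'" "x \<notin> pverts R'" "y' \<notin> pverts q" "y' \<notin> pverts R"
    by (rule notin; (use ends xy in \<open>simp; fail\<close>))+
  show "x \<noteq> x'" "x \<noteq> y'" "y \<noteq> y'" using 1 ends by auto
qed

text \<open>Switching both beads at once changes the length parity twice, so the chain keeps its
  parity. This symmetry halves the case analysis below.\<close>

lemma bead_sym: "beads en E D u v \<pi> P R q M R' q' S x y x' y'"
proof -
  have "odd (length (P @ R @ M @ R' @ S)) = \<pi>" using l by (simp, argo)
  then show ?thesis
    by unfold_locales (use ear crossing good pP pq pR pM pq' pR' pS xy table l in \<open>simp_all add: Int_commute\<close>)
qed

section \<open>Cutting the pieces of the chain at the ends of a bypass\<close>

lemma split_P: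
  assumes "s \<in> insert x (pverts P)"
  obtains Pa Pb where "P = Pa @ Pb" "path E u Pa s" "path E s Pb x" "meet_in Pa Pb {s}"
    "meet_in Pa q {s}" "meet_in Pa R {s}"
proof -
  obtain Pa Pb where s: "P = Pa @ Pb" "path E u Pa s" "path E s Pb x" "meet_in Pa Pb {s}"
  proof (cases "s = x")
    case True
    then show thesis using that[of P "[]"] pP by simp
  next
    case False
    then show thesis using path_split[OF pP] assms that by blast
  qed
  have "x \<in> pverts Pa \<Longrightarrow> x = s" using s path_ends[OF s(3)] path_Nil_iff[OF s(3)] by blast
  then show thesis using that[OF s] dP s by auto
qed

lemma split_q:
  assumes "s \<in> pverts q" "s \<noteq> x" "s \<noteq> y"
  obtains qa qb where "q = qa @ qb" "path E x qa s" "path E s qb y" "meet_in qa qb {s}"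
    "meet_in P qb {}" "meet_in qa R {x}" "meet_in qb R {y}"
    "meet_in qa M {}" "meet_in qa q' {}" "meet_in qa R' {}"
proof -
  obtain qa qb where s: "q = qa @ qb" "path E x qa s" "path E s qb y" "meet_in qa qb {s}"
    using path_split[OF pq] assms by blast
  have "x \<in> pverts qa" "y \<in> pverts qb"
    using path_ends[OF s(2)] path_ends[OF s(3)] path_Nil_iff[OF s(2)] path_Nil_iff[OF s(3)] assms by auto
  then have n: "x \<notin> pverts qb" "y \<notin> pverts qa" using s(4) assms by auto
  have i: "pverts qa \<subseteq> pverts q" "pverts qb \<subseteq> pverts q" using s(1) by auto
  show thesis
    by (rule that[OF s]; (rule table[THEN Int_subset_drop1[where c=x]] table[THEN Int_subset_drop1[where c=y]]
          table[THEN Int_subset_drop2[where c=x]] table[THEN Int_subset_drop2[where c=y]]; (use i n in \<open>simp; fail\<close>)))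
qed

text \<open>The condition \<open>t \<noteq> y\<close> forces \<open>Ma\<close> to be nonempty. Hence
  \<open>M\<close> is nonempty, the two beads do not touch, and the rest \<open>Mb\<close> is
  shorter, as the induction on \<open>length M\<close> requires.\<close>

lemma split_M:
  assumes "t \<in> insert x' (pverts M)" "t \<noteq> y"
  obtains Ma Mb where "M = Ma @ Mb" "path E y Ma t" "path E t Mb x'" "meet_in Ma Mb {t}"
    "meet_in Mb q {}" "meet_in Mb R {}" "meet_in Ma q' {t}" "meet_in Ma R' {t}"
    "meet_in q q' {}" "meet_in R q' {}" "meet_in q R' {}" "meet_in R R' {}"
    "length Mb < length M"
proof -
  obtain Ma Mb where s: "M = Ma @ Mb" "path E y Ma t" "path E t Mb x'" "meet_in Ma Mb {t}"
  proof (cases "t = x'")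
    case True
    then show thesis using that[of M "[]"] pM by simp
  next
    case False
    then show thesis using path_split[OF pM] assms that by blast
  qed
  have "Ma \<noteq> []" using path_Nil_iff[OF s(2)] assms by auto
  then have a: "y \<in> pverts Ma" "length Mb < length M" using path_ends[OF s(2)] s(1) by auto
  then have b: "y \<notin> pverts Mb" using s(4) assms by auto
  have "y \<noteq> x'" using \<open>Ma \<noteq> []\<close> path_Nil_iff[OF pM] s(1) by auto
  then have "c \<in> pverts q \<inter> pverts q' \<Longrightarrow> False" "c \<in> pverts R \<inter> pverts q' \<Longrightarrow> False"
    "c \<in> pverts q \<inter> pverts R' \<Longrightarrow> False" "c \<in> pverts R \<inter> pverts R' \<Longrightarrow> False" for c
    using dq(3-6) dR(2-5) by (metis singletonD subsetD)+
  then have 1: "meet_in q q' {}" "meet_in R q' {}" "meet_in q R' {}" "meet_in R R' {}"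
    by blast+
  have c: "x' \<in> pverts Ma \<Longrightarrow> x' = t" using s path_ends[OF s(3)] path_Nil_iff[OF s(3)] by blast
  have "meet_in Mb q {}" "meet_in Mb R {}"
    using b dq(2) dR(1) s(1) by auto
  moreover have "meet_in Ma q' {t}" "meet_in Ma R' {t}" using c dM s(1) by auto
  ultimately show thesis by (rule that[OF s _ _ _ _ 1 a(2)])
qed

lemma split_q':
  assumes "t \<in> pverts q'" "t \<noteq> x'" "t \<noteq> y'"
  obtains ta tb where "q' = ta @ tb" "path E x' ta t" "path E t tb y'" "meet_in ta tb {t}"
    "meet_in ta S {}" "meet_in ta R' {x'}" "meet_in tb R' {y'}"
    "meet_in tb M {}" "meet_in tb q {}" "meet_in tb R {}"
proof -
  obtain ta tb where s: "q' = ta @ tb" "path E x' ta t" "path E t tb y'" "meet_in ta tb {t}"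
    using path_split[OF pq'] assms by blast
  have "x' \<in> pverts ta" "y' \<in> pverts tb"
    using path_ends[OF s(2)] path_ends[OF s(3)] path_Nil_iff[OF s(2)] path_Nil_iff[OF s(3)] assms by auto
  then have n: "x' \<notin> pverts tb" "y' \<notin> pverts ta" using s(4) assms by auto
  have i: "pverts ta \<subseteq> pverts q'" "pverts tb \<subseteq> pverts q'" using s(1) by auto
  show thesis
    by (rule that[OF s]; (rule table[THEN Int_subset_drop1[where c=x']] table[THEN Int_subset_drop1[where c=y']]
          table[THEN Int_subset_drop2[where c=x']] table[THEN Int_subset_drop2[where c=y']]; (use i n in \<open>simp; fail\<close>)))
qed

lemma split_S:
  assumes "t \<in> insert y' (pverts S)"
  obtains Sa Sb where "S = Sa @ Sb" "path E y' Sa t" "path E t Sb v" "meet_in Sa Sb {t}"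
    "meet_in Sb q' {t}" "meet_in Sb R' {t}"
proof -
  obtain Sa Sb where s: "S = Sa @ Sb" "path E y' Sa t" "path E t Sb v" "meet_in Sa Sb {t}"
    using path_split[OF pS assms] by blast
  have "y' \<in> pverts Sb \<Longrightarrow> y' = t" using s path_ends[OF s(2)] path_Nil_iff[OF s(2)] by blast
  then show thesis using that[OF s] dq' s by auto
qed

text \<open>The pieces before \<open>y\<close> are \<open>P\<close>, \<open>q\<close>,
  \<open>R\<close>; those after it are \<open>M\<close>, \<open>q'\<close>, \<open>R'\<close>,
  \<open>S\<close>. A bypass jumps from the first group to the second without using
  \<open>y\<close>, the only vertex that the groups can share.\<close>

definition bypass :: "'v \<Rightarrow> ('v, 'e) dart list \<Rightarrow> 'v \<Rightarrow> bool" where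
  "bypass s T t \<longleftrightarrow> path E s T t \<and> y \<notin> pverts T \<and> s \<noteq> t \<and> s \<noteq> y \<and> t \<noteq> y \<and>
     pverts T \<inter> (pverts P \<union> pverts q \<union> pverts R) \<subseteq> {s} \<and>
     pverts T \<inter> (pverts M \<union> pverts q' \<union> pverts R' \<union> pverts S) \<subseteq> {t}"

lemma bypass_all:
  assumes "bypass s T t"
  shows "path E s T t" "s \<noteq> t" "s \<noteq> y" "t \<noteq> y" "meet_in T P {s}"
    "meet_in T q {s}" "meet_in T R {s}" "meet_in T M {t}"
    "meet_in T q' {t}" "meet_in T R' {t}" "meet_in T S {t}"
    "s \<in> pverts T" "t \<in> pverts T"
  using assms path_ends[of E s T t] path_Nil_iff[of E s T t] by (auto simp: bypass_def)

lemma bypass_from_P: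
  assumes "bypass s T t" "s \<in> insert x (pverts P)"
  shows "meet_in T q {x}" "meet_in T R {x}"
    "s \<noteq> x'" "s \<noteq> y'" "s \<notin> pverts M" "s \<notin> pverts q'" "s \<notin> pverts S" "s \<notin> pverts R'"
proof -
  have "s \<in> pverts q \<or> s \<in> pverts R \<Longrightarrow> s = x" using assms(2) dP(1,2) by auto
  then show "meet_in T q {x}" "meet_in T R {x}" using bypass_all(6,7)[OF assms(1)] by auto
  show "s \<noteq> x'" "s \<noteq> y'" using assms(2) points by auto
  show "s \<notin> pverts M" "s \<notin> pverts q'" "s \<notin> pverts S" "s \<notin> pverts R'"
    using assms(2) points(6,8-10) dP(3-6) by auto
qed

lemma bypass_from_q:
  assumes "bypass s T t" "s \<in> pverts q" "s \<noteq> x"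
  shows "meet_in T P {}" "meet_in T R {}"
    "s \<noteq> x'" "s \<noteq> y'"
proof -
  have "s \<notin> pverts P" "s \<notin> pverts R" using bypass_all(3)[OF assms(1)] assms(2,3) dP dq by auto
  then show "meet_in T P {}" "meet_in T R {}" using bypass_all[OF assms(1)] by auto
  show "s \<noteq> x'" using bypass_all(3)[OF assms(1)] assms(2) dq(3) ends by auto
  show "s \<noteq> y'" using assms points by auto
qed

lemma bypass_to_M:
  assumes "bypass s T t" "t \<in> insert x' (pverts M)"
  shows "meet_in T q' {x'}" "meet_in T R' {x'}" "meet_in T S {}" "t \<noteq> x" "t \<noteq> y'"
proof -
  have "t \<in> pverts q' \<or> t \<in> pverts R' \<Longrightarrow> t = x'" using assms(2) dM(1,2) by auto
  then show "meet_in T q' {x'}" "meet_in T R' {x'}" using bypass_all(9,10)[OF assms(1)] by auto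
  have "t \<notin> pverts S" using assms(2) points dM(3) by auto
  then show "meet_in T S {}" using bypass_all(11)[OF assms(1)] by auto
  show "t \<noteq> x" "t \<noteq> y'" using assms(2) points xy by auto
qed

lemma bypass_to_q':
  assumes "bypass s T t" "t \<in> pverts q'" "t \<noteq> x'" "t \<noteq> y'"
  shows "meet_in T M {}" "meet_in T R' {}" "meet_in T S {}" "t \<noteq> x"
proof -
  have "t \<notin> pverts M" "t \<notin> pverts R'" "t \<notin> pverts S" using assms(2-) dM(1) dq'(1,2) by auto
  then show "meet_in T M {}" "meet_in T R' {}" "meet_in T S {}"
    using bypass_all(8,10,11)[OF assms(1)] by auto
  show "t \<noteq> x" using assms(2) points by auto
qed

lemma bypass_to_S:
  assumes "bypass s T t" "t \<in> insert y' (pverts S)"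
  shows "meet_in T M {}" "meet_in T q' {y'}" "meet_in T R' {y'}" "t \<noteq> x" "t \<noteq> x'"
proof -
  have "t \<notin> pverts M" using assms(2) points dM(3) by auto
  then show "meet_in T M {}" using bypass_all(8)[OF assms(1)] by auto
  have "t \<in> pverts q' \<or> t \<in> pverts R' \<Longrightarrow> t = y'" using assms(2) dq'(2,3) by auto
  then show "meet_in T q' {y'}" "meet_in T R' {y'}" using bypass_all(9,10)[OF assms(1)] by auto
  show "t \<noteq> x" "t \<noteq> x'" using assms(2) points xy by auto
qed

section \<open>Rerouting the chain through a bypass\<close>

abbreviation "claim \<equiv> fwd D (P @ q @ M @ q' @ S) = fwd D (P @ R @ M @ R' @ S)"

lemma bypass_sym: "bypass s T t \<Longrightarrow> beads.bypass en E P R q M R' q' S y s T t"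
  using bead_sym by (auto simp: bypass_def beads.bypass_def)

text \<open>If the route \<open>P @ qa @ T @ tb @ S\<close> has parity \<open>\<pi>\<close>, both
  chains reach it by one ear move each. Otherwise replacing \<open>tb\<close> by
  \<open>reverse ta @ R'\<close> corrects the parity, as \<open>q'\<close> and \<open>R'\<close>
  differ in parity; the second chain reaches this route by an ear move, the first by a crossing move
  with the ears \<open>T\<close> and \<open>R'\<close>.\<close>

lemma bypass_q_q':
  assumes T: "bypass s T t" and s: "s \<in> pverts q" "s \<noteq> x" and t: "t \<in> pverts q'" "t \<noteq> x'" "t \<noteq> y'"
  shows claim
proof -
  note b = bypass_all[OF T] bypass_from_q[OF T s] bypass_to_q'[OF T t]
  obtain qa qb where q: "q = qa @ qb" and pqa: "path E x qa s" and pqb: "path E s qb y"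
    and dqa: "meet_in qa qb {s}"
      "meet_in P qb {}" "meet_in qa R {x}" "meet_in qb R {y}"
      "meet_in qa M {}" "meet_in qa q' {}" "meet_in qa R' {}"
    by (rule split_q[OF s b(3)])
  obtain ta tb where q': "q' = ta @ tb" and pta: "path E x' ta t" and ptb: "path E t tb y'"
    and dta: "meet_in ta tb {t}"
      "meet_in ta S {}" "meet_in ta R' {x'}" "meet_in tb R' {y'}"
      "meet_in tb M {}" "meet_in tb q {}" "meet_in tb R {}"
    by (rule split_q'[OF t])
  note paths = pP pq pR pM pq' pR' pS b(1) pqa pqb path_reverse[OF pqb] pta ptb path_reverse[OF pta]
  note F = dqa dta b(5-11,14,15,18-20) table
  note meets = F[THEN Int_subset_mono1] F[THEN Int_subset_mono2]
  note distinct = xy points(1-3) b(2-4,16,17,21) s(2) t(2,3)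
  show ?thesis
  proof (cases "odd (length (P @ qa @ T @ tb @ S)) = \<pi>")
    case True
    have "fwd D ((P @ qa) @ (qb @ M @ ta) @ (tb @ S)) = fwd D ((P @ qa) @ T @ (tb @ S))"
      by (rule ears[of _ s _ t]; (intro paths[THEN path_append] paths)?; (simp only: pverts_distrib)?; (intro conjI)?)
        ((rule meets; (simp add: q q'; fail))
          | rule distinct distinct[THEN not_sym]
          | (use l True in \<open>simp (no_asm_use) add: q q'; satx\<close>))+
    moreover have "fwd D (P @ (R @ M @ R') @ S) = fwd D (P @ (qa @ T @ tb) @ S)"
      by (rule ears[of _ x _ y']; (intro paths[THEN path_append] paths)?; (simp only: pverts_distrib)?; (intro conjI)?)
        ((rule meets; (simp add: q q'; fail))
          | rule distinct distinct[THEN not_sym]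
          | (use l True in \<open>simp (no_asm_use) add: q q'; satx\<close>))+
    ultimately show ?thesis by (simp add: q q')
  next
    case False
    have "fwd D (P @ (R @ M) @ (R' @ S)) = fwd D (P @ (qa @ T @ reverse ta) @ (R' @ S))"
      by (rule ears[of _ x _ x']; (intro paths[THEN path_append] paths)?; (simp only: pverts_distrib)?; (intro conjI)?)
        ((rule meets; (simp add: q q'; fail))
          | rule distinct distinct[THEN not_sym]
          | (use l False in \<open>simp (no_asm_use) add: q q'; satx\<close>))+
    moreover have "fwd D ((P @ qa) @ (qb @ M) @ ta @ tb @ S) = fwd D ((P @ qa) @ T @ reverse ta @ R' @ S)"
      by (rule crossings[of _ s _ x' _ t _ y']; (intro paths[THEN path_append] paths)?; (simp only: pverts_distrib)?; (intro conjI)?)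
        ((rule meets; (simp add: q q'; fail))
          | rule distinct distinct[THEN not_sym]
          | (use l False in \<open>simp (no_asm_use) add: q q'; satx\<close>))+
    ultimately show ?thesis by (simp add: q q')
  qed
qed

text \<open>As for \<open>bypass_q_q'\<close>, but now \<open>T\<close> ends on the other chain.
  With the wrong parity the common route is \<open>P @ qa @ T @ reverse ta @ q' @ S\<close>, and the
  crossing move is applied to the second chain.\<close>

lemma bypass_q_R':
  assumes T: "bypass s T t" and s: "s \<in> pverts q" "s \<noteq> x" and t: "t \<in> pverts R'" "t \<noteq> x'" "t \<noteq> y'"
  shows claim
proof -
  note b = bypass_all[OF T] bypass_from_q[OF T s] beads.bypass_to_q'[OF bead_sym bypass_sym[OF T] t]
  obtain qa qb where q: "q = qa @ qb" and pqa: "path E x qa s" and pqb: "path E s qb y"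
    and dqa: "meet_in qa qb {s}"
      "meet_in P qb {}" "meet_in qa R {x}" "meet_in qb R {y}"
      "meet_in qa M {}" "meet_in qa q' {}" "meet_in qa R' {}"
    by (rule split_q[OF s b(3)])
  obtain ta tb where R': "R' = ta @ tb" and pta: "path E x' ta t" and ptb: "path E t tb y'"
    and dta: "meet_in ta tb {t}"
      "meet_in ta S {}" "meet_in ta q' {x'}" "meet_in tb q' {y'}"
      "meet_in tb M {}" "meet_in tb R {}" "meet_in tb q {}"
    by (rule beads.split_q'[OF bead_sym t])
  note paths = pP pq pR pM pq' pR' pS b(1) pqa pqb path_reverse[OF pqb] pta ptb path_reverse[OF pta]
  note F = dqa dta b(5-11,14,15,18-20) table
  note meets = F[THEN Int_subset_mono1] F[THEN Int_subset_mono2]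
  note distinct = xy points(1-3) b(2-4,16,17,21) s(2) t(2,3)
  show ?thesis
  proof (cases "odd (length (P @ qa @ T @ tb @ S)) = \<pi>")
    case True
    have "fwd D ((P @ qa) @ (qb @ M @ q') @ S) = fwd D ((P @ qa) @ (T @ tb) @ S)"
      by (rule ears[of _ s _ y']; (intro paths[THEN path_append] paths)?; (simp only: pverts_distrib)?; (intro conjI)?)
        ((rule meets; (simp add: q R'; fail))
          | rule distinct distinct[THEN not_sym]
          | (use l True in \<open>simp (no_asm_use) add: q R'; satx\<close>))+
    moreover have "fwd D (P @ (R @ M @ ta) @ (tb @ S)) = fwd D (P @ (qa @ T) @ (tb @ S))"
      by (rule ears[of _ x _ t]; (intro paths[THEN path_append] paths)?; (simp only: pverts_distrib)?; (intro conjI)?)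
        ((rule meets; (simp add: q R'; fail))
          | rule distinct distinct[THEN not_sym]
          | (use l True in \<open>simp (no_asm_use) add: q R'; satx\<close>))+
    ultimately show ?thesis by (simp add: q R')
  next
    case False
    have "fwd D ((P @ qa) @ (qb @ M) @ (q' @ S)) = fwd D ((P @ qa) @ (T @ reverse ta) @ (q' @ S))"
      by (rule ears[of _ s _ x']; (intro paths[THEN path_append] paths)?; (simp only: pverts_distrib)?; (intro conjI)?)
        ((rule meets; (simp add: q R'; fail))
          | rule distinct distinct[THEN not_sym]
          | (use l False in \<open>simp (no_asm_use) add: q R'; satx\<close>))+
    moreover have "fwd D (P @ (R @ M) @ ta @ tb @ S) = fwd D (P @ (qa @ T) @ reverse ta @ q' @ S)"
      by (rule crossings[of _ x _ x' _ t _ y']; (intro paths[THEN path_append] paths)?; (simp only: pverts_distrib)?; (intro conjI)?)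
        ((rule meets; (simp add: q R'; fail))
          | rule distinct distinct[THEN not_sym]
          | (use l False in \<open>simp (no_asm_use) add: q R'; satx\<close>))+
    ultimately show ?thesis by (simp add: q R')
  qed
qed

text \<open>With the wrong parity the correction is made at the first bead: the common route is
  \<open>P @ R @ reverse qb @ T @ Sb\<close>, reached from the first chain by crossing the ears
  \<open>R\<close> and \<open>T\<close>.\<close>

lemma bypass_q_S:
  assumes T: "bypass s T t" and s: "s \<in> pverts q" "s \<noteq> x" and t: "t \<in> insert y' (pverts S)"
  shows claim
proof -
  note b = bypass_all[OF T] bypass_from_q[OF T s] bypass_to_S[OF T t]
  obtain qa qb where q: "q = qa @ qb" and pqa: "path E x qa s" and pqb: "path E s qb y"
    and dqa: "meet_in qa qb {s}"
      "meet_in P qb {}" "meet_in qa R {x}" "meet_in qb R {y}"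
      "meet_in qa M {}" "meet_in qa q' {}" "meet_in qa R' {}"
    by (rule split_q[OF s b(3)])
  obtain Sa Sb where S: "S = Sa @ Sb" and pSa: "path E y' Sa t" and pSb: "path E t Sb v"
    and dSa: "meet_in Sa Sb {t}" "meet_in Sb q' {t}" "meet_in Sb R' {t}"
    by (rule split_S[OF t])
  note paths = pP pq pR pM pq' pR' pS b(1) pqa pqb path_reverse[OF pqb] pSa pSb
  note F = dqa dSa b(5-11,14,15,18-20) table
  note meets = F[THEN Int_subset_mono1] F[THEN Int_subset_mono2]
  note distinct = xy points(1-3) b(2-4,16,17,21,22) s(2) 
  show ?thesis
  proof (cases "odd (length (P @ qa @ T @ Sb)) = \<pi>")
    case True
    have "fwd D ((P @ qa) @ (qb @ M @ q' @ Sa) @ Sb) = fwd D ((P @ qa) @ T @ Sb)"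
      by (rule ears[of _ s _ t]; (intro paths[THEN path_append] paths)?; (simp only: pverts_distrib)?; (intro conjI)?)
        ((rule meets; (simp add: q S; fail))
          | rule distinct distinct[THEN not_sym]
          | (use l True in \<open>simp (no_asm_use) add: q S; satx\<close>))+
    moreover have "fwd D (P @ (R @ M @ R' @ Sa) @ Sb) = fwd D (P @ (qa @ T) @ Sb)"
      by (rule ears[of _ x _ t]; (intro paths[THEN path_append] paths)?; (simp only: pverts_distrib)?; (intro conjI)?)
        ((rule meets; (simp add: q S; fail))
          | rule distinct distinct[THEN not_sym]
          | (use l True in \<open>simp (no_asm_use) add: q S; satx\<close>))+
    ultimately show ?thesis by (simp add: q S)
  next
    case False
    have "fwd D ((P @ R) @ (M @ R' @ Sa) @ Sb) = fwd D ((P @ R) @ (reverse qb @ T) @ Sb)"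
      by (rule ears[of _ y _ t]; (intro paths[THEN path_append] paths)?; (simp only: pverts_distrib)?; (intro conjI)?)
        ((rule meets; (simp add: q S; fail))
          | rule distinct distinct[THEN not_sym]
          | (use l False in \<open>simp (no_asm_use) add: q S; satx\<close>))+
    moreover have "fwd D (P @ qa @ qb @ (M @ q' @ Sa) @ Sb) = fwd D (P @ R @ reverse qb @ T @ Sb)"
      by (rule crossings[of _ x _ s _ y _ t]; (intro paths[THEN path_append] paths)?; (simp only: pverts_distrib)?; (intro conjI)?)
        ((rule meets; (simp add: q S; fail))
          | rule distinct distinct[THEN not_sym]
          | (use l False in \<open>simp (no_asm_use) add: q S; satx\<close>))+
    ultimately show ?thesis by (simp add: q S)
  qed
qed

text \<open>The same scheme with \<open>T\<close> starting before the first bead; a wrong parity is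
  corrected at the second bead.\<close>

lemma bypass_P_q':
  assumes T: "bypass s T t" and s: "s \<in> insert x (pverts P)" and t: "t \<in> pverts q'" "t \<noteq> x'" "t \<noteq> y'"
  shows claim
proof -
  note b = bypass_all[OF T] bypass_from_P[OF T s] bypass_to_q'[OF T t]
  obtain Pa Pb where P: "P = Pa @ Pb" and pPa: "path E u Pa s" and pPb: "path E s Pb x"
    and dPa: "meet_in Pa Pb {s}" "meet_in Pa q {s}" "meet_in Pa R {s}"
    by (rule split_P[OF s])
  obtain ta tb where q': "q' = ta @ tb" and pta: "path E x' ta t" and ptb: "path E t tb y'"
    and dta: "meet_in ta tb {t}"
      "meet_in ta S {}" "meet_in ta R' {x'}" "meet_in tb R' {y'}"
      "meet_in tb M {}" "meet_in tb q {}" "meet_in tb R {}"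
    by (rule split_q'[OF t])
  note paths = pP pq pR pM pq' pR' pS b(1) pPa pPb pta ptb path_reverse[OF pta]
  note F = dPa dta b(5-11,14,15,22-24) table
  note meets = F[THEN Int_subset_mono1] F[THEN Int_subset_mono2]
  note distinct = xy points(1-3) b(2-4,16,17,25) t(2,3)
  show ?thesis
  proof (cases "odd (length (Pa @ T @ tb @ S)) = \<pi>")
    case True
    have "fwd D (Pa @ (Pb @ q @ M @ ta) @ (tb @ S)) = fwd D (Pa @ T @ (tb @ S))"
      by (rule ears[of _ s _ t]; (intro paths[THEN path_append] paths)?; (simp only: pverts_distrib)?; (intro conjI)?)
        ((rule meets; (simp add: P q'; fail))
          | rule distinct distinct[THEN not_sym]
          | (use l True in \<open>simp (no_asm_use) add: P q'; satx\<close>))+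
    moreover have "fwd D (Pa @ (Pb @ R @ M @ R') @ S) = fwd D (Pa @ (T @ tb) @ S)"
      by (rule ears[of _ s _ y']; (intro paths[THEN path_append] paths)?; (simp only: pverts_distrib)?; (intro conjI)?)
        ((rule meets; (simp add: P q'; fail))
          | rule distinct distinct[THEN not_sym]
          | (use l True in \<open>simp (no_asm_use) add: P q'; satx\<close>))+
    ultimately show ?thesis by (simp add: P q')
  next
    case False
    have "fwd D (Pa @ (Pb @ R @ M) @ (R' @ S)) = fwd D (Pa @ (T @ reverse ta) @ (R' @ S))"
      by (rule ears[of _ s _ x']; (intro paths[THEN path_append] paths)?; (simp only: pverts_distrib)?; (intro conjI)?)
        ((rule meets; (simp add: P q'; fail))
          | rule distinct distinct[THEN not_sym]
          | (use l False in \<open>simp (no_asm_use) add: P q'; satx\<close>))+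
    moreover have "fwd D (Pa @ (Pb @ q @ M) @ ta @ tb @ S) = fwd D (Pa @ T @ reverse ta @ R' @ S)"
      by (rule crossings[of _ s _ x' _ t _ y']; (intro paths[THEN path_append] paths)?; (simp only: pverts_distrib)?; (intro conjI)?)
        ((rule meets; (simp add: P q'; fail))
          | rule distinct distinct[THEN not_sym]
          | (use l False in \<open>simp (no_asm_use) add: P q'; satx\<close>))+
    ultimately show ?thesis by (simp add: P q')
  qed
qed

text \<open>Here \<open>T\<close> spans both beads. If its route has parity \<open>\<pi>\<close>, it
  is an ear parallel to both chains.\<close>

lemma bypass_P_S:
  assumes T: "bypass s T t" and s: "s \<in> insert x (pverts P)" and t: "t \<in> insert y' (pverts S)"
  shows claim
proof -
  note b = bypass_all[OF T] bypass_from_P[OF T s] bypass_to_S[OF T t]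
  obtain Pa Pb where P: "P = Pa @ Pb" and pPa: "path E u Pa s" and pPb: "path E s Pb x"
    and dPa: "meet_in Pa Pb {s}" "meet_in Pa q {s}" "meet_in Pa R {s}"
    by (rule split_P[OF s])
  obtain Sa Sb where S: "S = Sa @ Sb" and pSa: "path E y' Sa t" and pSb: "path E t Sb v"
    and dSa: "meet_in Sa Sb {t}" "meet_in Sb q' {t}" "meet_in Sb R' {t}"
    by (rule split_S[OF t])
  note paths = pP pq pR pM pq' pR' pS b(1) pPa pPb pSa pSb
  note F = dPa dSa b(5-11,14,15,22-24) table
  note meets = F[THEN Int_subset_mono1] F[THEN Int_subset_mono2]
  note distinct = xy points(1-3) b(2-4,16,17,25,26) 
  show ?thesis
  proof (cases "odd (length (Pa @ T @ Sb)) = \<pi>")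
    case True
    have "fwd D (Pa @ (Pb @ q @ M @ q' @ Sa) @ Sb) = fwd D (Pa @ T @ Sb)"
      by (rule ears[of _ s _ t]; (intro paths[THEN path_append] paths)?; (simp only: pverts_distrib)?; (intro conjI)?)
        ((rule meets; (simp add: P S; fail))
          | rule distinct distinct[THEN not_sym]
          | (use l True in \<open>simp (no_asm_use) add: P S; satx\<close>))+
    moreover have "fwd D (Pa @ (Pb @ R @ M @ R' @ Sa) @ Sb) = fwd D (Pa @ T @ Sb)"
      by (rule ears[of _ s _ t]; (intro paths[THEN path_append] paths)?; (simp only: pverts_distrib)?; (intro conjI)?)
        ((rule meets; (simp add: P S; fail))
          | rule distinct distinct[THEN not_sym]
          | (use l True in \<open>simp (no_asm_use) add: P S; satx\<close>))+
    ultimately show ?thesis by (simp add: P S)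
  next
    case False
    \<comment> \<open>Now \<open>T\<close> has the parity of the two mixed chains, which switch only
      one bead and are not admissible themselves. Each of them forms an even circuit with
      \<open>T\<close>, so they have equal forward parities, and this is the claim with its terms
      rearranged.\<close>
    have l': "odd (length T) = odd (length (Pb @ q @ M @ R' @ Sa))" "odd (length T) = odd (length (Pb @ R @ M @ q' @ Sa))"
      by (use l False in \<open>simp (no_asm_use) add: P S; satx\<close>)+
    have p1: "path E s (Pb @ q @ M @ R' @ Sa) t"
      by (intro paths[THEN path_append] paths; (simp only: pverts_distrib)?; (intro conjI)?)
        ((rule meets; (simp add: P S; fail))+)
    have d1: "meet_in T (Pb @ q @ M @ R' @ Sa) {s, t}"
      by (simp only: pverts_distrib, intro conjI)
        ((rule meets; (simp add: P S; fail))+)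
    have p2: "path E s (Pb @ R @ M @ q' @ Sa) t"
      by (intro paths[THEN path_append] paths; (simp only: pverts_distrib)?; (intro conjI)?)
        ((rule meets; (simp add: P S; fail))+)
    have d2: "meet_in T (Pb @ R @ M @ q' @ Sa) {s, t}"
      by (simp only: pverts_distrib, intro conjI)
        ((rule meets; (simp add: P S; fail))+)
    have "fwd D (Pb @ q @ M @ R' @ Sa) = fwd D (Pb @ R @ M @ q' @ Sa)"
      using good_cycle[OF good b(1) p1 d1 l'(1) b(2)] good_cycle[OF good b(1) p2 d2 l'(2) b(2)] l' by satx
    then show ?thesis by (simp, satx)
  qed
qed

text \<open>An ear move along \<open>T\<close> carries one chain over to a route that enters
  \<open>M\<close> at \<open>t\<close>. This route and the other chain form two beads again, the
  first of which now ends at \<open>t\<close>, so only \<open>Mb\<close> remains between the beads.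
  The parity of the route decides which chain is moved.\<close>

lemma bypass_q_M:
  assumes T: "bypass s T t" and s: "s \<in> pverts q" "s \<noteq> x" and t: "t \<in> insert x' (pverts M)"
    and IH: "\<And>P q R M' q' R' S x y x' y'. length M' < length M \<Longrightarrow> beads en E D u v \<pi> P q R M' q' R' S x y x' y' \<Longrightarrow>
      fwd D (P @ q @ M' @ q' @ S) = fwd D (P @ R @ M' @ R' @ S)"
  shows claim
proof -
  note b = bypass_all[OF T] bypass_from_q[OF T s] bypass_to_M[OF T t]
  obtain qa qb where q: "q = qa @ qb" and pqa: "path E x qa s" and pqb: "path E s qb y"
    and dqa: "meet_in qa qb {s}"
      "meet_in P qb {}" "meet_in qa R {x}" "meet_in qb R {y}"
      "meet_in qa M {}" "meet_in qa q' {}" "meet_in qa R' {}"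
    by (rule split_q[OF s b(3)])
  obtain Ma Mb where M: "M = Ma @ Mb" and pMa: "path E y Ma t" and pMb: "path E t Mb x'"
    and dMa: "meet_in Ma Mb {t}"
      "meet_in Mb q {}" "meet_in Mb R {}" "meet_in Ma q' {t}" "meet_in Ma R' {t}"
      "meet_in q q' {}" "meet_in R q' {}" "meet_in q R' {}" "meet_in R R' {}"
    and less: "length Mb < length M"
    by (rule split_M[OF t b(4)])
  note paths = pP pq pR pM pq' pR' pS b(1) pqa pqb path_reverse[OF pqb] pMa pMb
  note F = dqa dMa b(5-11,14,15,18-20) table
  note meets = F[THEN Int_subset_mono1] F[THEN Int_subset_mono2]
  note distinct = xy points(1-3) b(2-4,16,17,21,22) s(2)
  show ?thesis
  proof (cases "odd (length (P @ qa @ T @ Mb @ q' @ S)) = \<pi>")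
    case True
    have "fwd D ((P @ qa) @ (qb @ Ma) @ (Mb @ q' @ S)) = fwd D ((P @ qa) @ T @ (Mb @ q' @ S))"
      by (rule ears[of _ s _ t]; (intro paths[THEN path_append] paths)?; (simp only: pverts_distrib)?; (intro conjI)?)
        ((rule meets; (simp add: q M; fail))
          | rule distinct distinct[THEN not_sym]
          | (use l True in \<open>simp (no_asm_use) add: q M; satx\<close>))+
    moreover have "beads en E D u v \<pi> P (qa @ T) (R @ Ma) Mb q' R' S x t x' y'"
      by (rule beads.intro; (intro paths[THEN path_append] paths)?; (simp only: pverts_distrib)?; (intro conjI)?)
        ((rule ear crossing good)
          | (rule meets; (simp add: q M; fail))
          | rule distinct distinct[THEN not_sym]
          | (use l True in \<open>simp (no_asm_use) add: q M; satx\<close>))+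
    from IH[OF less this] have "fwd D (P @ (qa @ T) @ Mb @ q' @ S) = fwd D (P @ (R @ Ma) @ Mb @ R' @ S)" .
    ultimately show ?thesis by (simp add: q M)
  next
    case False
    have "fwd D (P @ (R @ Ma) @ (Mb @ R' @ S)) = fwd D (P @ (qa @ T) @ (Mb @ R' @ S))"
      by (rule ears[of _ x _ t]; (intro paths[THEN path_append] paths)?; (simp only: pverts_distrib)?; (intro conjI)?)
        ((rule meets; (simp add: q M; fail))
          | rule distinct distinct[THEN not_sym]
          | (use l False in \<open>simp (no_asm_use) add: q M; satx\<close>))+
    moreover have "beads en E D u v \<pi> (P @ qa) T (qb @ Ma) Mb R' q' S s t x' y'"
      by (rule beads.intro; (intro paths[THEN path_append] paths)?; (simp only: pverts_distrib)?; (intro conjI)?)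
        ((rule ear crossing good)
          | (rule meets; (simp add: q M; fail))
          | rule distinct distinct[THEN not_sym]
          | (use l False in \<open>simp (no_asm_use) add: q M; satx\<close>))+
    from IH[OF less this] have "fwd D ((P @ qa) @ T @ Mb @ R' @ S) = fwd D ((P @ qa) @ (qb @ Ma) @ Mb @ q' @ S)" .
    ultimately show ?thesis by (simp add: q M)
  qed
qed

text \<open>As in \<open>bypass_q_M\<close>, but \<open>T\<close> itself is one side of the new
  first bead, the other side being the whole stretch from \<open>s\<close> to \<open>t\<close> of
  the chain that was not moved.\<close>

lemma bypass_P_M:
  assumes T: "bypass s T t" and s: "s \<in> insert x (pverts P)" and t: "t \<in> insert x' (pverts M)"
    and IH: "\<And>P q R M' q' R' S x y x' y'. length M' < length M \<Longrightarrow> beads en E D u v \<pi> P q R M' q' R' S x y x' y' \<Longrightarrow>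
      fwd D (P @ q @ M' @ q' @ S) = fwd D (P @ R @ M' @ R' @ S)"
  shows claim
proof -
  note b = bypass_all[OF T] bypass_from_P[OF T s] bypass_to_M[OF T t]
  obtain Pa Pb where P: "P = Pa @ Pb" and pPa: "path E u Pa s" and pPb: "path E s Pb x"
    and dPa: "meet_in Pa Pb {s}" "meet_in Pa q {s}" "meet_in Pa R {s}"
    by (rule split_P[OF s])
  obtain Ma Mb where M: "M = Ma @ Mb" and pMa: "path E y Ma t" and pMb: "path E t Mb x'"
    and dMa: "meet_in Ma Mb {t}"
      "meet_in Mb q {}" "meet_in Mb R {}" "meet_in Ma q' {t}" "meet_in Ma R' {t}"
      "meet_in q q' {}" "meet_in R q' {}" "meet_in q R' {}" "meet_in R R' {}"
    and less: "length Mb < length M"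
    by (rule split_M[OF t b(4)])
  note paths = pP pq pR pM pq' pR' pS b(1) pPa pPb pMa pMb
  note F = dPa dMa b(5-11,14,15,22-24) table
  note meets = F[THEN Int_subset_mono1] F[THEN Int_subset_mono2]
  note distinct = xy points(1-3) b(2-4,16,17,25,26) 
  show ?thesis
  proof (cases "odd (length (Pa @ T @ Mb @ q' @ S)) = \<pi>")
    case True
    have "fwd D (Pa @ (Pb @ q @ Ma) @ (Mb @ q' @ S)) = fwd D (Pa @ T @ (Mb @ q' @ S))"
      by (rule ears[of _ s _ t]; (intro paths[THEN path_append] paths)?; (simp only: pverts_distrib)?; (intro conjI)?)
        ((rule meets; (simp add: P M; fail))
          | rule distinct distinct[THEN not_sym]
          | (use l True in \<open>simp (no_asm_use) add: P M; satx\<close>))+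
    moreover have "beads en E D u v \<pi> Pa T (Pb @ R @ Ma) Mb q' R' S s t x' y'"
      by (rule beads.intro; (intro paths[THEN path_append] paths)?; (simp only: pverts_distrib)?; (intro conjI)?)
        ((rule ear crossing good)
          | (rule meets; (simp add: P M; fail))
          | rule distinct distinct[THEN not_sym]
          | (use l True in \<open>simp (no_asm_use) add: P M; satx\<close>))+
    from IH[OF less this] have "fwd D (Pa @ T @ Mb @ q' @ S) = fwd D (Pa @ (Pb @ R @ Ma) @ Mb @ R' @ S)" .
    ultimately show ?thesis by (simp add: P M)
  next
    case False
    have "fwd D (Pa @ (Pb @ R @ Ma) @ (Mb @ R' @ S)) = fwd D (Pa @ T @ (Mb @ R' @ S))"
      by (rule ears[of _ s _ t]; (intro paths[THEN path_append] paths)?; (simp only: pverts_distrib)?; (intro conjI)?)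
        ((rule meets; (simp add: P M; fail))
          | rule distinct distinct[THEN not_sym]
          | (use l False in \<open>simp (no_asm_use) add: P M; satx\<close>))+
    moreover have "beads en E D u v \<pi> Pa T (Pb @ q @ Ma) Mb R' q' S s t x' y'"
      by (rule beads.intro; (intro paths[THEN path_append] paths)?; (simp only: pverts_distrib)?; (intro conjI)?)
        ((rule ear crossing good)
          | (rule meets; (simp add: P M; fail))
          | rule distinct distinct[THEN not_sym]
          | (use l False in \<open>simp (no_asm_use) add: P M; satx\<close>))+
    from IH[OF less this] have "fwd D (Pa @ T @ Mb @ R' @ S) = fwd D (Pa @ (Pb @ q @ Ma) @ Mb @ q' @ S)" .
    ultimately show ?thesis by (simp add: P M)
  qed
qed

lemma bypass_claim:
  assumes T: "bypass s T t" and s: "s \<in> insert x (pverts P) \<union> pverts q" and t: "t \<in> insert x' (pverts M) \<union> pverts q' \<union> pverts R' \<union> insert y' (pverts S)"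
    and IH: "\<And>P q R M' q' R' S x y x' y'. length M' < length M \<Longrightarrow> beads en E D u v \<pi> P q R M' q' R' S x y x' y' \<Longrightarrow>
      fwd D (P @ q @ M' @ q' @ S) = fwd D (P @ R @ M' @ R' @ S)"
  shows claim
proof -
  consider "s \<in> insert x (pverts P)" | "s \<in> pverts q" "s \<noteq> x" using s by blast
  then show ?thesis
  proof cases
    case 1
    note s = this
    consider "t \<in> insert x' (pverts M)" | "t \<in> pverts q'" "t \<noteq> x'" "t \<noteq> y'"
      | "t \<in> pverts R'" "t \<noteq> x'" "t \<noteq> y'" | "t \<in> insert y' (pverts S)" using t by blast
    then show ?thesis
    proof cases
      case 1
      then show ?thesis using bypass_P_M[OF T s _ IH] by simp
    next
      case 2
      then show ?thesis by (rule bypass_P_q'[OF T s])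
    next
      case 3
      then show ?thesis by (rule beads.bypass_P_q'[OF bead_sym bypass_sym[OF T] s, symmetric])
    next
      case 4
      then show ?thesis by (rule bypass_P_S[OF T s])
    qed
  next
    case 2
    note s = this
    consider "t \<in> insert x' (pverts M)" | "t \<in> pverts q'" "t \<noteq> x'" "t \<noteq> y'"
      | "t \<in> pverts R'" "t \<noteq> x'" "t \<noteq> y'" | "t \<in> insert y' (pverts S)" using t by blast
    then show ?thesis
    proof cases
      case 1
      then show ?thesis using bypass_q_M[OF T s _ IH] by simp
    next
      case 2
      then show ?thesis by (rule bypass_q_q'[OF T s])
    next
      case 3
      then show ?thesis by (rule bypass_q_R'[OF T s])
    next
      case 4
      then show ?thesis by (rule bypass_q_S[OF T s])
    qed
  qed
qed

end

section \<open>The double bead exchange in the absence of separating vertices\<close>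

context incidence
begin

text \<open>Since \<open>y\<close> is neither \<open>u\<close> nor \<open>v\<close>, some
  \<open>uv\<close>-path avoids it, and the piece of that path which crosses from before
  \<open>y\<close> to after \<open>y\<close> is a bypass. A bypass starting on \<open>R\<close> is
  reduced to one starting on \<open>q\<close> by \<open>bead_sym\<close>.\<close>

lemma bead_exchange:
  assumes con: "\<And>c. c \<noteq> u \<Longrightarrow> c \<noteq> v \<Longrightarrow> \<exists>W. path E u W v \<and> c \<notin> pverts W"
  shows "beads en E D u v \<pi> P q R M q' R' S x y x' y' \<Longrightarrow>
    fwd D (P @ q @ M @ q' @ S) = fwd D (P @ R @ M @ R' @ S)"
proof (induction "length M" arbitrary: P q R M q' R' S x y x' y' rule: less_induct)
  case less
  interpret beads en E D u v \<pi> P q R M q' R' S x y x' y' by fact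
  let ?L = "(pverts P \<union> pverts q \<union> pverts R) - {y}"
  let ?R = "(pverts M \<union> pverts q' \<union> pverts R' \<union> pverts S) - {y}"
  have u: "u \<in> ?L" using path_ends[OF pP] path_Nil_iff[OF pP] ends(1) xy points by (cases "P = []") auto
  have v: "v \<in> ?R" using path_ends[OF pS] path_Nil_iff[OF pS] ends(6) points by (cases "S = []") auto
  have LR: "?L \<inter> ?R = {}"
  proof -
    have "(pverts P \<union> pverts q \<union> pverts R) \<inter> (pverts M \<union> pverts q' \<union> pverts R' \<union> pverts S) \<subseteq> {y}"
      by (simp only: pverts_distrib, intro conjI) (rule table[THEN Int_subset_mono1]; simp; fail)+
    then show ?thesis by blast
  qed
  have "y \<noteq> u" "y \<noteq> v" using u v by auto
  then obtain W where W: "path E u W v" "y \<notin> pverts W" using con by blast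
  obtain W1 T W2 s t where T: "W = W1 @ T @ W2" "path E s T t"
    "s \<in> ?L" "t \<in> ?R" "pverts T \<inter> ?L \<subseteq> {s}" "pverts T \<inter> ?R \<subseteq> {t}"
    using crossing_segment[OF W(1) u v LR] by metis
  have "y \<notin> pverts T" using T(1) W(2) by auto
  then have b: "bypass s T t" unfolding bypass_def using T(2-) LR by blast
  have t: "t \<in> insert x' (pverts M) \<union> pverts q' \<union> pverts R' \<union> insert y' (pverts S)" using T(4) by blast
  consider "s \<in> insert x (pverts P) \<union> pverts q" | "s \<in> insert x (pverts P) \<union> pverts R" using T(3) by blast
  then show ?case
  proof cases
    case 1
    show ?thesis by (rule bypass_claim[OF b 1 t less(1)])
  next
    case 2
    have t': "t \<in> insert x' (pverts M) \<union> pverts R' \<union> pverts q' \<union> insert y' (pverts S)" using t by blast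
    show ?thesis by (rule beads.bypass_claim[OF bead_sym bypass_sym[OF b] 2 t' less(1), symmetric])
  qed
qed

end

section \<open>Paths of equal parity\<close>

context incidence
begin

lemma ear_exchange_disjoint:
  assumes "ear_cond E u v \<pi>" "good E D" "path E u P a" "path E a r b" "path E a r' b" "path E b S v" "a \<noteq> b"
    "meet_in P r {a}" "meet_in P r' {a}" "meet_in P S {}"
    "meet_in r S {b}" "meet_in r' S {b}" "meet_in r r' {a, b}"
    "odd (length (P @ r @ S)) = \<pi>" "odd (length r) = odd (length r')"
  shows "fwd D (P @ r @ S) = fwd D (P @ r' @ S)" "path E u (P @ r' @ S) v" "odd (length (P @ r' @ S)) = \<pi>"
proof -
  show p: "path E u (P @ r' @ S) v" and l: "odd (length (P @ r' @ S)) = \<pi>"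
    using assms by (auto intro: path3[where x=a and y=b])
  show "fwd D (P @ r @ S) = fwd D (P @ r' @ S)"
    using assms l by (intro ear_exchange[OF assms(1-6) _ p assms(7,13)] path3[where x=a and y=b])
qed

text \<open>A path that enters \<open>y\<close> by \<open>e\<close> has at most one further edge at
  \<open>y\<close>, the one by which it leaves. This feeds the count of edges off the target in
  \<open>fwd_constant_suffix\<close>.\<close>

lemma edges_at_middle:
  assumes "path E u (X @ (a, e, y) # W) v" "f \<in> pedges (X @ (a, e, y) # W)" "y \<in> en f" "f \<noteq> e"
  shows "W \<noteq> [] \<and> f = fst (snd (hd W))"
proof -
  obtain b where b: "path E u X b" "path E b ((a, e, y) # W) v" "meet_in X ((a, e, y) # W) {b}"
    using path_appendI[OF assms(1)] by blast
  then have ba: "b = a" "a \<noteq> y" by auto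
  have "f \<notin> pedges X"
  proof
    assume "f \<in> pedges X"
    then obtain c d where "(c, f, d) \<in> set X" by (auto simp: pedges_def)
    then have "y \<in> pverts X" using dart_pverts dart_ends path_walk b(1) assms(3) by (metis insertE singletonD)
    then show False using b(3) ba by auto
  qed
  then have f: "f \<in> pedges W" using assms(2,4) by auto
  then obtain d W' where W: "W = d # W'" by (cases W) auto
  obtain c g c' where d: "d = (c, g, c')" by (cases d)
  have pW: "path E y (d # W') v" using b(2) W by simp
  have "f \<notin> pedges W'"
  proof
    assume "f \<in> pedges W'"
    then obtain c1 d1 where "(c1, f, d1) \<in> set W'" by (auto simp: pedges_def)
    moreover have "path E c' W' v" using pW d by simp
    ultimately have "y \<in> pverts W'" using dart_pverts dart_ends path_walk assms(3) by (metis insertE singletonD)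
    then show False using pW d by auto
  qed
  then show ?thesis using f W d by auto
qed

text \<open>Leaving the current path along \<open>R\<close> changes the parity, so a second place is
  needed where it is corrected. Follow the remaining target \<open>N'\<close> to its first return to
  \<open>N\<close>. Ears of equal parity are exchanged at once and absorbed into \<open>M\<close>;
  the first pair of different parity is the second bead. The new path follows the target through
  \<open>R\<close> and then \<open>W\<close>.\<close>

lemma serial_exchange:
  assumes ec: "ear_cond E u v \<pi>" and cc: "crossing_cond E u v \<pi>" and g: "good E D"
    and con: "\<And>c. c \<noteq> u \<Longrightarrow> c \<noteq> v \<Longrightarrow> \<exists>W. path E u W v \<and> c \<notin> pverts W"
    and X: "path E u X x" and q: "path E x q y" and R: "path E x R y" and xy: "x \<noteq> y"
    and dX: "meet_in X q {x}" "meet_in X R {x}" "meet_in q R {x, y}"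
    and lq: "odd (length q) \<noteq> odd (length R)"
  shows "path E y M x' \<Longrightarrow> path E x' N v \<Longrightarrow> path E x' N' v \<Longrightarrow>
    meet_in X M {} \<Longrightarrow> meet_in X N {} \<Longrightarrow> meet_in X N' {} \<Longrightarrow>
    meet_in q M {y} \<Longrightarrow> meet_in q N {y} \<Longrightarrow> meet_in q N' {y} \<Longrightarrow>
    meet_in R M {y} \<Longrightarrow> meet_in R N {y} \<Longrightarrow> meet_in R N' {y} \<Longrightarrow>
    meet_in M N {x'} \<Longrightarrow> meet_in M N' {x'} \<Longrightarrow>
    odd (length N) \<noteq> odd (length N') \<Longrightarrow> odd (length (X @ q @ M @ N)) = \<pi> \<Longrightarrow>
    \<exists>Z W W'. W \<noteq> [] \<and> M @ N' = W @ W' \<and> path E u (X @ R @ W @ Z) v \<and> odd (length (X @ R @ W @ Z)) = \<pi> \<and>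
      fwd D (X @ q @ M @ N) = fwd D (X @ R @ W @ Z)"
proof (induction "length N'" arbitrary: M N N' x' rule: less_induct)
  case less
  note M = less(2) and N = less(3) and N' = less(4)
  \<comment> \<open>At \<open>v\<close> both remainders would be empty and hence of equal parity; so
    a pair of different parity is met before the target is used up.\<close>
  have "x' \<noteq> v"
  proof
    assume "x' = v"
    then have "N = []" "N' = []" using path_Nil_iff[OF N] path_Nil_iff[OF N'] by auto
    then show False using less(16) by simp
  qed
  then have ne: "N' \<noteq> []" "N \<noteq> []" using path_Nil_iff[OF N] path_Nil_iff[OF N'] by auto
  have qne: "q \<noteq> []" "R \<noteq> []" using path_Nil_iff[OF q] path_Nil_iff[OF R] xy by auto
  have e: "x \<in> pverts q" "y \<in> pverts q" "x \<in> pverts R" "y \<in> pverts R" "v \<in> pverts N" "x' \<in> pverts N"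
    using path_ends[OF q qne(1)] path_ends[OF R qne(2)] path_ends[OF N ne(2)] by auto
  obtain R2 N2' y' where N2': "N' = R2 @ N2'" "R2 \<noteq> []" "path E x' R2 y'" "path E y' N2' v" "y' \<in> pverts N"
    "meet_in R2 N {x', y'}" "meet_in R2 N2' {y'}"
    using first_return[OF N' ne(1) e(5)] by blast
  obtain q2 S where S: "N = q2 @ S" "path E x' q2 y'" "path E y' S v" "meet_in q2 S {y'}"
    using path_split[OF N] N2'(5) by blast
  have xy': "x' \<noteq> y'" "y' \<in> pverts R2" using path_ends[OF N2'(3,2)] by auto
  then have q2ne: "q2 \<noteq> []" using path_Nil_iff[OF S(2)] by auto
  have e2: "x' \<in> pverts q2" "x' \<in> pverts R2" using path_ends[OF S(2) q2ne] path_ends[OF N2'(3,2)] by auto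
  then have x'S: "x' \<notin> pverts S" using S(4) xy' by auto
  have x'N2: "x' \<notin> pverts N2'" using N2'(7) e2 xy' by auto
  \<comment> \<open>The vertex \<open>y\<close> can lie on the remainders only if \<open>M\<close>
    is empty, the case of touching beads.\<close>
  have yx: "y = x'" if "y \<in> pverts N \<or> y \<in> pverts N'"
  proof (cases "M = []")
    case False
    then show ?thesis using path_ends[OF M] less(14,15) that by blast
  qed (use path_Nil_iff[OF M] in auto)
  have yS: "y \<notin> pverts S" using yx x'S S(1) by auto
  have d1: "meet_in q N {x'}" "meet_in q N' {x'}"
     "meet_in R N {x'}" "meet_in R N' {x'}"
    using less(9,10,12,13) yx by auto
  have d2: "meet_in q S {}" "meet_in R S {}" "meet_in M S {}" "meet_in M N2' {}"
    "meet_in R2 S {y'}" "meet_in R2 q2 {x', y'}"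
    using less(9,12,14,15) yS x'S x'N2 S(1) N2'(1,6) by auto
  note F = d1 d2 dX less(5-15) S(4) N2'(7)
  note meets = F[THEN Int_subset_mono1] F[THEN Int_subset_mono2]
  note paths = X q R M S(2,3) N2'(3,4)
  show ?case
  proof (cases "odd (length q2) = odd (length R2)")
    case False
    have "beads en E D u v \<pi> X q R M q2 R2 S x y x' y'"
      by (rule beads.intro)
        ((rule ec cc g paths xy xy') | (rule meets; (simp add: S(1) N2'(1); fail))
          | (use lq False less(17) in \<open>simp add: S(1)\<close>; fail))+
    from bead_exchange[OF con this] have f: "fwd D (X @ q @ M @ q2 @ S) = fwd D (X @ R @ M @ R2 @ S)" .
    have "path E u (X @ R @ M @ R2 @ S) v"
      by (intro paths[THEN path_append] paths; (simp only: pverts_distrib)?; (intro conjI)?)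
        (rule meets; (simp add: S(1) N2'(1); fail))+
    moreover have "odd (length (X @ R @ M @ R2 @ S)) = \<pi>" using lq False less(17) 
      by (simp (no_asm_use) add: S(1); satx)
    ultimately show ?thesis using f N2'(1,2) S(1) by (intro exI[of _ S] exI[of _ "M @ R2"] exI[of _ N2']) simp
  next
    case True
    have a: "path E u (X @ q @ M) x'"
      by (intro paths[THEN path_append] paths; (simp only: pverts_distrib)?; (intro conjI)?)
        (rule meets; (simp add: S(1) N2'(1); fail))+
    have l: "odd (length ((X @ q @ M) @ q2 @ S)) = \<pi>" using less(17) S(1) by simp
    have z: "fwd D ((X @ q @ M) @ q2 @ S) = fwd D ((X @ q @ M) @ R2 @ S)"
      by (rule ear_exchange_disjoint(1)[OF ec g a S(2) N2'(3) S(3) xy'(1) _ _ _ _ _ _ l True]; (simp only: pverts_distrib)?; (intro conjI)?)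
        (rule meets; (simp add: S(1) N2'(1); fail))+
    have z2: "odd (length ((X @ q @ M) @ R2 @ S)) = \<pi>"
      by (rule ear_exchange_disjoint(3)[OF ec g a S(2) N2'(3) S(3) xy'(1) _ _ _ _ _ _ l True]; (simp only: pverts_distrib)?; (intro conjI)?)
        (rule meets; (simp add: S(1) N2'(1); fail))+
    have p: "path E y (M @ R2) y'"
      by (intro paths[THEN path_append] paths; (simp only: pverts_distrib)?; (intro conjI)?)
        (rule meets; (simp add: S(1) N2'(1); fail))+
    have "length N2' < length N'" using N2' by simp
    have "\<exists>Z W W'. W \<noteq> [] \<and> (M @ R2) @ N2' = W @ W' \<and> path E u (X @ R @ W @ Z) v \<and> odd (length (X @ R @ W @ Z)) = \<pi> \<and>
      fwd D (X @ q @ (M @ R2) @ S) = fwd D (X @ R @ W @ Z)"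
      by (rule less(1)[OF \<open>length N2' < length N'\<close> p S(3) N2'(4)]; (simp only: pverts_distrib)?; (intro conjI)?)
        ((rule meets; (simp add: S(1) N2'(1); fail))
          | (use less(16) True z2 in \<open>simp (no_asm_use) add: S(1) N2'(1); satx\<close>))+
    then show ?thesis using z S(1) N2'(1) by auto
  qed
qed

text \<open>The path \<open>X @ Y\<close> is transformed into the target \<open>X @ Y'\<close>,
  where \<open>X\<close> is the part already agreed upon. The measure is lexicographic: the length
  of the target still to be reached, then the number of edges of \<open>Y\<close> off the target.
  Every move but one extends the common prefix; that one keeps the prefix and reduces the second
  component.\<close>

lemma fwd_constant_suffix:
  assumes ec: "ear_cond E u v \<pi>" and cc: "crossing_cond E u v \<pi>" and g: "good E D"
    and con: "\<And>c. c \<noteq> u \<Longrightarrow> c \<noteq> v \<Longrightarrow> \<exists>W. path E u W v \<and> c \<notin> pverts W"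
  shows "path E u X x \<Longrightarrow> path E u (X @ Y) v \<Longrightarrow> path E u (X @ Y') v \<Longrightarrow>
    odd (length (X @ Y)) = \<pi> \<Longrightarrow> odd (length (X @ Y')) = \<pi> \<Longrightarrow> fwd D (X @ Y) = fwd D (X @ Y')"
proof (induction "(length Y', length (filter (\<lambda>d. fst (snd d) \<notin> pedges (X @ Y')) Y))" arbitrary: X Y Y' x
    rule: wf_induct_rule[OF wf_lex_prod[OF wf_less_than wf_less_than]])
  case 1
  have IH1: "fwd D (X1 @ Y1) = fwd D (X1 @ Y1')" if "length Y1' < length Y'" "path E u X1 x1"
    "path E u (X1 @ Y1) v" "path E u (X1 @ Y1') v" "odd (length (X1 @ Y1)) = \<pi>" "odd (length (X1 @ Y1')) = \<pi>"
    for X1 Y1 Y1' x1 by (rule 1(1)[OF _ that(2-6)]) (use that(1) in simp)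
  have IH2: "fwd D (X @ Y1) = fwd D (X @ Y')" if
    "length (filter (\<lambda>d. fst (snd d) \<notin> pedges (X @ Y')) Y1) < length (filter (\<lambda>d. fst (snd d) \<notin> pedges (X @ Y')) Y)"
    "path E u (X @ Y1) v" "odd (length (X @ Y1)) = \<pi>" for Y1
    by (rule 1(1)[OF _ 1(2) that(2) 1(4) that(3) 1(6)]) (use that(1) in simp)
  have pX: "path E u X x" using 1 by simp
  obtain pY: "path E x Y v" and XY: "meet_in X Y {x}"
    using path_appendI[OF 1(3)] path_unique[OF pX] by metis
  obtain pY': "path E x Y' v" and XY': "meet_in X Y' {x}"
    using path_appendI[OF 1(4)] path_unique[OF pX] by metis
  show ?case
  proof (cases "Y' = []")
    case True
    then have "Y = []" using path_Nil_iff[OF pY] path_Nil_iff[OF pY'] by simp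
    then show ?thesis using True by simp
  next
    case ne': False
    then have xv: "x \<noteq> v" using path_Nil_iff[OF pY'] by simp
    then have ne: "Y \<noteq> []" using path_Nil_iff[OF pY] by simp
    then have "v \<in> pverts (X @ Y)" using path_ends[OF pY] by simp
    \<comment> \<open>\<open>R\<close> is the part of the target up to its next contact with the
      current path, and \<open>q\<close> below is the stretch of the current path that competes with
      it.\<close>
    from first_return[OF pY' ne' this] obtain R Y2 y where
      Y': "Y' = R @ Y2" and R: "R \<noteq> []" "path E x R y" and Y2: "path E y Y2 v" and y: "y \<in> pverts (X @ Y)"
      and dR: "meet_in R (X @ Y) {x, y}" and RY2: "meet_in R Y2 {y}" .
    have eR: "x \<in> pverts R" "y \<in> pverts R" "x \<noteq> y" using path_ends[OF R(2,1)] by auto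
    then have "y \<notin> pverts X" using XY' Y' by auto
    then have "y \<in> insert x (pverts Y)" using y by auto
    from path_split[OF pY this] obtain q Q2 where
      Y: "Y = q @ Q2" and q: "path E x q y" and Q2: "path E y Q2 v" and qQ2: "meet_in q Q2 {y}" .
    have qne: "q \<noteq> []" using path_Nil_iff[OF q] eR by simp
    then have eq: "x \<in> pverts q" "y \<in> pverts q" using path_ends[OF q] by auto
    have xn: "x \<notin> pverts Q2" "x \<notin> pverts Y2" using qQ2 RY2 eq eR by auto
    have d: "meet_in X q {x}" "meet_in X R {x}" "meet_in q R {x, y}"
      "meet_in X Q2 {}" "meet_in X Y2 {}" "meet_in R Q2 {y}"
      using XY XY' Y Y' dR xn by auto
    have lQ: "odd (length (X @ q @ Q2)) = \<pi>" using 1(5) Y by simp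
    show ?thesis
    proof (cases "odd (length q) = odd (length R)")
      case True
      note z = ear_exchange_disjoint[OF ec g pX q R(2) Q2 eR(3) d(1,2,4) qQ2 d(6,3) lQ True]
      have "path E u (X @ R) y" by (rule path_append[OF pX R(2) d(2)])
      moreover have "length Y2 < length Y'" using Y' R by simp
      ultimately have "fwd D ((X @ R) @ Q2) = fwd D ((X @ R) @ Y2)"
        using IH1[of Y2 "X @ R" y Q2] z 1(4,6) Y' by simp
      then show ?thesis using z(1) Y Y' by simp
    next
      case odd: False
      show ?thesis
      proof (cases "meet_in q Y2 {y}")
        case True
        \<comment> \<open>Both full paths have parity \<open>\<pi>\<close> while \<open>q\<close>
          and \<open>R\<close> differ in parity; hence so do the remainders.\<close>
        have l: "odd (length Q2) \<noteq> odd (length Y2)" "odd (length (X @ q @ [] @ Q2)) = \<pi>"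
          by (use odd lQ 1(6) in \<open>simp (no_asm_use) add: Y'; satx\<close>) (use lQ in simp)
        have "\<exists>Z W W'. W \<noteq> [] \<and> [] @ Y2 = W @ W' \<and> path E u (X @ R @ W @ Z) v \<and> odd (length (X @ R @ W @ Z)) = \<pi> \<and>
          fwd D (X @ q @ [] @ Q2) = fwd D (X @ R @ W @ Z)"
          by (rule serial_exchange[OF ec cc g con pX q R(2) eR(3) d(1-3) odd _ Q2 Y2 _ d(4,5) _ qQ2 True _ d(6) RY2 _ _ l]) simp_all
        then obtain Z W W' where z: "W \<noteq> []" "Y2 = W @ W'" "path E u (X @ R @ W @ Z) v" "odd (length (X @ R @ W @ Z)) = \<pi>"
          "fwd D (X @ q @ Q2) = fwd D (X @ R @ W @ Z)"
          unfolding append_Nil by blast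
        have z': "path E u ((X @ R @ W) @ Z) v" using z(3) by simp
        then obtain w where "path E u (X @ R @ W) w" by (rule path_appendI)
        moreover have "length W' < length Y'" using Y' R z(2) by simp
        ultimately have "fwd D ((X @ R @ W) @ Z) = fwd D ((X @ R @ W) @ W')"
          using IH1[of W' "X @ R @ W" w Z] z' z 1(4,6) Y' by simp
        then show ?thesis using z(2,5) Y Y' by simp
      next
        case False
        then obtain z0 where z0: "z0 \<in> pverts q" "z0 \<in> pverts Y2" "z0 \<noteq> y" by auto
        then obtain Ya Yb where Yab: "Y2 = Ya @ Yb" "path E y Ya z0" "path E z0 Yb v" "meet_in Ya Yb {z0}"
          using path_split[OF Y2] by blast
        \<comment> \<open>The target returns to the inside of \<open>q\<close> and has to leave it
          again before \<open>v\<close>. The piece \<open>r\<close> by which it leaves ends at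
          \<open>w\<close> strictly beyond \<open>y\<close>, so the order on the current path is
          \<open>x\<close>, \<open>z\<close>, \<open>y\<close>, \<open>w\<close> and the ears
          \<open>R\<close> and \<open>r\<close> cross.\<close>
        let ?L = "pverts q - {x, y}" and ?R = "pverts (X @ Y) - (pverts q - {x, y})"
        have "v \<in> pverts q \<Longrightarrow> v = y" using qQ2 path_ends[OF Q2] path_Nil_iff[OF Q2] by blast
        then have vR: "v \<in> ?R" using \<open>v \<in> pverts (X @ Y)\<close> by auto
        have zL: "z0 \<in> ?L" using z0 xn by auto
        obtain W1 r W2 z w where Yb: "Yb = W1 @ r @ W2" and r: "path E z r w" and "z \<in> ?L" "w \<in> ?R" 
          and rd: "pverts r \<inter> ?L \<subseteq> {z}" "pverts r \<inter> ?R \<subseteq> {w}"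
          by (rule crossing_segment[OF Yab(3) zL vR]) auto
        have Ya: "y \<in> pverts Ya" using path_ends[OF Yab(2)] path_Nil_iff[OF Yab(2)] z0(3) by auto
        then have yYb: "y \<notin> pverts Yb" using Yab(4) z0(3) by auto
        have zw: "z \<noteq> w" using \<open>z \<in> ?L\<close> \<open>w \<in> ?R\<close> by auto
        then have rne: "r \<noteq> []" "z \<in> pverts r" "w \<in> pverts r" using path_ends[OF r] path_Nil_iff[OF r] by auto
        have rY2: "pverts r \<subseteq> pverts Y2" using Yb Yab(1) by auto
        have zq: "z \<in> insert x (pverts q)" "z \<noteq> x" "z \<noteq> y" using \<open>z \<in> ?L\<close> by auto
        have wn: "w \<noteq> x" "w \<noteq> y" "w \<notin> pverts X" using rne(3) rY2 xn yYb Yb d(5) by auto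
        then have "w \<in> insert y (pverts Q2)" using \<open>w \<in> ?R\<close> Y by auto
        from path_split[OF Q2 this] obtain C Q4 where Q2s: "Q2 = C @ Q4" and C: "path E y C w" and Q4: "path E w Q4 v"
          and CQ4: "meet_in C Q4 {w}" .
        from path_split[OF q zq(1)] obtain A B where qs: "q = A @ B" and A: "path E x A z" and B: "path E z B y"
          and AB: "meet_in A B {z}" .
        have tot: "path E u (X @ A @ B @ C @ Q4) v" using 1(3) Y qs Q2s by simp
        have dis: "distinct [x, z, y, w]" using eR(3) zq wn zw by auto
        have rV: "meet_in r (X @ A @ B @ C @ Q4) {z, w}" using rd Y qs Q2s by auto
        have RV: "meet_in R (X @ A @ B @ C @ Q4) {x, y}" using dR Y qs Q2s by auto
        have Rr: "pverts R \<inter> pverts r = {}" using RY2 rY2 yYb Yb by auto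
        have l: "odd (length (X @ A @ B @ C @ Q4)) = \<pi>" using 1(5) Y qs Q2s by simp
        have ex: "A \<noteq> []" "B \<noteq> []" "C \<noteq> []" using path_Nil_iff[OF A] path_Nil_iff[OF B] path_Nil_iff[OF C] zq wn by auto
        have eA: "x \<in> pverts A" "z \<in> pverts A" "z \<in> pverts B" "y \<in> pverts B" "y \<in> pverts C" "w \<in> pverts C"
          using path_ends[OF A ex(1)] path_ends[OF B ex(2)] path_ends[OF C ex(3)] by auto
        show ?thesis
        proof (cases "odd (length r) = odd (length (B @ C))")
          case False
          note z = crossing_exchange[OF cc g pX A B C Q4 tot R(2) r dis RV rV Rr l _ False]
          have lR: "odd (length R) \<noteq> odd (length (A @ B))" using odd qs by auto
          have p: "path E u (X @ R @ reverse B @ r @ Q4) v" 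
            by (rule crossing_path[OF pX A B C Q4 tot R(2) r dis RV rV Rr])
          have "path E u (X @ R) y" by (rule path_append[OF pX R(2) d(2)])
          moreover have "length Y2 < length Y'" using Y' R by simp
          ultimately have "fwd D ((X @ R) @ reverse B @ r @ Q4) = fwd D ((X @ R) @ Y2)"
            using IH1[of Y2 "X @ R" y "reverse B @ r @ Q4"] z(2)[OF lR] p 1(4,6) Y' by simp
          then show ?thesis using z(1)[OF lR] Y Y' qs Q2s by simp
        next
          \<comment> \<open>Here no crossing move is available. Replacing \<open>B @ C\<close> by
            \<open>r\<close> is legal but does not lengthen the prefix; the gain is that all edges
            of \<open>r\<close> lie on the target whereas not all edges of \<open>B @ C\<close>
            do.\<close>
          case True
          have BC: "meet_in B C {y}" "meet_in A C {}" "meet_in A Q4 {}" "meet_in B Q4 {}"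
          proof -
            show BC: "meet_in B C {y}" using qQ2 qs Q2s by auto
            have "y \<notin> pverts A" using AB eA(4) zq by auto
            then show "meet_in A C {}" "meet_in A Q4 {}" using qQ2 qs Q2s by auto
            have "y \<notin> pverts Q4" using CQ4 eA wn by auto
            then show "meet_in B Q4 {}" using qQ2 qs Q2s by auto
          qed
          have XA: "path E u (X @ A) z" by (rule path_append[OF pX A]) (use d qs in auto)
          have pBC: "path E z (B @ C) w" by (rule path_append[OF B C BC(1)])
          have z: "fwd D ((X @ A) @ (B @ C) @ Q4) = fwd D ((X @ A) @ r @ Q4)" "path E u ((X @ A) @ r @ Q4) v"
            "odd (length ((X @ A) @ r @ Q4)) = \<pi>"
          proof -
            have xB: "x \<notin> pverts B" using AB eA zq by auto
            have zX: "z \<notin> pverts X" using d(1) zq eA qs by auto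
            have wQ: "w \<notin> pverts A" using BC eA by auto
            have zQ: "z \<notin> pverts Q4" using BC eA by auto
            have h: "meet_in (X @ A) (B @ C) {z}" using d(1,4) qs Q2s AB BC zX xn xB by auto
            have h2: "meet_in (X @ A) r {z}" using rV wQ wn by auto
            have h3: "meet_in (X @ A) Q4 {}" using d(4) BC Q2s by auto
            have h4: "meet_in (B @ C) Q4 {w}" using CQ4 BC by auto
            have h5: "meet_in r Q4 {w}" using rV zQ by auto
            have h6: "meet_in (B @ C) r {z, w}" using rV by auto
            have l': "odd (length ((X @ A) @ (B @ C) @ Q4)) = \<pi>" using l by simp
            note e = ear_exchange_disjoint[OF ec g XA pBC r Q4 zw h h2 h3 h4 h5 h6 l' True[symmetric]]
            show "fwd D ((X @ A) @ (B @ C) @ Q4) = fwd D ((X @ A) @ r @ Q4)" "path E u ((X @ A) @ r @ Q4) v"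
              "odd (length ((X @ A) @ r @ Q4)) = \<pi>" by (fact e)+
          qed
          obtain B' b1 e1 where B': "B = B' @ [(b1, e1, y)]"
          proof -
            obtain B' dd where B': "B = B' @ [dd]" using ex(2) by (metis rev_exhaust)
            obtain b1 e1 y1 where dd: "dd = (b1, e1, y1)" by (cases dd)
            then have "y1 = y" using B B' path_appendD by fastforce
            then show thesis using that B' dd by simp
          qed
          obtain c1 e2 C' where C': "C = (y, e2, c1) # C'" using C ex(3) by (cases C) auto
          obtain R' a1 e0 where R': "R = R' @ [(a1, e0, y)]"
          proof -
            obtain R' dd where R': "R = R' @ [dd]" using R(1) by (metis rev_exhaust)
            obtain b1 e1 y1 where dd: "dd = (b1, e1, y1)" by (cases dd)
            then have "y1 = y" using R(2) R' path_appendD by fastforce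
            then show thesis using that R' dd by simp
          qed
          have en: "en e1 = {b1, y}" "b1 \<noteq> y" "en e2 = {y, c1}" "c1 \<noteq> y" "en e0 = {a1, y}" "a1 \<noteq> y"
            using B B' C C' R(2) R' path_appendD by fastforce+
          \<comment> \<open>The target enters \<open>y\<close> by \<open>e0\<close>, the last edge
            of \<open>R\<close>, and leaves it by at most one edge, so it cannot use both edges of
            \<open>B @ C\<close> at \<open>y\<close>.\<close>
          have "e1 \<notin> pedges (X @ Y') \<or> e2 \<notin> pedges (X @ Y')"
          proof (rule ccontr)
            assume neg: "\<not> ?thesis"
            have w': "X @ Y' = (X @ R') @ (a1, e0, y) # Y2" using Y' R' by simp
            have "x \<notin> pverts B" "x \<notin> pverts C" using AB eA zq BC by auto
            moreover have "a1 \<in> pverts R" "b1 \<in> pverts B" "c1 \<in> pverts C" using R' B' C' by auto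
            ultimately have "a1 \<noteq> b1" "a1 \<noteq> c1" using RV en by auto
            then have "e1 \<noteq> e0" "e2 \<noteq> e0" using en by (auto simp: doubleton_eq_iff)
            then have "e1 = fst (snd (hd Y2))" "e2 = fst (snd (hd Y2))"
              using edges_at_middle[of E u "X @ R'" a1 e0 y Y2 v] 1(4) w' neg en by auto
            then have "b1 = c1" using en by (auto simp: doubleton_eq_iff)
            then show False using BC(1) en \<open>b1 \<in> pverts B\<close> \<open>c1 \<in> pverts C\<close> by auto
          qed
          then have c: "filter (\<lambda>d. fst (snd d) \<notin> pedges (X @ Y')) (B @ C) \<noteq> []"
            unfolding filter_empty_conv using B' C' by auto
          have "filter (\<lambda>d. fst (snd d) \<notin> pedges (X @ Y')) r = []"
            unfolding filter_empty_conv Y' Yab(1) Yb by (auto simp: pedges_def)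
          then have "length (filter (\<lambda>d. fst (snd d) \<notin> pedges (X @ Y')) (A @ r @ Q4))
              < length (filter (\<lambda>d. fst (snd d) \<notin> pedges (X @ Y')) Y)"
            using c unfolding Y qs Q2s by simp
          from IH2[OF this] have "fwd D (X @ A @ r @ Q4) = fwd D (X @ Y')" using z(2,3) by simp
          then show ?thesis using z(1) Y qs Q2s by simp
        qed
      qed
    qed
  qed
qed

end

section \<open>Separating vertices\<close>

context incidence
begin

section \<open>Rotating and restricting closed paths, and reversing all edges\<close>

lemma walk_pverts: "walk E b p x \<Longrightarrow> pverts p \<subseteq> fst ` set p \<union> {x}"
proof (induction p arbitrary: b)
  case (Cons d p)
  obtain a e b' where d: "d = (a, e, b')" by (cases d)
  have "b' \<in> fst ` set p \<union> {x}" using Cons.prems d by (cases p) auto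
  then show ?case using Cons d by auto
qed simp

lemma walk_path: "walk E b p x \<Longrightarrow> distinct (map fst p) \<Longrightarrow> x \<notin> fst ` set p \<Longrightarrow> path E b p x"
proof (induction p arbitrary: b)
  case (Cons d p)
  obtain a e b' where d: "d = (a, e, b')" by (cases d)
  have "pverts p \<subseteq> fst ` set p \<union> {x}" using Cons.prems(1) d walk_pverts[of E b' p x] by simp
  moreover have "b' \<in> fst ` set p \<union> {x}" using Cons.prems d by (cases p) auto
  ultimately have "a \<notin> pverts p" "a \<noteq> b'" using Cons.prems d by auto
  then show ?case using Cons d by auto
qed simp

lemma closed_path_Cons: "closed_path E x ((a, e, b) # p) \<Longrightarrow> a = x \<and> e \<in> E \<and> en e = {x, b} \<and> path E b p x \<and> e \<notin> pedges p"
  unfolding closed_path_def by (auto intro!: walk_path simp: pedges_def)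

lemma closed_path_rotate:
  assumes "closed_path E x (p @ q)" "q \<noteq> []"
  shows "closed_path E (fst (hd q)) (q @ p)"
proof -
  obtain y where "walk E x p y" "walk E y q x" using assms(1) by (auto simp: closed_path_def walk_append)
  moreover from this have "y = fst (hd q)" using assms(2) by (cases q) auto
  ultimately have "walk E (fst (hd q)) (q @ p) (fst (hd q))" by (auto simp: walk_append)
  then show ?thesis using assms by (auto simp: closed_path_def)
qed

lemma closed_path_mono: "closed_path E x C \<Longrightarrow> pedges C \<subseteq> E' \<Longrightarrow> closed_path E' x C"
proof -
  have "walk E x p y \<Longrightarrow> pedges p \<subseteq> E' \<Longrightarrow> walk E' x p y" for p y by (induction p arbitrary: x) auto
  then show "closed_path E x C \<Longrightarrow> pedges C \<subseteq> E' \<Longrightarrow> closed_path E' x C" by (auto simp: closed_path_def)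
qed

lemma good_mono:
  assumes "good E D" "E' \<subseteq> E"
  shows "good E' D"
proof -
  have w: "walk E' x p y \<Longrightarrow> walk E x p y" for x p y using assms(2) by (induction p arbitrary: x) auto
  then have "closed_path E' x C \<Longrightarrow> closed_path E x C" for x C by (simp add: closed_path_def)
  then show ?thesis using assms unfolding good_def orients_def by blast
qed

definition swap_orientation :: "('e \<Rightarrow> 'v \<times> 'v) \<Rightarrow> 'e \<Rightarrow> 'v \<times> 'v" where
  "swap_orientation D e = (snd (D e), fst (D e))"

lemma fwd_swap:
  assumes "orients E D" "path E x p y"
  shows "fwd (swap_orientation D) p \<longleftrightarrow> (fwd D p \<noteq> odd (length p))"
  using assms(2)
proof (induction p arbitrary: x)
  case (Cons d p)
  obtain a e b where d: "d = (a, e, b)" by (cases d)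
  have "{fst (D e), snd (D e)} = {a, b}" "a \<noteq> b" using Cons.prems assms(1) d by (auto simp: orients_def)
  then have "swap_orientation D e = (a, b) \<longleftrightarrow> D e \<noteq> (a, b)"
    by (cases "D e") (auto simp: doubleton_eq_iff swap_orientation_def)
  then show ?case using Cons d by auto
qed simp

text \<open>Reversing every edge complements the set of forward edges of a circuit, which preserves
  its parity when the length is even.\<close>

lemma good_swap:
  assumes "good E D"
  shows "good E (swap_orientation D)"
  unfolding good_def
proof (intro conjI allI impI)
  show "orients E (swap_orientation D)" using assms by (auto simp: good_def orients_def swap_orientation_def)
  fix x C
  assume C: "closed_path E x C" "even (length C)"
  obtain a e b p where Cp: "C = (a, e, b) # p" using C(1) by (cases C) (auto simp: closed_path_def)
  note c = closed_path_Cons[OF C(1)[unfolded Cp]]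
  have "p \<noteq> []" using C(2) Cp by auto
  then have "b \<noteq> x" using path_ends c by blast
  then have e: "path E x [(x, e, b)] b" "path E b p x" using c by auto
  have o: "orients E D" using assms by (simp add: good_def)
  have "fwd D C" using assms C by (auto simp: good_def)
  moreover have "fwd (swap_orientation D) C = (fwd (swap_orientation D) [(x, e, b)] \<noteq> fwd (swap_orientation D) p)"
    using Cp c by simp
  moreover have "fwd D C = (fwd D [(x, e, b)] \<noteq> fwd D p)" using Cp c by simp
  ultimately show "fwd (swap_orientation D) C"
    using fwd_swap[OF o e(1)] fwd_swap[OF o e(2)] C(2) Cp by auto
qed

lemma fwd_constant:
  assumes "ear_cond E u v \<pi>" "crossing_cond E u v \<pi>" "good E D"
    and "\<And>c. c \<noteq> u \<Longrightarrow> c \<noteq> v \<Longrightarrow> \<exists>W. path E u W v \<and> c \<notin> pverts W"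
    and "path E u Q v" "path E u Q' v" "odd (length Q) = \<pi>" "odd (length Q') = \<pi>"
  shows "fwd D Q = fwd D Q'"
  using fwd_constant_suffix[OF assms(1-4), of "[]" u Q Q'] assms(5-8) by simp

end

locale separation = incidence en for en :: "'e \<Rightarrow> 'v set" +
  fixes E :: "'e set" and u v c :: 'v
  assumes cu: "c \<noteq> u" and cv: "c \<noteq> v" and sep: "\<And>W. path E u W v \<Longrightarrow> c \<in> pverts W"
begin

text \<open>The component of \<open>u\<close> after deletion of \<open>c\<close>. The side
  \<open>E1\<close> consists of all edges touching it, including those to \<open>c\<close>, so paths
  in \<open>E1\<close> stay in \<open>U \<union> {c}\<close> and paths in \<open>E2\<close> avoid
  \<open>U\<close>.\<close>

definition U :: "'v set" where "U = {x. \<exists>p. path E u p x \<and> c \<notin> pverts p}"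
definition E1 :: "'e set" where "E1 = {e \<in> E. en e \<inter> U \<noteq> {}}"
definition E2 :: "'e set" where "E2 = E - E1"

lemma vU: "v \<notin> U" using sep by (auto simp: U_def)

lemma cU: "c \<notin> U"
proof
  assume "c \<in> U"
  then obtain p where p: "path E u p c" "c \<notin> pverts p" by (auto simp: U_def)
  then show False using path_ends[OF p(1)] path_Nil_iff[OF p(1)] cu by blast
qed

lemma U_step:
  assumes "a \<in> U" "e \<in> E" "en e = {a, b}" "b \<noteq> c"
  shows "b \<in> U"
proof -
  obtain p where p: "path E u p a" "c \<notin> pverts p" using assms by (auto simp: U_def)
  show ?thesis
  proof (cases "b \<in> insert u (pverts p)")
    case True
    then obtain p1 p2 where "p = p1 @ p2" "path E u p1 b" using path_split[OF p(1)] by metis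
    then show ?thesis using p(2) by (auto simp: U_def)
  next
    case False
    show ?thesis
    proof (cases "a = b")
      case False2: False
      have "path E u (p @ [(a, e, b)]) b" 
        by (rule path_append[OF p(1)]) (use assms False False2 in auto)
      moreover have "a \<noteq> c" using assms cU by auto
      ultimately show ?thesis using p(2) assms(4) by (fastforce simp: U_def)
    qed (use assms in simp)
  qed
qed

lemma U_path: "path E x p y \<Longrightarrow> x \<in> U \<Longrightarrow> c \<notin> pverts p \<Longrightarrow> y \<in> U"
proof (induction p arbitrary: x)
  case (Cons d p)
  obtain a e b where d: "d = (a, e, b)" by (cases d)
  have "b \<in> U" using U_step[of a e b] Cons.prems d by auto
  then show ?case using Cons d by auto
qed simp

lemma U_path_iff: "path E x p y \<Longrightarrow> c \<notin> pverts p \<Longrightarrow> x \<in> U \<longleftrightarrow> y \<in> U"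
  using U_path path_reverse pverts_reverse by metis

lemma E1_pverts: "path E1 x p y \<Longrightarrow> pverts p \<subseteq> U \<union> {c}"
proof (induction p arbitrary: x)
  case (Cons d p)
  obtain a e b where d: "d = (a, e, b)" by (cases d)
  then have "a \<in> U \<or> b \<in> U" "e \<in> E" "en e = {a, b}" using Cons.prems by (auto simp: E1_def)
  then have "a \<in> U \<union> {c}" "b \<in> U \<union> {c}" using U_step[of a e b] U_step[of b e a] by (auto simp: insert_commute)
  then show ?case using Cons d by auto
qed simp

lemma E2_pverts: "path E2 x p y \<Longrightarrow> pverts p \<inter> U = {}"
proof (induction p arbitrary: x)
  case (Cons d p)
  obtain a e b where d: "d = (a, e, b)" by (cases d)
  then have "a \<notin> U" "b \<notin> U" using Cons.prems by (auto simp: E1_def E2_def)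
  then show ?case using Cons d by auto
qed simp

lemma sub: "E1 \<subseteq> E" "E2 \<subseteq> E" by (auto simp: E1_def E2_def)

lemma join:
  assumes "path E1 x p c" "path E2 c q y"
  shows "path E x (p @ q) y"
  using path_append[OF path_mono[OF assms(1) sub(1)] path_mono[OF assms(2) sub(2)]] E1_pverts[OF assms(1)] E2_pverts[OF assms(2)]
  by auto

lemma split:
  assumes "path E u Q v"
  obtains Q1 Q2 where "Q = Q1 @ Q2" "path E1 u Q1 c" "path E2 c Q2 v"
proof -
  obtain Q1 Q2 where Q: "Q = Q1 @ Q2" "path E u Q1 c" "path E c Q2 v" "meet_in Q1 Q2 {c}"
    using path_split[OF assms insertI2[OF sep[OF assms]]] by blast
  have Q1: "z \<in> U" if z: "z \<in> pverts Q1" "z \<noteq> c" for z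
  proof -
    obtain A B where AB: "Q1 = A @ B" "path E u A z" "path E z B c" "meet_in A B {z}"
      using path_split[OF Q(2) insertI2[OF z(1)]] by blast
    then have "c \<in> pverts B" using path_ends[OF AB(3)] path_Nil_iff[OF AB(3)] that by auto
    then have "c \<notin> pverts A" using AB(4) that by auto
    then show ?thesis using AB(2) by (auto simp: U_def)
  qed
  have Q2: "z \<notin> U" if z: "z \<in> pverts Q2" for z
  proof (cases "z = c")
    case False
    obtain A B where AB: "Q2 = A @ B" "path E c A z" "path E z B v" "meet_in A B {z}"
      using path_split[OF Q(3) insertI2[OF z]] by blast
    then have "c \<in> pverts A" using path_ends[OF AB(2)] path_Nil_iff[OF AB(2)] False by auto
    then have "c \<notin> pverts B" using AB(4) False by auto
    then show ?thesis using AB(3) U_path vU by blast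
  qed (use cU in simp)
  have "pedges Q1 \<subseteq> E1"
  proof
    fix e assume e: "e \<in> pedges Q1"
    then obtain a b where ab: "(a, e, b) \<in> set Q1" by (auto simp: pedges_def)
    then have "en e = {a, b}" using dart_ends path_walk Q(2) by metis
    moreover have "a \<noteq> b"
    proof -
      obtain A B where "Q1 = A @ (a, e, b) # B" using ab split_list by metis
      then show ?thesis using Q(2) path_appendD by fastforce
    qed
    ultimately have "a \<in> U \<or> b \<in> U" using Q1 dart_pverts[OF ab] by blast
    then show "e \<in> E1" using \<open>en e = {a, b}\<close> e path_pedges[OF Q(2)] by (auto simp: E1_def)
  qed
  moreover have "pedges Q2 \<subseteq> E2"
  proof
    fix e assume e: "e \<in> pedges Q2"
    then obtain a b where ab: "(a, e, b) \<in> set Q2" by (auto simp: pedges_def)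
    then have "en e = {a, b}" using dart_ends path_walk Q(3) by metis
    then show "e \<in> E2" using Q2 dart_pverts[OF ab] e path_pedges[OF Q(3)] by (auto simp: E1_def E2_def)
  qed
  ultimately show thesis using that[OF Q(1)] path_restrict Q(2,3) by blast
qed

text \<open>A circuit passes through \<open>c\<close> at most once, so what is left of it after
  removing \<open>c\<close> is connected and lies inside or outside \<open>U\<close>.\<close>

lemma closed_path_side:
  assumes "closed_path E x C"
  shows "pedges C \<subseteq> E1 \<or> pedges C \<subseteq> E2"
proof -
  \<comment> \<open>Rotated so that \<open>c\<close>, if it is visited at all, is the base
    vertex.\<close>
  obtain x' C' where C': "closed_path E x' C'" "pedges C' = pedges C" "x' = c \<or> c \<notin> fst ` set C'"
  proof (cases "c \<in> fst ` set C")
    case True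
    then obtain d where d: "d \<in> set C" "fst d = c" by auto
    then obtain A B where "C = A @ d # B" using split_list by metis
    then show thesis using that[of "fst (hd (d # B))" "(d # B) @ A"] closed_path_rotate[of E x A "d # B"] assms d
      by (auto simp: pedges_def)
  qed (use assms that in blast)
  obtain a e b p where Cp: "C' = (a, e, b) # p" using C'(1) by (cases C') (auto simp: closed_path_def)
  have c: "a = x'" "e \<in> E" "en e = {x', b}" "path E b p x'" "e \<notin> pedges p" using closed_path_Cons C'(1) Cp by blast+
  have ns: "c \<notin> fst ` set p" using C'(1,3) Cp c(1) by (auto simp: closed_path_def)
  have "f \<in> E1 \<longleftrightarrow> b \<in> U" if f: "f \<in> pedges p" for f
  proof -
    obtain a' b' where ab: "(a', f, b') \<in> set p" using f by (auto simp: pedges_def)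
    then obtain A B where p: "p = A @ (a', f, b') # B" using split_list by metis
    obtain z where z: "path E b A z" "path E z ((a', f, b') # B) x'" "meet_in A ((a', f, b') # B) {z}"
      using path_appendI c(4) p by metis
    then have [simp]: "z = a'" by simp
    have ac: "a' \<noteq> c" using ns p by auto
    have "c \<notin> pverts A"
    proof (cases "x' = c")
      case True
      then have "c \<in> pverts ((a', f, b') # B)" using path_ends[OF z(2)] by simp
      then show ?thesis using z(3) ac by auto
    next
      case False
      then have "c \<notin> pverts p" using walk_pverts[OF path_walk[OF c(4)]] ns by auto
      then show ?thesis using p by simp
    qed
    then have bU: "b \<in> U \<longleftrightarrow> a' \<in> U" using U_path_iff z(1) by simp
    have fE: "f \<in> E" "en f = {a', b'}" using z(2) by auto
    have "b' \<in> U \<Longrightarrow> a' \<in> U" using U_step[of b' f a'] fE ac by (auto simp: insert_commute)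
    then show ?thesis using fE bU by (auto simp: E1_def)
  qed
  moreover have "e \<in> E1 \<longleftrightarrow> b \<in> U"
  proof (cases "x' = c")
    case True
    then show ?thesis using c(2,3) cU by (auto simp: E1_def)
  next
    case False
    then have "x' \<noteq> c" "b \<noteq> c"
    proof -
      have "b \<in> fst ` set p \<union> {x'}" using c(4) by (cases p) auto
      then show "x' \<noteq> c" "b \<noteq> c" using False ns by auto
    qed
    then have "x' \<in> U \<longleftrightarrow> b \<in> U" using U_step[of x' e b] U_step[of b e x'] c(2,3) by (auto simp: insert_commute)
    then show ?thesis using c(2,3) by (auto simp: E1_def)
  qed
  ultimately have "f \<in> E1 \<longleftrightarrow> b \<in> U" if "f \<in> pedges C'" for f using that Cp by auto
  moreover have "pedges C' \<subseteq> E" using Cp c(2) path_pedges[OF c(4)] by auto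
  ultimately show ?thesis unfolding C'(2) E2_def by blast
qed

text \<open>A forbidden configuration on one side, prolonged by a fixed path through the other side,
  is forbidden in \<open>E\<close>; the prolongation shifts the parity by its length. The next three
  lemmas use the same idea.\<close>

lemma ear_cond_E1:
  assumes ec: "ear_cond E u v (\<pi> \<noteq> odd (length Q2))" and Q2: "path E2 c Q2 v"
  shows "ear_cond E1 u c \<pi>"
  unfolding ear_cond_def
proof (intro allI impI)
  fix P q R S x y
  assume a: "path E1 u P x" "path E1 x q y" "path E1 x R y" "path E1 y S c"
    "path E1 u (P @ q @ S) c" "path E1 u (P @ R @ S) c" "x \<noteq> y" "meet_in q R {x, y}"
    "odd (length (P @ q @ S)) = \<pi>" "odd (length q) = odd (length R)"
  note m = path_mono[OF _ sub(1)]
  show "odd (length q)"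
    by (rule ec[unfolded ear_cond_def, rule_format, OF m[OF a(1)] m[OF a(2)] m[OF a(3)] join[OF a(4) Q2] _ _ a(7,8) _ a(10)])
       (use join[OF a(5) Q2] join[OF a(6) Q2] a(9) in \<open>auto\<close>)
qed

lemma ear_cond_E2:
  assumes ec: "ear_cond E u v (\<pi> \<noteq> odd (length Q1))" and Q1: "path E1 u Q1 c"
  shows "ear_cond E2 c v \<pi>"
  unfolding ear_cond_def
proof (intro allI impI)
  fix P q R S x y
  assume a: "path E2 c P x" "path E2 x q y" "path E2 x R y" "path E2 y S v"
    "path E2 c (P @ q @ S) v" "path E2 c (P @ R @ S) v" "x \<noteq> y" "meet_in q R {x, y}"
    "odd (length (P @ q @ S)) = \<pi>" "odd (length q) = odd (length R)"
  note m = path_mono[OF _ sub(2)]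
  show "odd (length q)"
    by (rule ec[unfolded ear_cond_def, rule_format, OF join[OF Q1 a(1)] m[OF a(2)] m[OF a(3)] m[OF a(4)] _ _ a(7,8) _ a(10)])
       (use join[OF Q1 a(5)] join[OF Q1 a(6)] a(9) in \<open>auto\<close>)
qed

lemma crossing_cond_E1:
  assumes cc: "crossing_cond E u v (\<pi> \<noteq> odd (length Q2))" and Q2: "path E2 c Q2 v"
  shows "crossing_cond E1 u c \<pi>"
  unfolding crossing_cond_def
proof (intro allI impI)
  fix P A B C S R R' x x' y y'
  assume a: "path E1 u P x" "path E1 x A x'" "path E1 x' B y" "path E1 y C y'" "path E1 y' S c"
    "path E1 u (P @ A @ B @ C @ S) c" "path E1 x R y" "path E1 x' R' y'" "distinct [x, x', y, y']"
    "meet_in R (P @ A @ B @ C @ S) {x, y}" "meet_in R' (P @ A @ B @ C @ S) {x', y'}"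
    "pverts R \<inter> pverts R' = {}" "odd (length (P @ A @ B @ C @ S)) = \<pi>"
    "odd (length R) \<noteq> odd (length (A @ B))" "odd (length R') \<noteq> odd (length (B @ C))"
  note m = path_mono[OF _ sub(1)]
  let ?T = "P @ A @ B @ C @ S"
  have c: "c \<in> pverts ?T" using path_ends[OF a(6)] path_Nil_iff[OF a(6)] cu by auto
  have RQ: "meet_in R Q2 {c}" "meet_in R' Q2 {c}"
    using E1_pverts[OF a(7)] E1_pverts[OF a(8)] E2_pverts[OF Q2] by auto
  have 1: "meet_in R (?T @ Q2) {x, y}" "meet_in R' (?T @ Q2) {x', y'}"
    unfolding pverts_simps(3)[of ?T Q2] using RQ a(10,11) c by blast+
  have 2: "path E u (?T @ Q2) v" "odd (length (?T @ Q2)) = (\<pi> \<noteq> odd (length Q2))"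
    using join[OF a(6) Q2] a(13) by auto
  show "odd (length A) = odd (length C)"
    by (rule cc[unfolded crossing_cond_def, rule_format, OF m[OF a(1)] m[OF a(2)] m[OF a(3)] m[OF a(4)] join[OF a(5) Q2]
          _ m[OF a(7)] m[OF a(8)] a(9) _ _ a(12) _ a(14,15)]) (use 1 2 in simp_all)
qed

lemma crossing_cond_E2:
  assumes cc: "crossing_cond E u v (\<pi> \<noteq> odd (length Q1))" and Q1: "path E1 u Q1 c"
  shows "crossing_cond E2 c v \<pi>"
  unfolding crossing_cond_def
proof (intro allI impI)
  fix P A B C S R R' x x' y y'
  assume a: "path E2 c P x" "path E2 x A x'" "path E2 x' B y" "path E2 y C y'" "path E2 y' S v"
    "path E2 c (P @ A @ B @ C @ S) v" "path E2 x R y" "path E2 x' R' y'" "distinct [x, x', y, y']"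
    "meet_in R (P @ A @ B @ C @ S) {x, y}" "meet_in R' (P @ A @ B @ C @ S) {x', y'}"
    "pverts R \<inter> pverts R' = {}" "odd (length (P @ A @ B @ C @ S)) = \<pi>"
    "odd (length R) \<noteq> odd (length (A @ B))" "odd (length R') \<noteq> odd (length (B @ C))"
  note m = path_mono[OF _ sub(2)]
  let ?T = "P @ A @ B @ C @ S"
  have c: "c \<in> pverts ?T" using path_ends[OF a(6)] path_Nil_iff[OF a(6)] cv by auto
  have RQ: "meet_in R Q1 {c}" "meet_in R' Q1 {c}"
    using E2_pverts[OF a(7)] E2_pverts[OF a(8)] E1_pverts[OF Q1] by auto
  have 1: "meet_in R (Q1 @ ?T) {x, y}" "meet_in R' (Q1 @ ?T) {x', y'}"
    unfolding pverts_simps(3)[of Q1 ?T] using RQ a(10,11) c by blast+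
  have 2: "path E u (Q1 @ ?T) v" "odd (length (Q1 @ ?T)) = (\<pi> \<noteq> odd (length Q1))"
    using join[OF Q1 a(6)] a(13) by auto
  show "odd (length A) = odd (length C)"
    by (rule cc[unfolded crossing_cond_def, rule_format, OF join[OF Q1 a(1)] m[OF a(2)] m[OF a(3)] m[OF a(4)] m[OF a(5)]
          _ m[OF a(7)] m[OF a(8)] a(9) _ _ a(12) _ a(14,15)]) (use 1 2 in simp_all)
qed

end

context incidence
begin

text \<open>A set of parities is prescribed because a single parity for \<open>E\<close> can split
  at a separating vertex into both parities on each side.\<close>

definition constant_on :: "'e set \<Rightarrow> 'v \<Rightarrow> 'v \<Rightarrow> bool set \<Rightarrow> ('e \<Rightarrow> 'v \<times> 'v) \<Rightarrow> bool" where
  "constant_on E u v \<Pi> D \<longleftrightarrow> (\<forall>\<pi>\<in>\<Pi>. \<forall>Q Q'. path E u Q v \<longrightarrow> path E u Q' v \<longrightarrow>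
     odd (length Q) = \<pi> \<longrightarrow> odd (length Q') = \<pi> \<longrightarrow> fwd D Q = fwd D Q')"

end

context separation
begin

text \<open>\<open>\<Pi>1\<close> and \<open>\<Pi>2\<close> contain the parities that some path on
  the other side completes to a member of \<open>\<Pi>\<close>. Constancy on the sides leaves one
  bit undetermined: how forward parity changes when the length parity changes on both sides at once.
  Reversing \<open>E2\<close> flips this bit.\<close>

lemma combine:
  assumes D1: "good E1 D1" "constant_on E1 u c \<Pi>1 D1" and D2: "good E2 D2" "constant_on E2 c v \<Pi>2 D2"
    and \<Pi>1: "\<Pi>1 = {\<pi>. \<exists>Q2. path E2 c Q2 v \<and> (\<pi> \<noteq> odd (length Q2)) \<in> \<Pi>}"
    and \<Pi>2: "\<Pi>2 = {\<pi>. \<exists>Q1. path E1 u Q1 c \<and> (\<pi> \<noteq> odd (length Q1)) \<in> \<Pi>}"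
  shows "\<exists>D. good E D \<and> constant_on E u v \<Pi> D"
proof -
  have o2: "orients E2 D2" using D2 by (simp add: good_def)
  \<comment> \<open>Two paths of the same total parity may differ in parity on both sides;
    \<open>mixed\<close> demands that the changes of forward parity on the two sides then
    cancel.\<close>
  define mixed where "mixed = (\<lambda>D2' :: 'e \<Rightarrow> 'v \<times> 'v. \<forall>Q1 Q1' Q2 Q2'. path E1 u Q1 c \<longrightarrow> path E1 u Q1' c \<longrightarrow>
    path E2 c Q2 v \<longrightarrow> path E2 c Q2' v \<longrightarrow> (odd (length Q1) \<noteq> odd (length Q2)) \<in> \<Pi> \<longrightarrow>
    odd (length Q1) \<noteq> odd (length Q1') \<longrightarrow> odd (length Q2) \<noteq> odd (length Q2') \<longrightarrow>
    (fwd D1 Q1 \<noteq> fwd D1 Q1') = (fwd D2' Q2 \<noteq> fwd D2' Q2'))"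
  have c1: "fwd D1 Q = fwd D1 Q'" if "path E1 u Q c" "path E1 u Q' c" "odd (length Q) = odd (length Q')"
    "path E2 c Q2 v" "(odd (length Q) \<noteq> odd (length Q2)) \<in> \<Pi>" for Q Q' Q2
    using D1(2) that unfolding constant_on_def \<Pi>1 by blast
  have c2: "fwd D2 Q = fwd D2 Q'" if "path E2 c Q v" "path E2 c Q' v" "odd (length Q) = odd (length Q')"
    "path E1 u Q1 c" "(odd (length Q1) \<noteq> odd (length Q)) \<in> \<Pi>" for Q Q' Q1
    using D2(2) that unfolding constant_on_def \<Pi>2 by (smt (verit) mem_Collect_eq)
  have "\<exists>D2'. good E2 D2' \<and> constant_on E2 c v \<Pi>2 D2' \<and> mixed D2'"
  proof (cases "mixed D2")
    case False
    then obtain A A' B B' where w: "path E1 u A c" "path E1 u A' c" "path E2 c B v" "path E2 c B' v"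
      "(odd (length A) \<noteq> odd (length B)) \<in> \<Pi>" "odd (length A) \<noteq> odd (length A')" "odd (length B) \<noteq> odd (length B')"
      "(fwd D1 A \<noteq> fwd D1 A') \<noteq> (fwd D2 B \<noteq> fwd D2 B')" unfolding mixed_def by blast
    have s: "fwd (swap_orientation D2) Q = (fwd D2 Q \<noteq> odd (length Q))" if "path E2 c Q v" for Q
      using fwd_swap[OF o2 that] .
    have "constant_on E2 c v \<Pi>2 (swap_orientation D2)"
      using D2(2) s unfolding constant_on_def by metis
    moreover have "mixed (swap_orientation D2)"
      unfolding mixed_def
    proof (intro allI impI)
      fix Q1 Q1' Q2 Q2'
      assume q: "path E1 u Q1 c" "path E1 u Q1' c" "path E2 c Q2 v" "path E2 c Q2' v"
        "(odd (length Q1) \<noteq> odd (length Q2)) \<in> \<Pi>" "odd (length Q1) \<noteq> odd (length Q1')" "odd (length Q2) \<noteq> odd (length Q2')"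
      \<comment> \<open>The difference between even and odd paths on a side does not depend on the
        paths chosen, so the single failure \<open>A, A', B, B'\<close> settles all cases after
        reversal.\<close>
      have f1: "(fwd D1 Q1 \<noteq> fwd D1 Q1') = (fwd D1 A \<noteq> fwd D1 A')"
      proof (cases "odd (length Q1) = odd (length A)")
        case True
        then have "fwd D1 Q1 = fwd D1 A" using c1[OF q(1) w(1) _ q(3,5)] by simp
        moreover have "fwd D1 Q1' = fwd D1 A'" 
          by (rule c1[OF q(2) w(2) _ q(4)]) (use True q(5-7) w(6) in \<open>auto simp del: even_add\<close>)
        ultimately show ?thesis by simp
      next
        case False
        then have "fwd D1 Q1 = fwd D1 A'" by (intro c1[OF q(1) w(2) _ q(3,5)]) (use w(6) in auto)
        moreover have "fwd D1 Q1' = fwd D1 A" 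
          by (rule c1[OF q(2) w(1) _ q(4)]) (use False q(5-7) w(6) in \<open>auto simp del: even_add\<close>)
        ultimately show ?thesis by auto
      qed
      have f2: "(fwd D2 Q2 \<noteq> fwd D2 Q2') = (fwd D2 B \<noteq> fwd D2 B')"
      proof (cases "odd (length Q2) = odd (length B)")
        case True
        then have "fwd D2 Q2 = fwd D2 B" using c2[OF q(3) w(3) _ q(1,5)] by simp
        moreover have "fwd D2 Q2' = fwd D2 B'" 
          by (rule c2[OF q(4) w(4) _ q(2)]) (use True q(5-7) w(7) in \<open>auto simp del: even_add\<close>)
        ultimately show ?thesis by simp
      next
        case False
        then have "fwd D2 Q2 = fwd D2 B'" by (intro c2[OF q(3) w(4) _ q(1,5)]) (use w(7) in auto)
        moreover have "fwd D2 Q2' = fwd D2 B" 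
          by (rule c2[OF q(4) w(3) _ q(2)]) (use False q(5-7) w(7) in \<open>auto simp del: even_add\<close>)
        ultimately show ?thesis by auto
      qed
      show "(fwd D1 Q1 \<noteq> fwd D1 Q1') = (fwd (swap_orientation D2) Q2 \<noteq> fwd (swap_orientation D2) Q2')"
        using f1 f2 s[OF q(3)] s[OF q(4)] q(7) w(8) by satx
    qed
    ultimately show ?thesis using good_swap[OF D2(1)] by blast
  qed (use D2 in blast)
  then obtain D2' where D2': "good E2 D2'" "constant_on E2 c v \<Pi>2 D2'" "mixed D2'" by blast
  define D where "D = (\<lambda>e. if e \<in> E1 then D1 e else D2' e)"
  have f1: "fwd D p = fwd D1 p" if "pedges p \<subseteq> E1" for p by (rule fwd_cong) (use that in \<open>auto simp: D_def\<close>)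
  have f2: "fwd D p = fwd D2' p" if "pedges p \<subseteq> E2" for p by (rule fwd_cong) (use that in \<open>auto simp: D_def E2_def\<close>)
  have "good E D" unfolding good_def
  proof (intro conjI allI impI)
    show "orients E D" using D1(1) D2'(1) by (auto simp: good_def orients_def D_def E2_def)
    fix x C assume C: "closed_path E x C" "even (length C)"
    from closed_path_side[OF C(1)] show "fwd D C"
    proof
      assume "pedges C \<subseteq> E1"
      then show ?thesis using f1 closed_path_mono[OF C(1)] C(2) D1(1) unfolding good_def by blast
    next
      assume "pedges C \<subseteq> E2"
      then show ?thesis using f2 closed_path_mono[OF C(1)] C(2) D2'(1) unfolding good_def by blast
    qed
  qed
  moreover have "constant_on E u v \<Pi> D" unfolding constant_on_def
  proof (intro ballI allI impI)
    fix \<pi> Q Q' assume h: "\<pi> \<in> \<Pi>" "path E u Q v" "path E u Q' v" "odd (length Q) = \<pi>" "odd (length Q') = \<pi>"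
    obtain Q1 Q2 where Q: "Q = Q1 @ Q2" "path E1 u Q1 c" "path E2 c Q2 v" by (rule split[OF h(2)])
    obtain Q1' Q2' where Q': "Q' = Q1' @ Q2'" "path E1 u Q1' c" "path E2 c Q2' v" by (rule split[OF h(3)])
    have s: "(odd (length Q1) \<noteq> odd (length Q2)) = \<pi>" "(odd (length Q1') \<noteq> odd (length Q2')) = \<pi>" using h(4,5) Q Q' by auto
    have F: "fwd D Q = (fwd D1 Q1 \<noteq> fwd D2' Q2)" "fwd D Q' = (fwd D1 Q1' \<noteq> fwd D2' Q2')"
      using Q Q' f1 f2 path_pedges by simp_all
    show "fwd D Q = fwd D Q'"
    proof (cases "odd (length Q1) = odd (length Q1')")
      case True
      then have l2: "odd (length Q2) = odd (length Q2')" using s by satx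
      have "fwd D1 Q1 = fwd D1 Q1'" by (rule c1[OF Q(2) Q'(2) True Q(3)]) (use s(1) h(1) in simp)
      moreover have "odd (length Q2) \<in> \<Pi>2" unfolding \<Pi>2 using Q(2) s(1) h(1) by fastforce
      then have "fwd D2' Q2 = fwd D2' Q2'" using D2'(2) l2 Q(3) Q'(3) unfolding constant_on_def by metis
      ultimately show ?thesis using F by simp
    next
      case False
      then have l2: "odd (length Q2) \<noteq> odd (length Q2')" using s by satx
      have "(odd (length Q1) \<noteq> odd (length Q2)) \<in> \<Pi>" using s(1) h(1) by simp
      then have "(fwd D1 Q1 \<noteq> fwd D1 Q1') = (fwd D2' Q2 \<noteq> fwd D2' Q2')"
        using D2'(3) Q Q' False l2 unfolding mixed_def by blast
      then show ?thesis using F by satx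
    qed
  qed
  ultimately show ?thesis by blast
qed

end

context incidence
begin

text \<open>Without a path of a prescribed parity there is nothing to show, and without a separating
  vertex \<open>D0\<close> itself is constant. Only a separating vertex makes it necessary to change
  the orientation.\<close>

lemma exists_constant_orientation:
  "finite E \<Longrightarrow> u \<noteq> v \<Longrightarrow> (\<And>\<pi>. \<pi> \<in> \<Pi> \<Longrightarrow> ear_cond E u v \<pi> \<and> crossing_cond E u v \<pi>) \<Longrightarrow> good E D0 \<Longrightarrow>
    \<exists>D. good E D \<and> constant_on E u v \<Pi> D"
proof (induction "card E" arbitrary: E u v \<Pi> rule: less_induct)
  case less
  show ?case
  proof (cases "\<exists>Q0. path E u Q0 v \<and> odd (length Q0) \<in> \<Pi>")
    case False
    then have "constant_on E u v \<Pi> D0" unfolding constant_on_def by blast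
    then show ?thesis using less by blast
  next
    case True
    then obtain Q0 where Q0: "path E u Q0 v" "odd (length Q0) \<in> \<Pi>" by blast
    show ?thesis
    proof (cases "\<exists>c. c \<noteq> u \<and> c \<noteq> v \<and> (\<forall>W. path E u W v \<longrightarrow> c \<in> pverts W)")
      case False
      then have con: "\<And>c. c \<noteq> u \<Longrightarrow> c \<noteq> v \<Longrightarrow> \<exists>W. path E u W v \<and> c \<notin> pverts W" by blast
      have "constant_on E u v \<Pi> D0" unfolding constant_on_def
      proof (intro ballI allI impI)
        fix \<pi> Q Q' assume h: "\<pi> \<in> \<Pi>" "path E u Q v" "path E u Q' v" "odd (length Q) = \<pi>" "odd (length Q') = \<pi>"
        show "fwd D0 Q = fwd D0 Q'"
          using fwd_constant[OF _ _ less(5) con h(2-5)] less(4)[OF h(1)] by blast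
      qed
      then show ?thesis using less(5) by blast
    next
      case True
      then obtain c where c: "c \<noteq> u" "c \<noteq> v" "\<And>W. path E u W v \<Longrightarrow> c \<in> pverts W" by blast
      interpret separation en E u v c by unfold_locales (use c in auto)
      obtain A B where AB: "Q0 = A @ B" "path E1 u A c" "path E2 c B v" by (rule split[OF Q0(1)])
      \<comment> \<open>The path \<open>Q0\<close> has edges on both sides, so each side is a proper
        subset of \<open>E\<close> and the induction applies.\<close>
      have ne: "A \<noteq> []" "B \<noteq> []" using path_Nil_iff[OF AB(2)] path_Nil_iff[OF AB(3)] c by auto
      have "pedges A \<noteq> {}" "pedges B \<noteq> {}" using ne by (auto simp: pedges_def)
      then have "E1 \<noteq> {}" "E2 \<noteq> {}" using path_pedges[OF AB(2)] path_pedges[OF AB(3)] by auto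
      then have "E1 \<subset> E" "E2 \<subset> E" using sub by (auto simp: E2_def)
      then have card: "card E1 < card E" "card E2 < card E" using psubset_card_mono less(2) by blast+
      have fin: "finite E1" "finite E2" using sub less(2) finite_subset by blast+
      define \<Pi>1 where "\<Pi>1 = {\<pi>. \<exists>Q2. path E2 c Q2 v \<and> (\<pi> \<noteq> odd (length Q2)) \<in> \<Pi>}"
      define \<Pi>2 where "\<Pi>2 = {\<pi>. \<exists>Q1. path E1 u Q1 c \<and> (\<pi> \<noteq> odd (length Q1)) \<in> \<Pi>}"
      obtain D1 where D1: "good E1 D1" "constant_on E1 u c \<Pi>1 D1"
        using less(1)[OF card(1) fin(1) c(1)[symmetric], of \<Pi>1] good_mono[OF less(5) sub(1)]
          ear_cond_E1 crossing_cond_E1 less(4) unfolding \<Pi>1_def by blast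
      obtain D2 where D2: "good E2 D2" "constant_on E2 c v \<Pi>2 D2"
        using less(1)[OF card(2) fin(2) c(2), of \<Pi>2] good_mono[OF less(5) sub(2)]
          ear_cond_E2 crossing_cond_E2 less(4) unfolding \<Pi>2_def by blast
      show ?thesis by (rule combine[OF D1 D2 \<Pi>1_def \<Pi>2_def])
    qed
  qed
qed

end

section \<open>Good orientations without obstructions\<close>

context incidence
begin

lemma walk_pedges: "walk E x p y \<Longrightarrow> pedges p \<subseteq> E"
  by (induction p arbitrary: x) fastforce+

definition even_theta :: "'e set \<Rightarrow> 'v \<Rightarrow> 'v \<Rightarrow> ('v, 'e) dart list \<Rightarrow> ('v, 'e) dart list \<Rightarrow> ('v, 'e) dart list \<Rightarrow> bool" where
  "even_theta E x y p q r \<longleftrightarrow> x \<noteq> y \<and> path E x p y \<and> path E x q y \<and> path E x r y \<and>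
     even (length p) \<and> even (length q) \<and> even (length r) \<and>
     meet_in p q {x, y} \<and> meet_in p r {x, y} \<and> meet_in q r {x, y}"

definition star_K4 :: "'e set \<Rightarrow> 'v \<Rightarrow> 'v \<Rightarrow> 'v \<Rightarrow> 'v \<Rightarrow> ('v, 'e) dart list \<Rightarrow> ('v, 'e) dart list \<Rightarrow>
    ('v, 'e) dart list \<Rightarrow> ('v, 'e) dart list \<Rightarrow> ('v, 'e) dart list \<Rightarrow> ('v, 'e) dart list \<Rightarrow> bool" where
  "star_K4 E w a b c p q r f g h \<longleftrightarrow>
     w \<noteq> a \<and> w \<noteq> b \<and> w \<noteq> c \<and> a \<noteq> b \<and> a \<noteq> c \<and> b \<noteq> c \<and>
     path E w p a \<and> path E w q b \<and> path E w r c \<and> path E a f b \<and> path E b g c \<and> path E c h a \<and>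
     even (length p) \<and> even (length q) \<and> even (length r) \<and>
     odd (length f) \<and> odd (length g) \<and> odd (length h) \<and>
     meet_in p q {w} \<and> meet_in p r {w} \<and> meet_in q r {w} \<and>
     meet_in f g {b} \<and> meet_in g h {c} \<and> meet_in h f {a} \<and>
     meet_in p f {a} \<and> meet_in p g {} \<and> meet_in p h {a} \<and>
     meet_in q f {b} \<and> meet_in q g {b} \<and> meet_in q h {} \<and>
     meet_in r f {} \<and> meet_in r g {c} \<and> meet_in r h {c}"

text \<open>The new edge \<open>e\<close> closes the \<open>uv\<close>-path to a circuit; the path
  in question is the arc of this circuit complementary to \<open>q\<close>.\<close>

lemma outer_path:
  assumes P: "path E u P x" and q: "path E x q y" and S: "path E y S v" and t: "path E u (P @ q @ S) v"
    and xy: "x \<noteq> y" and e: "en e = {u, v}"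
  shows "path (insert e E) y (S @ (v, e, u) # P) x" "meet_in q (S @ (v, e, u) # P) {x, y}"
    "pverts (S @ (v, e, u) # P) \<subseteq> pverts (P @ q @ S)"
proof -
  obtain z where z: "path E u P z" "path E z (q @ S) v" "meet_in P (q @ S) {z}"
    using path_appendI[OF t] by blast
  have [simp]: "z = x" using path_unique[OF z(1) P] .
  obtain w where w: "path E x q w" "path E w S v" "meet_in q S {w}"
    using path_appendI z(2) \<open>z = x\<close> by metis
  have [simp]: "w = y" using path_unique[OF w(1) q] .
  have qne: "x \<in> pverts q" "y \<in> pverts q" using path_ends[OF q] path_Nil_iff[OF q] xy by auto
  have xS: "x \<notin> pverts S" using w(3) qne xy by auto
  have yP: "y \<notin> pverts P" using z(3) qne xy by auto
  have PS: "pverts P \<inter> pverts S = {}" using z(3) xS by auto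
  have v: "v \<in> pverts S \<or> (v = y \<and> S = [])" using path_ends[OF S] path_Nil_iff[OF S] by blast
  have u: "u \<in> pverts P \<or> (u = x \<and> P = [])" using path_ends[OF P] path_Nil_iff[OF P] by blast
  have vP: "v \<notin> pverts P" using v PS yP by auto
  have uS: "u \<notin> pverts S" using u PS xS by auto
  have uv: "u \<noteq> v" using u v vP uS xy by auto
  have vx: "path (insert e E) v ((v, e, u) # P) x" using path_mono[OF P] e vP uv by auto
  show "path (insert e E) y (S @ (v, e, u) # P) x"
    by (rule path_append[OF path_mono[OF S] vx]) (use PS uS v in auto)
  have "u \<in> pverts q \<Longrightarrow> u = x" "v \<in> pverts q \<Longrightarrow> v = y" using u v z(3) w(3) by auto
  then show "meet_in q (S @ (v, e, u) # P) {x, y}" using z(3) w(3) by auto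
  show "pverts (S @ (v, e, u) # P) \<subseteq> pverts (P @ q @ S)" using u v qne by auto
qed

text \<open>The circuit closed by \<open>e\<close> is even, so the outer arc has the parity of
  \<open>q\<close>. Two even ears and this arc would form an even theta.\<close>

lemma ear_cond_if_no_theta:
  assumes no: "\<And>x y p q r. \<not> even_theta (insert e E) x y p q r" and e: "en e = {u, v}"
  shows "ear_cond E u v True"
  unfolding ear_cond_def
proof (intro allI impI)
  fix P q R S x y
  assume a: "path E u P x" "path E x q y" "path E x R y" "path E y S v"
    "path E u (P @ q @ S) v" "path E u (P @ R @ S) v" "x \<noteq> y" "meet_in q R {x, y}"
    "odd (length (P @ q @ S)) = True" "odd (length q) = odd (length R)"
  note o1 = outer_path[OF a(1,2,4,5,7) e] and o2 = outer_path[OF a(1,3,4,6,7) e]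
  let ?O = "S @ (v, e, u) # P"
  show "odd (length q)"
  proof (rule ccontr)
    assume "\<not> odd (length q)"
    then have "even (length q)" "even (length R)" "even (length ?O)" using a(9,10) by auto
    then have "even_theta (insert e E) x y q R (reverse ?O)"
      unfolding even_theta_def reverse_simps(4) pverts_reverse
      using a(7,8) o1 o2 path_mono[OF a(2), of "insert e E"] path_mono[OF a(3), of "insert e E"] path_reverse[OF o1(1)]
      by blast
    then show False using no by blast
  qed
qed

text \<open>The circuit \<open>A, B, C, Q\<close> with the chords \<open>R\<close> and
  \<open>R'\<close> is a subdivided \<open>K\<^sub>4\<close>. The parity conditions on the chords
  make all four triangles odd.\<close>

lemma crossing_cond_if_no_K4:
  assumes no: "\<And>w a b c p q r f g h. \<not> star_K4 (insert e E) w a b c p q r f g h" and e: "en e = {u, v}"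
  shows "crossing_cond E u v True"
  unfolding crossing_cond_def
proof (intro allI impI)
  fix P A B C S R R' x x' y y'
  assume a: "path E u P x" "path E x A x'" "path E x' B y" "path E y C y'" "path E y' S v"
    "path E u (P @ A @ B @ C @ S) v" "path E x R y" "path E x' R' y'" "distinct [x, x', y, y']"
    "meet_in R (P @ A @ B @ C @ S) {x, y}" "meet_in R' (P @ A @ B @ C @ S) {x', y'}"
    "pverts R \<inter> pverts R' = {}" "odd (length (P @ A @ B @ C @ S)) = True"
    "odd (length R) \<noteq> odd (length (A @ B))" "odd (length R') \<noteq> odd (length (B @ C))"
  let ?E = "insert e E"
  define Q where "Q = S @ (v, e, u) # P"
  obtain z where z: "path E u P z" "path E z ((A @ B @ C) @ S) v"
    using path_appendI[OF a(6)] by (metis append.assoc)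
  then have [simp]: "z = x" using path_unique[OF z(1) a(1)] by simp
  obtain w where w: "path E x (A @ B @ C) w" "path E w S v"
    using path_appendI z(2) \<open>z = x\<close> by metis
  obtain z1 where z1: "path E x A z1" "path E z1 (B @ C) w" "meet_in A (B @ C) {z1}"
    using path_appendI[OF w(1)] by blast
  have [simp]: "z1 = x'" using path_unique[OF z1(1) a(2)] .
  obtain z2 where z2: "path E x' B z2" "path E z2 C w" "meet_in B C {z2}"
    using path_appendI z1(2) \<open>z1 = x'\<close> by metis
  have [simp]: "z2 = y" using path_unique[OF z2(1) a(3)] .
  have [simp]: "w = y'" using path_unique z2(2) a(4) \<open>z2 = y\<close> by metis
  have tot: "path E u (P @ (A @ B @ C) @ S) v" using a(6) by simp
  have xy': "x \<noteq> y'" using a(9) by simp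
  note o = outer_path[OF a(1) w(1)[simplified] a(5) tot xy' e, folded Q_def]
  have ne: "A \<noteq> []" "B \<noteq> []" "C \<noteq> []" using path_Nil_iff[OF a(2)] path_Nil_iff[OF a(3)] path_Nil_iff[OF a(4)] a(9) by auto
  have ends: "x \<in> pverts A" "x' \<in> pverts A" "x' \<in> pverts B" "y \<in> pverts B" "y \<in> pverts C" "y' \<in> pverts C"
    using path_ends[OF a(2) ne(1)] path_ends[OF a(3) ne(2)] path_ends[OF a(4) ne(3)] by auto
  have AB: "meet_in A B {x'}" and BC: "meet_in B C {y}" using z1(3) z2(3) by auto
  have nin: "x \<notin> pverts B" "x \<notin> pverts C" "x' \<notin> pverts C" "y \<notin> pverts A" "y' \<notin> pverts A" "y' \<notin> pverts B"
    using z1(3) z2(3) ends a(9) by auto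
  have x'C: "meet_in A C {}" using z1(3) nin by auto
  have AO: "meet_in A Q {x}" "meet_in B Q {}" "meet_in C Q {y'}"
    using o(2) nin by auto
  have xQ: "x' \<notin> pverts Q" "y \<notin> pverts Q" using AO ends by auto
  have QV: "pverts Q \<subseteq> pverts (P @ A @ B @ C @ S)" using o(3) by simp
  have R: "meet_in R A {x}" "meet_in R B {y}" "meet_in R C {y}" "meet_in R Q {x}"
    using a(10) nin xQ QV by auto
  have R': "meet_in R' A {x'}" "meet_in R' B {x'}" "meet_in R' C {y'}" "meet_in R' Q {y'}"
    using a(11) nin xQ QV by auto
  have RR': "meet_in R R' {}" using a(12) by simp
  note F = AB BC x'C AO R R' RR'
  note meets = F[THEN Int_subset_mono1] F[THEN Int_subset_mono2]
  have paths: "path ?E x A x'" "path ?E x' B y" "path ?E y C y'" "path ?E y' Q x" "path ?E x R y" "path ?E x' R' y'"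
    using path_mono[OF _ subset_insertI[of E e]] a(2-4,7,8) o(1) by (simp_all add: path_mono[OF _ subset_insertI])
  note paths' = paths paths[THEN path_reverse]
  have dist: "x \<noteq> x'" "x \<noteq> y" "x \<noteq> y'" "x' \<noteq> y" "x' \<noteq> y'" "y \<noteq> y'" using a(9) by auto
  have lQ: "odd (length Q) \<longleftrightarrow> odd (length A + length B + length C)"
    using a(13) unfolding Q_def by auto
  show "odd (length A) = odd (length C)"
  proof (rule ccontr)
    assume neq: "odd (length A) \<noteq> odd (length C)"
    \<comment> \<open>With all triangles odd and the opposite paths \<open>A\<close>,
      \<open>C\<close> of different parity, exactly one vertex has three even paths:
      \<open>x'\<close>, \<open>x\<close>, \<open>y\<close>, \<open>y'\<close> in the order of the
      cases. The paths opposite to it are odd.\<close>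
    consider "even (length A)" "odd (length C)" "even (length B)" "even (length R')" "odd (length R)" "odd (length Q)"
      | "even (length A)" "odd (length C)" "odd (length B)" "odd (length R')" "even (length R)" "even (length Q)"
      | "odd (length A)" "even (length C)" "even (length B)" "odd (length R')" "even (length R)" "odd (length Q)"
      | "odd (length A)" "even (length C)" "odd (length B)" "even (length R')" "odd (length R)" "even (length Q)"
      using neq a(14,15) lQ by (cases "even (length A)"; cases "even (length B)") auto
    then show False
    proof cases
      case 1
      have "star_K4 ?E x' x y y' (reverse A) B R' R C Q"
        unfolding star_K4_def reverse_simps(4) pverts_reverse
        by (intro conjI) ((rule paths' 1 dist dist[THEN not_sym]) | (rule meets; simp; fail))+
      then show False using no by blast
    next
      case 2
      have "star_K4 ?E x x' y y' A R (reverse Q) B C (reverse R')"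
        unfolding star_K4_def reverse_simps(4) pverts_reverse
        by (intro conjI) ((rule paths' 2 dist dist[THEN not_sym]) | (rule meets; simp; fail))+
      then show False using no by blast
    next
      case 3
      have "star_K4 ?E y x' y' x (reverse B) C (reverse R) R' Q A"
        unfolding star_K4_def reverse_simps(4) pverts_reverse
        by (intro conjI) ((rule paths' 3 dist dist[THEN not_sym]) | (rule meets; simp; fail))+
      then show False using no by blast
    next
      case 4
      have "star_K4 ?E y' y x' x (reverse C) (reverse R') Q (reverse B) (reverse A) R"
        unfolding star_K4_def reverse_simps(4) pverts_reverse
        by (intro conjI) ((rule paths' 4 dist dist[THEN not_sym]) | (rule meets; simp; fail))+
      then show False using no by blast
    qed
  qed
qed

lemma even_theta_mono: "even_theta E x y p q r \<Longrightarrow> E \<subseteq> E' \<Longrightarrow> even_theta E' x y p q r"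
  unfolding even_theta_def using path_mono by blast

lemma star_K4_mono: "star_K4 E w a b c p q r f g h \<Longrightarrow> E \<subseteq> E' \<Longrightarrow> star_K4 E' w a b c p q r f g h"
  unfolding star_K4_def by (elim conjE) (intro conjI; (assumption | erule path_mono))

theorem exists_good_orientation:
  assumes "finite E" "\<And>e. e \<in> E \<Longrightarrow> \<exists>a b. en e = {a, b}"
    and "\<And>x y p q r. \<not> even_theta E x y p q r" "\<And>w a b c p q r f g h. \<not> star_K4 E w a b c p q r f g h"
  shows "\<exists>D. good E D"
  using assms
proof (induction E rule: finite_induct)
  case empty
  have "\<not> closed_path {} x C" for x C
    by (cases C) (auto simp: closed_path_def)
  then show ?case by (auto simp: good_def orients_def)
next
  case (insert e E)
  have m: "E \<subseteq> insert e E" by blast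
  obtain D0 where D0: "good E D0"
  proof -
    have "\<not> even_theta E x y p q r" for x y p q r using insert.prems(2) even_theta_mono[OF _ m] by metis
    moreover have "\<not> star_K4 E w a b c p q r f g h" for w a b c p q r f g h using insert.prems(3) star_K4_mono[OF _ m] by metis
    ultimately have "\<exists>D. good E D" using insert.IH insert.prems(1) by simp
    then show thesis using that by blast
  qed
  obtain u v where e: "en e = {u, v}" using insert.prems(1) by blast
  \<comment> \<open>A circuit through \<open>e\<close>, rotated to start there, is \<open>e\<close>
    followed by a path joining its ends; even circuits correspond to odd paths.\<close>
  have rot: "\<exists>a b p. path E b p a \<and> {a, b} = {u, v} \<and> even (length p) = odd (length C) \<and>
      (\<forall>D. fwd D C = ((D e = (a, b)) \<noteq> fwd D p))" if C: "closed_path (insert e E) x C" "e \<in> pedges C" for x C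
  proof -
    obtain d where d: "d \<in> set C" "fst (snd d) = e" using C(2) by (auto simp: pedges_def)
    obtain a b where ab: "d = (a, e, b)" using d(2) by (cases d) auto
    obtain A B where AB: "C = A @ d # B" using d(1) split_list by metis
    have "closed_path (insert e E) a (d # B @ A)" using closed_path_rotate[of "insert e E" x A "d # B"] C(1) AB ab by simp
    note c = closed_path_Cons[OF this[unfolded ab]]
    then have "path E b (B @ A) a" using path_restrict[of "insert e E" b "B @ A" a E] path_pedges[of "insert e E" b "B @ A" a]
      by auto
    moreover have "{a, b} = {u, v}" using c e by simp
    moreover have "fwd D C = ((D e = (a, b)) \<noteq> fwd D (B @ A))" for D using AB ab by auto
    moreover have "even (length (B @ A)) = odd (length C)" using AB by auto
    ultimately show ?thesis by blast
  qed
  have gd: "good (insert e E) D'" if D: "good E D" "\<And>f. f \<in> E \<Longrightarrow> D' f = D f" "D' e = (u, v) \<or> D' e = (v, u)"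
    and h: "\<And>a b p. path E b p a \<Longrightarrow> {a, b} = {u, v} \<Longrightarrow> odd (length p) \<Longrightarrow> (D' e = (a, b)) \<noteq> fwd D p" for D D'
    unfolding good_def
  proof (intro conjI allI impI)
    show "orients (insert e E) D'" using D e by (auto simp: good_def orients_def)
    fix x C assume C: "closed_path (insert e E) x C" "even (length C)"
    show "fwd D' C"
    proof (cases "e \<in> pedges C")
      case False
      have "walk (insert e E) x C x" using C(1) by (simp add: closed_path_def)
      then have "pedges C \<subseteq> insert e E" by (rule walk_pedges)
      then have "pedges C \<subseteq> E" using False by auto
      moreover from this have "closed_path E x C" using closed_path_mono[OF C(1)] by blast
      then have "fwd D C" using D(1) C(2) by (auto simp: good_def)
      ultimately show ?thesis using fwd_cong[of C D' D] D(2) by auto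
    next
      case True
      obtain a b p where p: "path E b p a" "{a, b} = {u, v}" "odd (length p)" "fwd D' C = ((D' e = (a, b)) \<noteq> fwd D' p)"
        using rot[OF C(1) True] C(2) by auto
      have "fwd D' p = fwd D p" by (rule fwd_cong) (use D(2) path_pedges[OF p(1)] in auto)
      then show ?thesis using h[OF p(1-3)] p(4) by simp
    qed
  qed
  show ?case
  proof (cases "u = v")
    case True
    have "good (insert e E) (D0(e := (u, v)))"
    proof (rule gd[OF D0])
      fix a b p assume p: "path E b p a" "{a, b} = {u, v}" "odd (length p)"
      then have "a = b" using True by (auto simp: doubleton_eq_iff)
      \<comment> \<open>An even circuit contains no loop, so a new loop may be directed
        arbitrarily.\<close>
      then have "p = []" using path_Nil_iff[OF p(1)] by simp
      then show "((D0(e := (u, v))) e = (a, b)) \<noteq> fwd D0 p" using p(3) by simp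
    qed (use insert.hyps in auto)
    then show ?thesis by blast
  next
    case False
    have "ear_cond E u v True \<and> crossing_cond E u v True"
      using ear_cond_if_no_theta[OF insert.prems(2) e] crossing_cond_if_no_K4[OF insert.prems(3) e] by blast
    then obtain D where D: "good E D" "constant_on E u v {True} D"
      using exists_constant_orientation[OF insert.hyps(1) False _ D0, of "{True}"] by blast
    then have o: "orients E D" by (simp add: good_def)
    have k: "\<exists>k. \<forall>Q. path E u Q v \<longrightarrow> odd (length Q) \<longrightarrow> fwd D Q = k"
      using D(2) unfolding constant_on_def by (metis insertI1)
    then obtain k where k: "\<And>Q. path E u Q v \<Longrightarrow> odd (length Q) \<Longrightarrow> fwd D Q = k" by blast
    \<comment> \<open>The number of forward edges of a circuit through \<open>e\<close> has to be
      odd, so \<open>e\<close> runs against the odd \<open>uv\<close>-paths in the circuit exactly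
      when their common forward parity \<open>k\<close> is already odd.\<close>
    define D' where "D' = D(e := if k then (u, v) else (v, u))"
    have "good (insert e E) D'"
    proof (rule gd[OF D(1)])
      fix a b p assume p: "path E b p a" "{a, b} = {u, v}" "odd (length p)"
      consider "a = u" "b = v" | "a = v" "b = u" using p(2) by (auto simp: doubleton_eq_iff)
      then show "(D' e = (a, b)) \<noteq> fwd D p"
      proof cases
        case 1
        have "fwd D (reverse p) = k" using k path_reverse[OF p(1)] 1 p(3) by simp
        then show ?thesis using fwd_reverse[OF o p(1)] p(3) 1 False by (auto simp: D'_def)
      next
        case 2
        have "fwd D p = k" using k p 2 by simp
        then show ?thesis using 2 False by (auto simp: D'_def)
      qed
    qed (use insert.hyps in \<open>auto simp: D'_def\<close>)
    then show ?thesis by blast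
  qed
qed

end

section \<open>Circuits, isomorphisms and subdivisions\<close>

abbreviation "gwalk G \<equiv> incidence.walk (ends G) (edges G)"
abbreviation "gpath G \<equiv> incidence.path (ends G) (edges G)"
abbreviation "gclosed G \<equiv> incidence.closed_path (ends G) (edges G)"
abbreviation "ggood G \<equiv> incidence.good (ends G) (edges G)"

section \<open>Transport of dart lists along maps of vertices and edges\<close>

definition map_darts :: "('v \<Rightarrow> 'w) \<Rightarrow> ('e \<Rightarrow> 'f) \<Rightarrow> ('v, 'e) dart list \<Rightarrow> ('w, 'f) dart list" where
  "map_darts f g p = map (\<lambda>(a, e, b). (f a, g e, f b)) p"

lemma map_darts_simps [simp]:
  "map_darts f g [] = []" "map_darts f g ((a, e, b) # p) = (f a, g e, f b) # map_darts f g p"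
  "map_darts f g (p @ q) = map_darts f g p @ map_darts f g q" "length (map_darts f g p) = length p"
  by (auto simp: map_darts_def)

lemma pverts_map_darts [simp]: "pverts (map_darts f g p) = f ` pverts p"
  by (induction p) auto

lemma pedges_map_darts [simp]: "pedges (map_darts f g p) = g ` pedges p"
  by (induction p) auto

lemma map_darts_fst: "map fst (map_darts f g p) = map f (map fst p)"
  by (induction p) auto

lemma map_darts_edge: "edge_list (map_darts f g p) = map g (edge_list p)"
  by (induction p) auto

context incidence
begin

lemma walk_map:
  "walk E x p y \<Longrightarrow> (\<And>e. e \<in> pedges p \<Longrightarrow> g e \<in> E' \<and> en' (g e) = f ` en e) \<Longrightarrow>
    incidence.walk en' E' (f x) (map_darts f g p) (f y)"
  by (induction p arbitrary: x) (auto simp: incidence.walk.simps)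

lemma path_map:
  "path E x p y \<Longrightarrow> inj_on f (pverts p) \<Longrightarrow> (\<And>e. e \<in> pedges p \<Longrightarrow> g e \<in> E' \<and> en' (g e) = f ` en e) \<Longrightarrow>
    incidence.path en' E' (f x) (map_darts f g p) (f y)"
proof (induction p arbitrary: x)
  case Nil
  then show ?case by (simp add: incidence.path.simps)
next
  case (Cons d p)
  obtain a e b where d: "d = (a, e, b)" by (cases d)
  have "f a \<noteq> f b" "f a \<notin> f ` pverts p" using Cons.prems(1,2) d by (auto simp: inj_on_def)
  moreover have "incidence.path en' E' (f b) (map_darts f g p) (f y)"
    using Cons.IH[of b] Cons.prems d by (auto simp: inj_on_def)
  ultimately show ?case using Cons.prems d by (auto simp: incidence.path.simps)
qed

lemma closed_path_ends:
  assumes "closed_path E x C" "even (length C)" "(a, e, b) \<in> set C"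
  shows "a \<noteq> b"
proof -
  obtain A B where AB: "C = A @ (a, e, b) # B" using assms(3) split_list by metis
  have c: "closed_path E a ((a, e, b) # B @ A)" using closed_path_rotate[of E x A "(a, e, b) # B"] assms(1) AB by simp
  have "path E b (B @ A) a" using closed_path_Cons[OF c] by simp
  moreover have "B @ A \<noteq> []" using assms(2) AB by auto
  ultimately show ?thesis using path_ends by blast
qed

lemma walk_next: "walk E x C y \<Longrightarrow> i < length C \<Longrightarrow> snd (snd (C ! i)) = (if Suc i < length C then fst (C ! Suc i) else y)"
proof (induction C arbitrary: x i)
  case (Cons d C)
  obtain a e b where d: "d = (a, e, b)" by (cases d)
  show ?case
  proof (cases i)
    case 0
    then show ?thesis using Cons.prems d by (cases C) auto
  next
    case (Suc j)
    then show ?thesis using Cons.IH[of b j] Cons.prems d by auto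
  qed
qed simp

lemma walk_nthI:
  "(\<And>i. i < length C \<Longrightarrow> fst (C ! i) = f i \<and> snd (snd (C ! i)) = f (Suc i) \<and> fst (snd (C ! i)) \<in> E \<and>
     en (fst (snd (C ! i))) = {f i, f (Suc i)}) \<Longrightarrow> walk E (f 0) C (f (length C))"
proof (induction C arbitrary: f)
  case (Cons d C)
  obtain a e b where d: "d = (a, e, b)" by (cases d)
  have "walk E (f (Suc 0)) C (f (Suc (length C)))"
    using Cons.IH[of "\<lambda>i. f (Suc i)"] Cons.prems[of "Suc i" for i] by simp
  then show ?case using Cons.prems[of 0] d by auto
qed simp

end

section \<open>Translation between circuits as edge sets and closed dart lists\<close>

lemma closed_path_traversal:
  assumes G: "finite_mgraph G" and C: "gclosed G x C"
  shows "traversal G (map fst C) (edge_list C)" "agreeing D (map fst C) (edge_list C) = length (filter (\<lambda>(a, e, b). D e = (a, b)) C)"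
proof -
  interpret incidence "ends G" .
  have w: "walk (edges G) x C x" and ne: "C \<noteq> []" using C by (auto simp: closed_path_def)
  have d: "snd (snd (C ! i)) = fst (C ! (Suc i mod length C))" if "i < length C" for i
  proof (cases "Suc i < length C")
    case True
    then show ?thesis using walk_next[OF w that] by simp
  next
    case False
    then have "Suc i = length C" using that by simp
    moreover have "fst (C ! 0) = x" using w ne by (cases C) auto
    ultimately show ?thesis using walk_next[OF w that] by simp
  qed
  have e: "ends G (fst (snd (C ! i))) = {fst (C ! i), snd (snd (C ! i))}" "fst (snd (C ! i)) \<in> edges G" if "i < length C" for i
  proof -
    have "(fst (C ! i), fst (snd (C ! i)), snd (snd (C ! i))) \<in> set C" using that by simp
    then show "ends G (fst (snd (C ! i))) = {fst (C ! i), snd (snd (C ! i))}" by (rule dart_ends[OF w])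
    have "fst (snd (C ! i)) \<in> pedges C" using that by (auto simp: pedges_def)
    then show "fst (snd (C ! i)) \<in> edges G" using walk_pedges[OF w] by auto
  qed
  have v: "fst (C ! i) \<in> verts G" if "i < length C" for i
    using e[OF that] G unfolding finite_mgraph_def by (metis doubleton_eq_iff)
  show "traversal G (map fst C) (edge_list C)"
    unfolding traversal_def
  proof (intro conjI allI impI)
    show "set (map fst C) \<subseteq> verts G" using v by (auto simp: in_set_conv_nth) (metis fst_conv)
    show "set (edge_list C) \<subseteq> edges G" using walk_pedges[OF w] by (simp add: pedges_def)
    fix i assume i: "i < length (edge_list C)"
    then have "Suc i mod length C < length C" using ne by simp
    then show "ends G (edge_list C ! i) = {map fst C ! i, map fst C ! (Suc i mod length (edge_list C))}"
      using i d e by simp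
  qed (use C in \<open>auto simp: closed_path_def\<close>)
  have "{i. i < length C \<and> D (edge_list C ! i) = (map fst C ! i, map fst C ! (Suc i mod length C))} =
    {i. i < length C \<and> (case C ! i of (a, e, b) \<Rightarrow> D e = (a, b))}"
  proof (intro Collect_cong conj_cong refl)
    fix i assume i: "i < length C"
    then have "Suc i mod length C < length C" using ne by simp
    then show "(D (edge_list C ! i) = (map fst C ! i, map fst C ! (Suc i mod length C))) = (case C ! i of (a, e, b) \<Rightarrow> D e = (a, b))"
      using i d[OF i] by (cases "C ! i") simp
  qed
  then show "agreeing D (map fst C) (edge_list C) = length (filter (\<lambda>(a, e, b). D e = (a, b)) C)"
    unfolding agreeing_def length_filter_conv_card by simp
qed

lemma traversal_closed_path:
  assumes "traversal G vs es"
  obtains C x where "gclosed G x C" "map fst C = vs" "edge_list C = es"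
proof -
  interpret incidence "ends G" .
  define n where "n = length es"
  define C where "C = map (\<lambda>i. (vs ! i, es ! i, vs ! (Suc i mod n))) [0..<n]"
  have T: "es \<noteq> []" "length vs = n" "distinct vs" "distinct es" "set es \<subseteq> edges G"
    "\<And>i. i < n \<Longrightarrow> ends G (es ! i) = {vs ! i, vs ! (Suc i mod n)}" using assms by (auto simp: traversal_def n_def)
  have m: "map fst C = vs" "edge_list C = es" using T by (auto simp: C_def n_def comp_def intro!: nth_equalityI)
  have "walk (edges G) (vs ! (0 mod n)) C (vs ! (length C mod n))"
  proof (rule walk_nthI[where f="\<lambda>i. vs ! (i mod n)"])
    fix i assume "i < length C"
    then have "i < n" by (simp add: C_def)
    then show "fst (C ! i) = vs ! (i mod n) \<and> snd (snd (C ! i)) = vs ! (Suc i mod n) \<and> fst (snd (C ! i)) \<in> edges G \<and>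
      ends G (fst (snd (C ! i))) = {vs ! (i mod n), vs ! (Suc i mod n)}"
      using T(5,6) by (auto simp: C_def n_def)
  qed
  then have "closed_path (edges G) (vs ! 0) C"
    unfolding closed_path_def m using T by (auto simp: C_def n_def)
  then show thesis using that m by blast
qed

lemma orientable_iff_good:
  assumes "finite_mgraph G"
  shows "(orientation G D \<and> (\<forall>A. even_circuit G A \<longrightarrow> clockwise_odd G D A)) \<longleftrightarrow> ggood G D"
proof -
  interpret incidence "ends G" .
  have o: "orientation G D \<longleftrightarrow> orients (edges G) D" by (simp add: orientation_def orients_def)
  show ?thesis
  proof
    assume L: "orientation G D \<and> (\<forall>A. even_circuit G A \<longrightarrow> clockwise_odd G D A)"
    show "ggood G D" unfolding good_def
    proof (intro conjI allI impI)
      fix x C assume C: "closed_path (edges G) x C" "even (length C)"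
      note t = closed_path_traversal[OF assms C(1)]
      let ?es = "edge_list C"
      have "card (set ?es) = length C" using C(1) distinct_card[of ?es] by (simp add: closed_path_def)
      then have "even_circuit G (set ?es)" using t(1) C(2) unfolding even_circuit_def circuit_def by metis
      then have "clockwise_odd G D (set ?es)" using L by blast
      then show "fwd D C" using clockwise_odd_iff[OF t(1)] C(2) L t(2)[of D] by (simp add: fwd_def)
    qed (use L o in blast)
  next
    assume R: "ggood G D"
    have "clockwise_odd G D A" if A: "even_circuit G A" for A
    proof -
      obtain vs es where t: "traversal G vs es" "set es = A" using A by (auto simp: even_circuit_def circuit_def)
      obtain C x where C: "closed_path (edges G) x C" "map fst C = vs" "edge_list C = es"
        using traversal_closed_path[OF t(1)] by metis
      have "card A = length es" using t distinct_card by (auto simp: traversal_def)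
      then have "even (length C)" using A C(3) by (auto simp: even_circuit_def)
      then have "fwd D C" using R C(1) by (auto simp: good_def)
      then have "odd (agreeing D vs es)" using closed_path_traversal(2)[OF assms C(1), of D] C(2,3) by (simp add: fwd_def)
      then show ?thesis using t by (auto simp: clockwise_odd_def)
    qed
    then show "orientation G D \<and> (\<forall>A. even_circuit G A \<longrightarrow> clockwise_odd G D A)" using R o by (auto simp: good_def)
  qed
qed

lemma walk_cong: "(\<And>e. e \<in> pedges p \<Longrightarrow> en e = en' e \<and> (e \<in> E \<longleftrightarrow> e \<in> E')) \<Longrightarrow> incidence.walk en E x p y = incidence.walk en' E' x p y"
  by (induction p arbitrary: x) (auto simp: incidence.walk.simps)

lemma path_cong: "(\<And>e. e \<in> pedges p \<Longrightarrow> en e = en' e \<and> (e \<in> E \<longleftrightarrow> e \<in> E')) \<Longrightarrow> incidence.path en E x p y = incidence.path en' E' x p y"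
  by (induction p arbitrary: x) (auto simp: incidence.path.simps)

lemma closed_path_cong: "(\<And>e. e \<in> pedges p \<Longrightarrow> en e = en' e \<and> (e \<in> E \<longleftrightarrow> e \<in> E')) \<Longrightarrow>
    incidence.closed_path en E x p = incidence.closed_path en' E' x p"
  using walk_cong[of p en en' E E' x x] by (simp add: incidence.closed_path_def)

lemma closed_path_pedges: "incidence.closed_path en E x p \<Longrightarrow> pedges p \<subseteq> E"
  unfolding incidence.closed_path_def using incidence.walk_pedges by metis

section \<open>Good orientations of subgraphs, isomorphic copies and subdivisions\<close>

lemma good_subgraph:
  assumes "subgraph K G" "ggood G D"
  shows "ggood K D"
  unfolding incidence.good_def
proof (intro conjI allI impI)
  have e: "\<And>e. e \<in> edges K \<Longrightarrow> ends K e = ends G e" "edges K \<subseteq> edges G" using assms(1) by (auto simp: subgraph_def)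
  show "incidence.orients (ends K) (edges K) D" using assms(2) e by (auto simp: incidence.good_def incidence.orients_def)
  fix x C assume C: "gclosed K x C" "even (length C)"
  have "gclosed G x C" using C(1) closed_path_cong[of C "ends K" "ends G" "edges K" "edges G" x] closed_path_pedges[OF C(1)] e by auto
  then show "fwd D C" using assms(2) C(2) by (auto simp: incidence.good_def)
qed

lemma not_good_K23: "\<not> ggood (complete_bipartite 2 3) D"
proof
  interpret incidence "ends (complete_bipartite 2 3)" .
  let ?E = "edges (complete_bipartite 2 3)"
  assume g: "good ?E D"
  define p :: "nat \<Rightarrow> (nat + nat, nat \<times> nat) dart list" where
    "p j = [(Inl 0, (0, j), Inr j), (Inr j, (1, j), Inl 1)]" for j
  have p: "path ?E (Inl 0) (p j) (Inl 1)" if "j < 3" for j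
    using that by (auto simp: p_def complete_bipartite_def incidence.path.simps)
  have "fwd D (p i) \<noteq> fwd D (p j)" if "i < 3" "j < 3" "i \<noteq> j" for i j
    using good_cycle[OF g p[OF that(1)] p[OF that(2)]] that by (auto simp: p_def)
  \<comment> \<open>Three truth values cannot be pairwise different.\<close>
  from this[of 0 1] this[of 0 2] this[of 1 2] show False by auto
qed

text \<open>The incidence part of \<open>finite_mgraph\<close>, which is carried along isomorphisms
  and subdivision steps so that orientations can be pulled back.\<close>

definition wf_mgraph :: "('v, 'e) mgraph \<Rightarrow> bool" where
  "wf_mgraph G \<longleftrightarrow> (\<forall>e\<in>edges G. ends G e \<subseteq> verts G \<and> (\<exists>a b. ends G e = {a, b}))"

lemma good_isomorphic:
  assumes wf: "wf_mgraph F" and iso: "isomorphic F H" and g: "ggood H D"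
  shows "\<exists>D. ggood F D"
proof -
  obtain f g where f: "bij_betw f (verts F) (verts H)" and g': "bij_betw g (edges F) (edges H)"
    and e: "\<And>e. e \<in> edges F \<Longrightarrow> ends H (g e) = f ` ends F e" using iso unfolding isomorphic_def by blast
  define D' where "D' = (\<lambda>e. let h = inv_into (verts F) f in (h (fst (D (g e))), h (snd (D (g e)))))"
  have inj: "inj_on f (verts F)" "inj_on g (edges F)" using f g' by (auto simp: bij_betw_def)
  have D: "\<exists>a b. ends F e = {a, b} \<and> D' e = (a, b) \<and> D (g e) = (f a, f b)" if ee: "e \<in> edges F" for e
  proof -
    have "\<exists>a b. ends F e = {a, b}" "ends F e \<subseteq> verts F" using wf ee unfolding wf_mgraph_def by simp_all
    then obtain a b where ab: "ends F e = {a, b}" "a \<in> verts F" "b \<in> verts F" by auto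
    have "g e \<in> edges H" using g' ee by (auto simp: bij_betw_def)
    then have "{fst (D (g e)), snd (D (g e))} = {f a, f b}" using g e[OF ee] ab by (auto simp: incidence.good_def incidence.orients_def)
    then have "D (g e) = (f a, f b) \<or> D (g e) = (f b, f a)" by (cases "D (g e)") (auto simp: doubleton_eq_iff)
    then show ?thesis
    proof
      assume "D (g e) = (f a, f b)"
      then show ?thesis using ab inj(1) by (intro exI[of _ a] exI[of _ b]) (simp add: D'_def)
    next
      assume "D (g e) = (f b, f a)"
      then show ?thesis using ab inj(1) by (intro exI[of _ b] exI[of _ a]) (simp add: D'_def insert_commute)
    qed
  qed
  have "ggood F D'" unfolding incidence.good_def
  proof (intro conjI allI impI)
    show "incidence.orients (ends F) (edges F) D'" unfolding incidence.orients_def using D by fastforce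
    fix x C assume C: "gclosed F x C" "even (length C)"
    have w: "gwalk F x C x" using C(1) by (simp add: incidence.closed_path_def)
    have pe: "pedges C \<subseteq> edges F" using closed_path_pedges[OF C(1)] .
    have gw: "gwalk H (f x) (map_darts f g C) (f x)"
      by (rule incidence.walk_map[OF w]) (use pe e bij_betwE[OF g'] in blast)
    have en: "ends F e = {a, b} \<and> a \<in> verts F \<and> b \<in> verts F \<and> e \<in> edges F" if "(a, e, b) \<in> set C" for a e b
    proof -
      have "ends F e = {a, b}" by (rule incidence.dart_ends[OF w that])
      moreover have "e \<in> edges F" using pe that by (force simp: pedges_def)
      ultimately show ?thesis using wf unfolding wf_mgraph_def by blast
    qed
    have "set (map fst C) \<subseteq> verts F" using en by auto
    then have "distinct (map fst (map_darts f g C))" "distinct (edge_list (map_darts f g C))"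
      using C(1) inj pe unfolding map_darts_fst map_darts_edge incidence.closed_path_def pedges_def
      by (metis distinct_map inj_on_subset, metis distinct_map inj_on_subset image_set)
    then have "gclosed H (f x) (map_darts f g C)" using gw C(1) by (auto simp: incidence.closed_path_def map_darts_def)
    then have 1: "fwd D (map_darts f g C)" using g C(2) by (auto simp: incidence.good_def)
    have "D (g e) = (f a, f b) \<longleftrightarrow> D' e = (a, b)" if m: "(a, e, b) \<in> set C" for a e b
    proof -
      obtain a' b' where d: "ends F e = {a', b'}" "D' e = (a', b')" "D (g e) = (f a', f b')" using D en[OF m] by blast
      then show ?thesis using en[OF m] inj(1) by (auto simp: inj_on_def doubleton_eq_iff)
    qed
    then have "fwd D (map_darts f g C) = fwd D' C" by (induction C) auto
    then show "fwd D' C" using 1 by simp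
  qed
  then show ?thesis by blast
qed

text \<open>The edge \<open>e\<close> is directed from \<open>u\<close> to \<open>v\<close> iff the
  path \<open>T\<close> replacing it has an odd number of forward edges. As \<open>T\<close> has odd
  length, reversing it flips its forward parity just as for a single edge, so \<open>e\<close> and
  \<open>T\<close> contribute equally to every even circuit in either sense. A loop \<open>e\<close>
  lies on no even circuit.\<close>

lemma good_double_subdivide:
  assumes ds: "double_subdivide F F'" and wf: "wf_mgraph F" and g: "ggood F' D'"
  shows "\<exists>D. ggood F D"
  using ds
proof cases
  case (1 e u v x y a b c)
  have eF: "ends F e \<subseteq> verts F" using wf 1(2) by (auto simp: wf_mgraph_def)
  have ed: "edges F' = edges F - {e} \<union> {a, b, c}" "ends F' = (ends F)(a := {u, x}, b := {x, y}, c := {y, v})"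
    using 1(1) by simp_all
  have old: "ends F' f = ends F f" if "f \<in> edges F" for f using that 1 by auto
  define T where "T = [(u, a, x), (x, b, y), (y, c, v)]"
  have uvV: "u \<in> verts F" "v \<in> verts F" using eF 1(3) by auto
  then have fr: "u \<noteq> x" "u \<noteq> y" "v \<noteq> x" "v \<noteq> y" using 1 by auto
  define D where "D = D'(e := if fwd D' T then (u, v) else (v, u))"
  interpret A: incidence "ends F" .
  interpret B: incidence "ends F'" .
  have oB: "B.orients (edges F') D'" using g by (simp add: B.good_def)
  have "ggood F D" unfolding A.good_def
  proof (intro conjI allI impI)
    show "A.orients (edges F) D" unfolding A.orients_def
    proof
      fix f assume f: "f \<in> edges F"
      show "{fst (D f), snd (D f)} = ends F f"
      proof (cases "f = e")
        case False
        then have "f \<in> edges F'" using f ed by auto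
        then show ?thesis using oB old[OF f] False by (auto simp: B.orients_def D_def)
      qed (use 1(3) in \<open>auto simp: D_def\<close>)
    qed
    fix z C assume C: "A.closed_path (edges F) z C" "even (length C)"
    show "fwd D C"
    proof (cases "e \<in> pedges C")
      case False
      then have "B.closed_path (edges F') z C"
        using C(1) closed_path_cong[of C "ends F" "ends F'" "edges F" "edges F'" z] closed_path_pedges[OF C(1)] old ed by auto
      then have "fwd D' C" using g C(2) by (auto simp: B.good_def)
      moreover have "fwd D C = fwd D' C" by (rule fwd_cong) (use False in \<open>auto simp: D_def\<close>)
      ultimately show ?thesis by simp
    next
      case True
      then obtain d where d: "d \<in> set C" "fst (snd d) = e" by (auto simp: pedges_def)
      obtain s t where st: "d = (s, e, t)" using d(2) by (cases d) auto
      obtain X Y where XY: "C = X @ (s, e, t) # Y" using d(1) st split_list by metis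
      let ?p = "Y @ X"
      have c: "A.closed_path (edges F) s ((s, e, t) # ?p)" using A.closed_path_rotate[of "edges F" z X "(s, e, t) # Y"] C(1) XY by simp
      note cc = A.closed_path_Cons[OF c]
      have "s \<noteq> t" using A.closed_path_ends[OF C(1,2)] d st by auto
      have uv: "{s, t} = {u, v}" using cc 1(3) by simp
      have pe: "pedges ?p \<subseteq> edges F - {e}" using cc A.path_pedges by blast
      have "ends F f = ends F' f \<and> (f \<in> edges F \<longleftrightarrow> f \<in> edges F')" if "f \<in> pedges ?p" for f
        using that pe old[of f] ed(1) by blast
      from path_cong[of ?p, OF this] have p: "B.path (edges F') t ?p s" using cc by blast
      have pv: "pverts ?p \<subseteq> verts F"
      proof
        fix w assume "w \<in> pverts ?p"
        then obtain a' e' b' where m: "(a', e', b') \<in> set ?p" "w \<in> {a', b'}" unfolding pverts_def by force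
        then have "ends F e' = {a', b'}" using A.dart_ends A.path_walk cc by metis
        moreover have "e' \<in> edges F" using m pe by (force simp: pedges_def)
        ultimately show "w \<in> verts F" using wf m unfolding wf_mgraph_def by auto
      qed
      have T: "B.path (edges F') u T v" 
      proof -
        have "s \<in> {u, v}" "t \<in> {u, v}" using uv by auto
        then have "u \<noteq> v" using \<open>s \<noteq> t\<close> by auto
        then show ?thesis unfolding T_def ed using fr 1(6,10) by (simp add: incidence.path.simps)
      qed
      have dD: "fwd D ?p = fwd D' ?p" by (rule fwd_cong) (use pe in \<open>auto simp: D_def\<close>)
      have C': "fwd D C = ((D e = (s, t)) \<noteq> fwd D' ?p)" using XY dD by auto
      have xp: "x \<notin> pverts ?p" "y \<notin> pverts ?p" using pv 1 by auto
      \<comment> \<open>Applied with \<open>T\<close> or its reverse as \<open>Q\<close>: together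
        with the rest \<open>?p\<close> of the circuit it forms an even circuit of the subdivided
        graph.\<close>
      have gc: "fwd D' Q \<noteq> fwd D' ?p" if "B.path (edges F') s Q t" "pverts Q \<subseteq> {u, v, x, y}" "odd (length Q)" for Q
      proof -
        have "odd (length ?p)" using C(2) XY by auto
        moreover have "meet_in Q (reverse ?p) {s, t}" using that(2) uv xp by auto
        ultimately show ?thesis
          using B.good_cycle[OF g that(1) B.path_reverse[OF p] _ _ \<open>s \<noteq> t\<close>] that(3) B.fwd_reverse[OF oB p] by simp
      qed
      consider "s = u" "t = v" | "s = v" "t = u" using uv by (auto simp: doubleton_eq_iff)
      then show ?thesis
      proof cases
        case 1
        then have "fwd D' T \<noteq> fwd D' ?p" using T by (intro gc) (auto simp: T_def)
        then show ?thesis using C' 1 \<open>s \<noteq> t\<close> by (auto simp: D_def)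
      next
        case 2
        then have "fwd D' (reverse T) \<noteq> fwd D' ?p" using B.path_reverse[OF T] by (intro gc) (auto simp: T_def)
        moreover have "fwd D' (reverse T) \<longleftrightarrow> \<not> fwd D' T" using B.fwd_reverse[OF oB T] by (simp add: T_def)
        ultimately show ?thesis using C' 2 \<open>s \<noteq> t\<close> by (auto simp: D_def)
      qed
    qed
  qed
  then show ?thesis by blast
qed

section \<open>Contraction of an odd circuit\<close>

context incidence
begin

lemma closed_path_arcs:
  assumes C: "closed_path A x (X @ Y @ Z)" and ne: "Y \<noteq> []" "Z \<noteq> []"
  shows "path A (fst (hd Y)) Y (fst (hd Z))" "path A (fst (hd Z)) (Z @ X) (fst (hd Y))"
proof -
  have r: "closed_path A (fst (hd Y)) (Y @ Z @ X)" using closed_path_rotate[of A x X "Y @ Z"] C ne by simp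
  then obtain y where y: "walk A (fst (hd Y)) Y y" "walk A y (Z @ X) (fst (hd Y))" by (auto simp: closed_path_def walk_append)
  have [simp]: "y = fst (hd Z)" using y(2) ne by (cases Z) auto
  have d: "distinct (map fst (Y @ Z @ X))" using r by (simp add: closed_path_def)
  have "fst (hd Z) \<in> fst ` set Z" "fst (hd Y) \<in> fst ` set Y" using ne by auto
  moreover have "distinct (map fst Y)" "distinct (map fst (Z @ X))" "fst ` set Y \<inter> fst ` set (Z @ X) = {}"
    using d by auto
  ultimately have "fst (hd Z) \<notin> fst ` set Y" "fst (hd Y) \<notin> fst ` set (Z @ X)" "distinct (map fst Y)" "distinct (map fst (Z @ X))"
    by auto
  then show "path A (fst (hd Y)) Y (fst (hd Z))" "path A (fst (hd Z)) (Z @ X) (fst (hd Y))"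
    using y walk_path by simp_all
qed

lemma even_arcs:
  assumes o: "orients A D" and C: "closed_path A x0 C" and odd: "odd (length C)"
  shows "\<exists>h :: 'v \<Rightarrow> bool. \<forall>s\<in>fst ` set C. \<forall>t\<in>fst ` set C. s \<noteq> t \<longrightarrow>
    (\<exists>p. path A s p t \<and> even (length p) \<and> pverts p \<subseteq> fst ` set C \<and> fwd D p = (h s \<noteq> h t))"
proof -
  \<comment> \<open>\<open>H i\<close> is the forward parity of the even arc between the base vertex
    and the \<open>i\<close>-th vertex: the initial arc for even \<open>i\<close>, the final arc for
    odd \<open>i\<close>, since the circuit is odd. The sense is irrelevant on an even arc.\<close>
  define H where "H i \<longleftrightarrow> (if even i then fwd D (take i C) else fwd D (drop i C))" for i
  have main: "\<exists>p. path A (fst (C ! i)) p (fst (C ! j)) \<and> even (length p) \<and> pverts p \<subseteq> fst ` set C \<and> fwd D p = (H i \<noteq> H j)"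
    if ij: "i < j" "j < length C" for i j
  proof -
    define X where "X = take i C"
    define Y where "Y = take (j - i) (drop i C)"
    define Z where "Z = drop j C"
    have XY: "take j C = X @ Y" using ij by (simp add: X_def Y_def flip: take_add)
    then have CC: "C = X @ Y @ Z" unfolding Z_def by (metis append.assoc append_take_drop_id)
    have l: "length X = i" "length Y = j - i" "length Z = length C - j" using ij by (auto simp: X_def Y_def Z_def)
    have ne: "Y \<noteq> []" "Z \<noteq> []" using l ij by auto
    have hY: "fst (hd Y) = fst (C ! i)" using ne l CC by (metis hd_append2 hd_drop_conv_nth append_eq_conv_conj length_greater_0_conv nth_append_length_plus add.right_neutral hd_conv_nth ij order.strict_trans)
    have hZ: "fst (hd Z) = fst (C ! j)" using ij by (simp add: Z_def hd_drop_conv_nth)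
    have dX: "drop i C = Y @ Z" using CC l by simp
    note arcs = closed_path_arcs[OF C[unfolded CC] ne]
    have sub: "pverts p \<subseteq> fst ` set C" if "path A (fst a) p (fst b)" "set p \<subseteq> set C" "b \<in> set C" for p a b
      using walk_pverts[OF path_walk[OF that(1)]] that(2,3) by auto
    have inC: "hd Y \<in> set C" "hd Z \<in> set C" using CC ne by auto
    show ?thesis
    proof (cases "even (j - i)")
      case True
      then have "even i = even j" using ij by auto
      then have "fwd D Y = (H i \<noteq> H j)" unfolding H_def XY dX X_def[symmetric] Z_def[symmetric] by auto
      moreover have "pverts Y \<subseteq> fst ` set C" using sub[OF arcs(1)] inC CC by auto
      ultimately show ?thesis using arcs(1) hY hZ True l by (intro exI[of _ Y]) simp
    next
      case False
      then have "even i \<noteq> even j" using ij by auto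
      \<comment> \<open>The even arc is now the one through the base vertex. If \<open>i\<close> is
        odd, both \<open>H i\<close> and \<open>H j\<close> include the middle part
        \<open>Y\<close>, which cancels.\<close>
      then have f: "fwd D (Z @ X) = (H i \<noteq> H j)" unfolding H_def XY dX X_def[symmetric] Z_def[symmetric] by auto
      have ev: "even (length (Z @ X))" 
      proof -
        have "length C = j + length Z" using l(3) ij by simp
        then have "even (i + length Z)" using False odd ij by presburger
        then show ?thesis using l(1) by (simp add: add.commute)
      qed
      have "pverts (Z @ X) \<subseteq> fst ` set C" using sub[OF arcs(2)] inC CC by auto
      moreover have "fwd D (reverse (Z @ X)) = fwd D (Z @ X)" using fwd_reverse[OF o arcs(2)] ev by simp
      ultimately show ?thesis using path_reverse[OF arcs(2)] hY hZ ev f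
        by (intro exI[of _ "reverse (Z @ X)"]) (simp del: reverse_simps(3) fwd_simps(3) pverts_simps(3) add: reverse_simps(4))
    qed
  qed
  define idx where "idx s = (SOME i. i < length C \<and> fst (C ! i) = s)" for s
  have idx: "idx s < length C" "fst (C ! idx s) = s" if "s \<in> fst ` set C" for s
  proof -
    have "\<exists>i. i < length C \<and> fst (C ! i) = s" using that by (metis imageE in_set_conv_nth)
    then have "idx s < length C \<and> fst (C ! idx s) = s" unfolding idx_def by (rule someI_ex)
    then show "idx s < length C" "fst (C ! idx s) = s" by auto
  qed
  have "\<exists>p. path A s p t \<and> even (length p) \<and> pverts p \<subseteq> fst ` set C \<and> fwd D p = (H (idx s) \<noteq> H (idx t))"
    if st: "s \<in> fst ` set C" "t \<in> fst ` set C" "s \<noteq> t" for s t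
  proof -
    have "idx s \<noteq> idx t" using idx[OF st(1)] idx[OF st(2)] st(3) by auto
    then consider "idx s < idx t" | "idx t < idx s" by linarith
    then show ?thesis
    proof cases
      case 1
      then show ?thesis using main[OF 1 idx(1)[OF st(2)]] idx(2)[OF st(1)] idx(2)[OF st(2)] by simp
    next
      case 2
      then obtain p where p: "path A t p s" "even (length p)" "pverts p \<subseteq> fst ` set C" "fwd D p = (H (idx t) \<noteq> H (idx s))"
        using main[OF 2 idx(1)[OF st(1)]] idx(2)[OF st(1)] idx(2)[OF st(2)] by auto
      then have "fwd D (reverse p) = (H (idx s) \<noteq> H (idx t))" using fwd_reverse[OF o p(1)] by auto
      then show ?thesis using path_reverse[OF p(1)] p by (intro exI[of _ "reverse p"]) simp
    qed
  qed
  then show ?thesis by (intro exI[of _ "\<lambda>s. H (idx s)"] ballI impI)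
qed

end

lemma contract_simps:
  "verts (contract K A) = contract_map (\<Union>e\<in>A. ends K e) ` verts K" "edges (contract K A) = edges K - A"
  "ends (contract K A) e = contract_map (\<Union>e\<in>A. ends K e) ` ends K e"
  by (simp_all add: contract_def Let_def)

lemma contract_map_eq: "contract_map W a = contract_map W b \<longleftrightarrow> a = b \<or> (a \<in> W \<and> b \<in> W)"
  by (auto simp: contract_map_def)

lemma contract_map_eq_W: "W \<noteq> {} \<Longrightarrow> contract_map W a = W \<longleftrightarrow> a \<in> W"
  by (auto simp: contract_map_def)

text \<open>An even circuit of the contraction lifts either to a circuit of \<open>K\<close> or to a
  path between two vertices of \<open>A\<close>. In the second case the even arc of \<open>A\<close>
  closes it to an even circuit, and the potential accounts for the forward parity of the
  arc.\<close>

lemma good_contract: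
  assumes K: "finite_mgraph K" and A: "odd_circuit K A" and g: "ggood K D"
  shows "\<exists>D'. ggood (contract K A) D'"
proof -
  interpret incidence "ends K" .
  obtain vs es where t: "traversal K vs es" "set es = A" using A by (auto simp: odd_circuit_def circuit_def)
  obtain C x where C: "closed_path (edges K) x C" "map fst C = vs" "edge_list C = es"
    using traversal_closed_path[OF t(1)] by metis
  have "card A = length es" using t distinct_card by (auto simp: traversal_def)
  then have oddC: "odd (length C)" using A C(3) by (auto simp: odd_circuit_def)
  have pC: "pedges C = A" by (simp add: pedges_def flip: t(2) C(3))
  have AK: "A \<subseteq> edges K" using closed_path_pedges[OF C(1)] pC by simp
  have CA: "closed_path A x C" using closed_path_mono[OF C(1)] pC by simp
  define W where "W = fst ` set C"
  have WA: "(\<Union>e\<in>A. ends K e) = W"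
  proof
    have w: "walk A x C x" using CA by (simp add: closed_path_def)
    have Cne: "C \<noteq> []" using CA by (simp add: closed_path_def)
    have "x \<in> W" using w Cne unfolding W_def by (cases C) auto
    then have pv: "pverts C \<subseteq> W" using walk_pverts[OF w] by (auto simp: W_def)
    show "(\<Union>e\<in>A. ends K e) \<subseteq> W"
    proof
      fix z assume "z \<in> (\<Union>e\<in>A. ends K e)"
      then obtain e a b where m: "(a, e, b) \<in> set C" "z \<in> ends K e" using pC by (auto simp: pedges_def)
      then show "z \<in> W" using dart_ends[OF w m(1)] dart_pverts[OF m(1)] pv by auto
    qed
    show "W \<subseteq> (\<Union>e\<in>A. ends K e)"
    proof
      fix z assume "z \<in> W"
      then obtain e b where m: "(z, e, b) \<in> set C" by (auto simp: W_def)
      then have "z \<in> ends K e" "e \<in> pedges C" using dart_ends[OF w m] by (force simp: pedges_def)+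
      then show "z \<in> (\<Union>e\<in>A. ends K e)" using pC by auto
    qed
  qed
  have Wne: "W \<noteq> {}" using CA by (auto simp: closed_path_def W_def)
  let ?c = "contract_map W"
  let ?en = "\<lambda>e. ?c ` ends K e"
  have ec: "edges (contract K A) = edges K - A" "ends (contract K A) = ?en"
    using contract_simps[of K A] WA by auto
  have o: "orients (edges K) D" using g by (simp add: good_def)
  then have oA: "orients A D" using AK by (auto simp: orients_def)
  obtain h :: "'a \<Rightarrow> bool" where h: "\<And>s t. s \<in> W \<Longrightarrow> t \<in> W \<Longrightarrow> s \<noteq> t \<Longrightarrow>
    \<exists>p. path A s p t \<and> even (length p) \<and> pverts p \<subseteq> W \<and> fwd D p = (h s \<noteq> h t)"
    using even_arcs[OF oA CA oddC] unfolding W_def[symmetric] by blast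
  \<comment> \<open>The potential, extended by \<open>False\<close> off the circuit; an edge is
    reversed exactly when \<open>k\<close> differs at its ends.\<close>
  define k where "k z \<longleftrightarrow> z \<in> W \<and> h z" for z
  define D' where "D' e = (if k (fst (D e)) = k (snd (D e)) then (?c (fst (D e)), ?c (snd (D e))) else (?c (snd (D e)), ?c (fst (D e))))" for e
  \<comment> \<open>The corrections by \<open>k\<close> telescope to the two ends of the lifted
    walk. Consecutive lifted edges fit together because \<open>W\<close> is the only vertex of the
    contraction with several preimages, and it is excluded from the inside of the walk.\<close>
  have lift: "\<exists>L s t. walk (edges K - A) s L t \<and> ?c s = X \<and> ?c t = Y \<and> edge_list L = edge_list p \<and>
      map (?c \<circ> fst) L = map fst p \<and> fwd D L = (fwd D' p \<noteq> (k s \<noteq> k t))"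
    if "incidence.walk ?en (edges K - A) X p Y" "p \<noteq> []" "\<And>a e b. (a, e, b) \<in> set p \<Longrightarrow> a \<noteq> b"
      "\<And>d. d \<in> set (butlast p) \<Longrightarrow> snd (snd d) \<noteq> W" for X p Y
    using that
  proof (induction p arbitrary: X)
    case (Cons d p)
    obtain e B where d: "d = (X, e, B)" using Cons.prems(1) by (cases d) (simp add: incidence.walk.simps)
    have e: "e \<in> edges K - A" "?en e = {X, B}" "X \<noteq> B" using Cons.prems(1,3) d by (auto simp: incidence.walk.simps)
    obtain a' b' where ab': "ends K e = {a', b'}" using K e(1) unfolding finite_mgraph_def by blast
    then have "{?c a', ?c b'} = {X, B}" using e(2) by simp
    then obtain a b where ab: "ends K e = {a, b}" "?c a = X" "?c b = B"
      using ab' by (auto simp: doubleton_eq_iff insert_commute)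
    have "{fst (D e), snd (D e)} = {a, b}" using o e(1) ab(1) by (auto simp: orients_def)
    then have "D e = (a, b) \<or> D e = (b, a)" by (cases "D e") (auto simp: doubleton_eq_iff)
    moreover have "a \<noteq> b" using ab e(3) by auto
    ultimately have De: "(D e = (a, b)) = ((D' e = (X, B)) \<noteq> (k a \<noteq> k b))"
      using ab e(3) by (auto simp: D'_def)
    show ?case
    proof (cases "p = []")
      case True
      then have "B = Y" using Cons.prems(1) d by (simp add: incidence.walk.simps)
      then show ?thesis using True d e ab De by - (rule exI[of _ "[(a, e, b)]"], rule exI[of _ a], rule exI[of _ b], auto)
    next
      case False
      have "incidence.walk ?en (edges K - A) B p Y" using Cons.prems(1) d by (simp add: incidence.walk.simps)
      moreover have "\<And>a e b. (a, e, b) \<in> set p \<Longrightarrow> a \<noteq> b" 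
        using Cons.prems(3) list.set_intros(2) by fast
      moreover have "\<And>d. d \<in> set (butlast p) \<Longrightarrow> snd (snd d) \<noteq> W" using Cons.prems(4) False by simp
      ultimately obtain L s t where L: "walk (edges K - A) s L t" "?c s = B" "?c t = Y"
         "edge_list L = edge_list p" "map (?c \<circ> fst) L = map fst p" "fwd D L = (fwd D' p \<noteq> (k s \<noteq> k t))"
        using Cons.IH[of B] False by blast
      have "B \<noteq> W" using Cons.prems(4)[of d] False d by simp
      then have "b = s" using ab(3) L(2) contract_map_eq_W[OF Wne] contract_map_eq by metis
      then have "walk (edges K - A) a ((a, e, b) # L) t" using L(1) e(1) ab(1) by simp
      moreover have "fwd D ((a, e, b) # L) = (fwd D' (d # p) \<noteq> (k a \<noteq> k t))"
        using De L(6) \<open>b = s\<close> d by (simp only: fwd_simps) satx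
      ultimately show ?thesis using L(3-5) ab(2) d
        by - (rule exI[of _ "(a, e, b) # L"], rule exI[of _ a], rule exI[of _ t], simp add: comp_def)
    qed
  qed simp
  have "ggood (contract K A) D'" unfolding incidence.good_def ec
  proof (intro conjI allI impI)
    show "incidence.orients ?en (edges K - A) D'"
      unfolding incidence.orients_def
    proof
      fix e assume "e \<in> edges K - A"
      then have "ends K e = {fst (D e), snd (D e)}" using o by (auto simp: orients_def)
      then show "{fst (D' e), snd (D' e)} = ?en e" by (auto simp: D'_def)
    qed
    fix X0 C0 assume C0: "incidence.closed_path ?en (edges K - A) X0 C0" "even (length C0)"
    \<comment> \<open>If the circuit passes through the contracted vertex, it is rotated to start
      there.\<close>
    obtain X p where p: "incidence.closed_path ?en (edges K - A) X p" "even (length p)" "fwd D' p = fwd D' C0"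
      "X = W \<or> W \<notin> fst ` set p"
    proof (cases "W \<in> fst ` set C0")
      case True
      then obtain d where d: "d \<in> set C0" "fst d = W" by auto
      then obtain P Q where PQ: "C0 = P @ d # Q" using split_list by metis
      have "incidence.closed_path ?en (edges K - A) W (d # Q @ P)"
        using incidence.closed_path_rotate[of ?en "edges K - A" X0 P "d # Q"] C0(1) PQ d by simp
      moreover have "fwd D' (d # Q @ P) = fwd D' C0" unfolding PQ by (cases d) auto
      ultimately show thesis using that C0(2) PQ by auto
    qed (use C0 that in blast)
    have pw: "incidence.walk ?en (edges K - A) X p X" and ne: "p \<noteq> []" and ds: "distinct (map fst p)" "distinct (edge_list p)"
      using p(1) by (auto simp: incidence.closed_path_def)
    have hdX: "fst (hd p) = X" using pw ne by (cases p) (auto simp: incidence.walk.simps)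
    have bl: "snd (snd d) \<noteq> W" if dd: "d \<in> set (butlast p)" for d
    proof -
      obtain i where i: "i < length (butlast p)" "butlast p ! i = d" using dd by (auto simp: in_set_conv_nth)
      then have i': "Suc i < length p" "p ! i = d" by (auto simp: nth_butlast)
      then have *: "snd (snd d) = fst (p ! Suc i)" using incidence.walk_next[OF pw, of i] by simp
      show ?thesis
      proof
        assume "snd (snd d) = W"
        then have w: "fst (p ! Suc i) = W" using * by simp
        then have "W \<in> fst ` set p" using i'(1) nth_mem by force
        then have "X = W" using p(4) by blast
        then have "map fst p ! Suc i = map fst p ! 0" using w hdX i'(1) ne by (simp add: hd_conv_nth)
        then show False using ds(1) i'(1) ne by (metis length_greater_0_conv length_map nat.distinct(1) nth_eq_iff_index_eq)
      qed
    qed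
    obtain L s t where L: "walk (edges K - A) s L t" "?c s = X" "?c t = X" "edge_list L = edge_list p"
      "map (?c \<circ> fst) L = map fst p" "fwd D L = (fwd D' p \<noteq> (k s \<noteq> k t))"
      using lift[OF pw ne _ bl] incidence.closed_path_ends[OF p(1,2)] by blast
    have lenL: "length L = length p" using L(4) by (metis length_map)
    have dL: "distinct (map fst L)" using L(5) ds(1) by (metis distinct_map map_map)
    have Lne: "L \<noteq> []" using lenL ne by auto
    have wL: "walk (edges K) s L t" 
    using L(1) walk_cong[of L "ends K" "ends K" "edges K - A" "edges K" s t] walk_pedges[OF L(1)] by blast
    have "fwd D' p"
    proof (cases "s = t")
      case True
      have "closed_path (edges K) s L" using wL dL True Lne L(4) ds(2) by (simp add: closed_path_def)
      then have "fwd D L" using g p(2) lenL by (auto simp: good_def)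
      then show ?thesis using L(6) True by simp
    next
      case False
      then have st: "s \<in> W" "t \<in> W" using L(2,3) contract_map_eq by metis+
      have XW: "X = W" using st(1) L(2) contract_map_eq_W[OF Wne] by metis
      have src: "z = s" if z: "z \<in> fst ` set L" "z \<in> W" for z
      proof -
        obtain i where i: "i < length L" "fst (L ! i) = z" using z(1) by (metis imageE in_set_conv_nth)
        have "map fst p ! i = ?c z" using i L(5) by (metis comp_apply nth_map)
        then have "map fst p ! i = W" using z(2) contract_map_eq_W[OF Wne] by simp
        moreover have "map fst p ! 0 = W" using hdX XW ne by (simp add: hd_conv_nth)
        ultimately have "i = 0" using ds(1) i(1) lenL ne by (metis length_greater_0_conv length_map nth_eq_iff_index_eq)
        moreover have "fst (L ! 0) = s" using wL Lne by (cases L) auto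
        ultimately show ?thesis using i(2) by simp
      qed
      then have "t \<notin> fst ` set L" using st(2) False by blast
      then have pL: "path (edges K) s L t" using walk_path[OF wL dL] by simp
      \<comment> \<open>Inside the lift no vertex of \<open>W\<close> occurs, so \<open>L\<close>
        and the even arc \<open>q\<close> are parallel even paths and differ in forward
        parity.\<close>
      obtain q where q: "path A s q t" "even (length q)" "pverts q \<subseteq> W" "fwd D q = (h s \<noteq> h t)" using h[OF st False] by blast
      have "meet_in L q {s, t}" using walk_pverts[OF wL] src q(3) by auto
      then have "fwd D L \<noteq> fwd D q" using good_cycle[OF g pL path_mono[OF q(1) AK] _ _ False] q(2) p(2) lenL by simp
      then show ?thesis using L(6) q(4) st by (auto simp: k_def)
    qed
    then show "fwd D' C0" using p(3) by simp
  qed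
  then show ?thesis by blast
qed

section \<open>Even subdivisions of \<open>K\<^sub>2\<^sub>,\<^sub>3\<close> have no good
  orientation\<close>

lemma wf_isomorphic: "wf_mgraph F \<Longrightarrow> isomorphic F H \<Longrightarrow> wf_mgraph H"
  unfolding wf_mgraph_def isomorphic_def
proof (elim exE conjE, intro ballI)
  fix f g e assume wf: "\<forall>e\<in>edges F. ends F e \<subseteq> verts F \<and> (\<exists>a b. ends F e = {a, b})"
    and f: "bij_betw f (verts F) (verts H)" and g: "bij_betw g (edges F) (edges H)"
    and e: "\<forall>e\<in>edges F. ends H (g e) = f ` ends F e" "e \<in> edges H"
  obtain e' where e': "e' \<in> edges F" "e = g e'" using g e(2) by (auto simp: bij_betw_def)
  have "ends F e' \<subseteq> verts F" "\<exists>a b. ends F e' = {a, b}" using wf e'(1) by simp_all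
  then obtain a b where "ends F e' = {a, b}" "a \<in> verts F" "b \<in> verts F" by auto
  then show "ends H e \<subseteq> verts H \<and> (\<exists>a b. ends H e = {a, b})" using e e' bij_betwE[OF f] by auto
qed

lemma wf_double_subdivide: "double_subdivide F F' \<Longrightarrow> wf_mgraph F \<Longrightarrow> wf_mgraph F'"
  by (induction rule: double_subdivide.induct) (auto simp: wf_mgraph_def)

lemma even_subdivision_K23_not_good:
  assumes "even_subdivision (complete_bipartite 2 3) H"
  shows "\<not> ggood H D"
proof
  assume g: "ggood H D"
  obtain F0 F1 :: "(nat, nat) mgraph" where F: "isomorphic (complete_bipartite 2 3) F0" "double_subdivide\<^sup>*\<^sup>* F0 F1" "isomorphic F1 H"
    using assms unfolding even_subdivision_def by blast
  have wfK: "wf_mgraph (complete_bipartite 2 3)" by (auto simp: wf_mgraph_def complete_bipartite_def)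
  then have wf0: "wf_mgraph F0" using F(1) wf_isomorphic by blast
  have "wf_mgraph F1 \<and> ((\<exists>D. ggood F1 D) \<longrightarrow> (\<exists>D. ggood F0 D))" using F(2)
  proof (induction rule: rtranclp_induct)
    case base
    then show ?case using wf0 by simp
  next
    case (step F F')
    then show ?case using wf_double_subdivide good_double_subdivide by metis
  qed
  then have "\<exists>D. ggood F0 D" using good_isomorphic[OF _ F(3) g] by blast
  then show False using good_isomorphic[OF wfK F(1)] not_good_K23 by blast
qed

section \<open>Spanning thetas\<close>

context incidence
begin

lemma walk_ends: "walk E x p y \<Longrightarrow> (\<Union>e\<in>pedges p. en e) = pverts p"
proof (induction p arbitrary: x)
  case (Cons d p)
  obtain a e b where d: "d = (a, e, b)" by (cases d)
  have "(\<Union>e\<in>pedges p. en e) = pverts p" by (rule Cons.IH[of b]) (use Cons.prems d in simp)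
  then show ?case using Cons.prems d by simp
qed simp

text \<open>A common edge would join \<open>x\<close> and \<open>y\<close> and hence be all of
  \<open>p\<close>, which has even length.\<close>

lemma even_paths_edge_disjoint:
  assumes "path E x p y" "path E x q y" "even (length p)" "meet_in p q {x, y}"
  shows "pedges p \<inter> pedges q = {}"
proof (rule ccontr)
  assume "pedges p \<inter> pedges q \<noteq> {}"
  then obtain e a b a' b' where m: "(a, e, b) \<in> set p" "(a', e, b') \<in> set q" by (auto simp: pedges_def)
  have "{a, b} = {a', b'}" using dart_ends[OF path_walk[OF assms(1)] m(1)] dart_ends[OF path_walk[OF assms(2)] m(2)] by simp
  then have "a \<in> {a', b'}" "b \<in> {a', b'}" by blast+
  then have "{a, b} \<subseteq> pverts p \<inter> pverts q" using dart_pverts[OF m(1)] dart_pverts[OF m(2)] by auto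
  then have "p = [(x, e, y)]" using assms(4) by (intro path_edge_between[OF assms(1) m(1)]) blast
  then show False using assms(3) by simp
qed

lemma even_theta_edge_disjoint:
  assumes "even_theta E x y p q r"
  shows "pedges p \<inter> pedges q = {}" "pedges p \<inter> pedges r = {}" "pedges q \<inter> pedges r = {}"
  using assms even_paths_edge_disjoint unfolding even_theta_def by metis+

lemma even_theta_rotate: "even_theta E x y p q r \<Longrightarrow> even_theta E x y q r p"
  unfolding even_theta_def by (simp add: Int_commute)

lemma even_theta_map:
  assumes t: "even_theta E x y p q r" and inj: "inj_on f (pverts p \<union> pverts q \<union> pverts r)"
    and e: "\<And>e. e \<in> pedges p \<union> pedges q \<union> pedges r \<Longrightarrow> g e \<in> E' \<and> en' (g e) = f ` en e"
  shows "incidence.even_theta en' E' (f x) (f y) (map_darts f g p) (map_darts f g q) (map_darts f g r)"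
proof -
  have P: "path E x p y" "path E x q y" "path E x r y" "x \<noteq> y"
    and D: "meet_in p q {x, y}" "meet_in p r {x, y}" "meet_in q r {x, y}"
    and L: "even (length p)" "even (length q)" "even (length r)"
    using t by (auto simp: even_theta_def)
  have "x \<in> pverts p" "y \<in> pverts p" using path_ends[OF P(1)] path_Nil_iff[OF P(1)] P(4) by auto
  then have "f x \<noteq> f y" using inj P(4) by (auto simp: inj_on_def)
  moreover have "f ` pverts s \<inter> f ` pverts s' \<subseteq> {f x, f y}"
    if "meet_in s s' {x, y}" "s \<in> {p, q, r}" "s' \<in> {p, q, r}" for s s'
  proof -
    have "pverts s \<subseteq> pverts p \<union> pverts q \<union> pverts r" "pverts s' \<subseteq> pverts p \<union> pverts q \<union> pverts r" using that by auto
    then have "f ` pverts s \<inter> f ` pverts s' = f ` (pverts s \<inter> pverts s')" using inj_on_image_Int[OF inj] by simp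
    then show ?thesis using that(1) by auto
  qed
  moreover have "incidence.path en' E' (f x) (map_darts f g s) (f y)" if "s \<in> {p, q, r}" for s
    using that P e inj by (intro path_map) (auto intro: inj_on_subset)
  ultimately show ?thesis unfolding incidence.even_theta_def using L D by simp
qed

lemma path_targets: "path E x p y \<Longrightarrow> p \<noteq> [] \<Longrightarrow> map (snd \<circ> snd) p = map fst (tl p) @ [y]"
proof (induction p arbitrary: x)
  case (Cons d p)
  obtain a e b where d: "d = (a, e, b)" by (cases d)
  show ?case
  proof (cases "p = []")
    case False
    have p: "path E b p y" using Cons.prems d by simp
    have "map (snd \<circ> snd) p = map fst (tl p) @ [y]" by (rule Cons.IH[OF p False])
    moreover have "fst (hd p) = b" using p False by (cases p) auto
    ultimately show ?thesis using d False by (cases p) (auto simp: comp_def)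
  qed (use Cons.prems d in simp)
qed simp

lemma path_inner:
  assumes "path E x p y" "p \<noteq> []"
  shows "map fst p = x # map fst (tl p)" "pverts p = {x, y} \<union> fst ` set (tl p)"
    "distinct (map fst (tl p))" "x \<notin> fst ` set (tl p)" "y \<notin> fst ` set (tl p)"
proof -
  obtain a e b p' where p: "p = (a, e, b) # p'" using assms(2) by (cases p) auto
  then have pp: "a = x" "path E b p' y" "x \<noteq> b" "x \<notin> pverts p'" using assms(1) by auto
  show "map fst p = x # map fst (tl p)" using p pp by simp
  have "pverts p' \<union> {b} = {y} \<union> fst ` set p'"
  proof
    have "b \<in> {y} \<union> fst ` set p'" using pp(2) by (cases p') auto
    then show "pverts p' \<union> {b} \<subseteq> {y} \<union> fst ` set p'" using walk_pverts[OF path_walk[OF pp(2)]] by auto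
    have "y \<in> pverts p' \<union> {b}" using path_ends[OF pp(2)] path_Nil_iff[OF pp(2)] by auto
    then show "{y} \<union> fst ` set p' \<subseteq> pverts p' \<union> {b}" by (auto simp: pverts_def)
  qed
  then show "pverts p = {x, y} \<union> fst ` set (tl p)" using p pp by auto
  show "distinct (map fst (tl p))" "x \<notin> fst ` set (tl p)" "y \<notin> fst ` set (tl p)"
    using path_distinct[OF assms(1)] p pp by auto
qed

end

text \<open>Even subdivisions of \<open>K\<^sub>2\<^sub>,\<^sub>3\<close> are recognised in this
  form: such a graph is determined up to isomorphism by the three lengths, so no isomorphism has to
  be followed through the subdivision steps.\<close>

definition spanning_theta :: "('v, 'e) mgraph \<Rightarrow> 'v \<Rightarrow> 'v \<Rightarrow> ('v, 'e) dart list \<Rightarrow> ('v, 'e) dart list \<Rightarrow> ('v, 'e) dart list \<Rightarrow> bool" where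
  "spanning_theta H x y p q r \<longleftrightarrow> incidence.even_theta (ends H) (edges H) x y p q r \<and>
     verts H = pverts p \<union> pverts q \<union> pverts r \<and> edges H = pedges p \<union> pedges q \<union> pedges r"

lemma spanning_theta_rotate: "spanning_theta H x y p q r \<Longrightarrow> spanning_theta H x y q r p"
  unfolding spanning_theta_def using incidence.even_theta_rotate by fastforce

lemma spanning_theta_isomorphic:
  assumes "spanning_theta G x y p q r" "isomorphic G H"
  shows "\<exists>x' y' p' q' r'. spanning_theta H x' y' p' q' r' \<and> length p' = length p \<and> length q' = length q \<and> length r' = length r"
proof -
  obtain f g where f: "bij_betw f (verts G) (verts H)" and g: "bij_betw g (edges G) (edges H)"
    and e: "\<And>e. e \<in> edges G \<Longrightarrow> ends H (g e) = f ` ends G e" using assms(2) unfolding isomorphic_def by blast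
  have s: "incidence.even_theta (ends G) (edges G) x y p q r" "verts G = pverts p \<union> pverts q \<union> pverts r" "edges G = pedges p \<union> pedges q \<union> pedges r"
    using assms(1) by (auto simp: spanning_theta_def)
  have "incidence.even_theta (ends H) (edges H) (f x) (f y) (map_darts f g p) (map_darts f g q) (map_darts f g r)"
    by (rule incidence.even_theta_map[OF s(1)]) (use f s e bij_betwE[OF g] in \<open>auto simp: bij_betw_def\<close>)
  moreover have "verts H = f ` verts G" "edges H = g ` edges G" using f g by (auto simp: bij_betw_def)
  ultimately have "spanning_theta H (f x) (f y) (map_darts f g p) (map_darts f g q) (map_darts f g r)"
    unfolding spanning_theta_def using s by (simp add: image_Un)
  then show ?thesis by (metis map_darts_simps(4))
qed

text \<open>The first edge of \<open>p\<close> is subdivided; the other two paths are reached by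
  rotating the theta. Natural numbers supply the fresh vertices and edges.\<close>

lemma spanning_theta_extend:
  fixes F :: "(nat, nat) mgraph"
  assumes "spanning_theta F x y p q r"
  shows "\<exists>F' p'. double_subdivide F F' \<and> spanning_theta F' x y p' q r \<and> length p' = length p + 2"
proof -
  interpret incidence "ends F" .
  have t: "even_theta (edges F) x y p q r" and V: "verts F = pverts p \<union> pverts q \<union> pverts r"
    and E: "edges F = pedges p \<union> pedges q \<union> pedges r" using assms by (auto simp: spanning_theta_def)
  have P: "path (edges F) x p y" "path (edges F) x q y" "path (edges F) x r y" "x \<noteq> y"
    and D: "meet_in p q {x, y}" "meet_in p r {x, y}" "meet_in q r {x, y}"
    and L: "even (length p)" "even (length q)" "even (length r)"
    using t by (auto simp: even_theta_def)
  note ED = even_theta_edge_disjoint[OF t]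
  have fin: "finite (verts F)" "finite (edges F)" unfolding V E by (auto simp: pverts_def pedges_def)
  have "p \<noteq> []" using path_Nil_iff[OF P(1)] P(4) by simp
  then obtain e b p0 where p: "p = (x, e, b) # p0" using P(1) by (cases p) auto
  have pp: "e \<in> edges F" "ends F e = {x, b}" "x \<noteq> b" "x \<notin> pverts p0" "path (edges F) b p0 y" using P(1) p by auto
  have e0: "e \<notin> pedges p0" using path_distinct[OF P(1)] p by (auto simp: pedges_def)
  obtain w1 where w1: "w1 \<notin> verts F" using ex_new_if_finite[OF infinite_UNIV_nat fin(1)] by blast
  obtain w2 where w2: "w2 \<notin> insert w1 (verts F)" using ex_new_if_finite[OF infinite_UNIV_nat, of "insert w1 (verts F)"] fin(1) by auto
  obtain a1 where a1: "a1 \<notin> edges F" using ex_new_if_finite[OF infinite_UNIV_nat fin(2)] by blast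
  obtain a2 where a2: "a2 \<notin> insert a1 (edges F)" using ex_new_if_finite[OF infinite_UNIV_nat, of "insert a1 (edges F)"] fin(2) by auto
  obtain a3 where a3: "a3 \<notin> insert a1 (insert a2 (edges F))"
    using ex_new_if_finite[OF infinite_UNIV_nat, of "insert a1 (insert a2 (edges F))"] fin(2) by auto
  define F' where "F' = \<lparr>verts = verts F \<union> {w1, w2}, edges = edges F - {e} \<union> {a1, a2, a3},
         ends = (ends F)(a1 := {x, w1}, a2 := {w1, w2}, a3 := {w2, b})\<rparr>"
  have ds: "double_subdivide F F'"
    unfolding F'_def using w1 w2 a1 a2 a3 by (intro double_subdivide.intros[OF pp(1,2)]) auto
  have eF': "edges F' = edges F - {e} \<union> {a1, a2, a3}" "verts F' = verts F \<union> {w1, w2}"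
    "ends F' = (ends F)(a1 := {x, w1}, a2 := {w1, w2}, a3 := {w2, b})" by (simp_all add: F'_def)
  have old: "incidence.path (ends F') (edges F') z s z'" if s: "path (edges F) z s z'" "e \<notin> pedges s" for z s z'
  proof -
    have "ends F f = ends F' f \<and> (f \<in> edges F \<longleftrightarrow> f \<in> edges F')" if "f \<in> pedges s" for f
      using that path_pedges[OF s(1)] s(2) a1 a2 a3 by (auto simp: eF')
    from path_cong[of s, OF this] show ?thesis using s(1) by blast
  qed
  define p' where "p' = (x, a1, w1) # (w1, a2, w2) # (w2, a3, b) # p0"
  have pv: "pverts p0 \<subseteq> verts F" "x \<in> verts F" "b \<in> verts F" "pverts q \<subseteq> verts F" "pverts r \<subseteq> verts F" using V p by auto
  have "incidence.path (ends F') (edges F') x p' y"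
    unfolding p'_def using w1 w2 a1 a2 a3 pp pv old[OF pp(5) e0] by (auto simp: eF' incidence.path.simps)
  moreover have "incidence.path (ends F') (edges F') x q y" "incidence.path (ends F') (edges F') x r y"
    using old P(2,3) ED p by auto
  moreover have pvp': "pverts p' = pverts p \<union> {w1, w2}" by (auto simp: p'_def p)
  moreover have "meet_in p' q {x, y}" "meet_in p' r {x, y}" unfolding pvp' using D w1 w2 pv by auto
  moreover have "even (length p')" using L(1) by (simp add: p'_def p)
  ultimately have "incidence.even_theta (ends F') (edges F') x y p' q r"
    unfolding incidence.even_theta_def using L D P(4) by blast
  moreover have "edges F' = pedges p' \<union> pedges q \<union> pedges r"
    using E ED e0 unfolding eF' p'_def p by auto
  moreover have "verts F' = pverts p' \<union> pverts q \<union> pverts r" unfolding eF' pvp' V by auto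
  ultimately have "spanning_theta F' x y p' q r" by (simp add: spanning_theta_def)
  then show ?thesis using ds by (intro exI[of _ F'] exI[of _ p']) (simp add: p'_def p)
qed

lemma K23_spanning_theta:
  "spanning_theta (complete_bipartite 2 3) (Inl 0) (Inl 1)
    [(Inl 0, (0, 0), Inr 0), (Inr 0, (1, 0), Inl 1)] [(Inl 0, (0, 1), Inr 1), (Inr 1, (1, 1), Inl 1)]
    [(Inl 0, (0, 2), Inr 2), (Inr 2, (1, 2), Inl 1)]"
proof -
  have 2: "{..<2::nat} = {0, 1}" and 3: "{..<3::nat} = {0, 1, 2}" by auto
  show ?thesis
    unfolding spanning_theta_def incidence.even_theta_def
    by (auto simp: complete_bipartite_def incidence.path.simps 2 3)
qed

lemma nat_copy_K23:
  "\<exists>F0 :: (nat, nat) mgraph. isomorphic (complete_bipartite 2 3) F0"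
proof -
  \<comment> \<open>The two vertices of the left class become 0 and 1, the others 2, 3, 4; the six
    edges are numbered row by row.\<close>
  define f :: "nat + nat \<Rightarrow> nat" where "f z = (case z of Inl i \<Rightarrow> i | Inr j \<Rightarrow> 2 + j)" for z
  define g :: "nat \<times> nat \<Rightarrow> nat" where "g z = 3 * fst z + snd z" for z
  let ?K = "complete_bipartite 2 3"
  let ?F = "\<lparr>verts = f ` verts ?K, edges = g ` edges ?K, ends = (\<lambda>n. f ` ends ?K (inv_into (edges ?K) g n))\<rparr>"
  have "inj_on f (verts ?K)" by (auto simp: inj_on_def f_def complete_bipartite_def split: sum.splits)
  moreover have g: "inj_on g (edges ?K)" by (auto simp: inj_on_def g_def complete_bipartite_def) presburger+
  ultimately have "isomorphic ?K ?F" unfolding isomorphic_def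
    by (intro exI[of _ f] exI[of _ g]) (auto simp: bij_betw_def inv_into_f_f[OF g])
  then show ?thesis by blast
qed

text \<open>Each step lengthens one path by 2, so any larger even lengths are attained independently
  of each other.\<close>

lemma spanning_theta_reachable:
  fixes F :: "(nat, nat) mgraph"
  shows "spanning_theta F x y p q r \<Longrightarrow> length p \<le> l \<Longrightarrow> length q \<le> m \<Longrightarrow> length r \<le> n \<Longrightarrow> even l \<Longrightarrow> even m \<Longrightarrow> even n \<Longrightarrow>
    \<exists>F' p' q' r'. double_subdivide\<^sup>*\<^sup>* F F' \<and> spanning_theta F' x y p' q' r' \<and> length p' = l \<and> length q' = m \<and> length r' = n"
proof (induction "l + m + n - (length p + length q + length r)" arbitrary: F p q r rule: less_induct)
  case less
  have ev: "even (length p)" "even (length q)" "even (length r)" using less(2) by (auto simp: spanning_theta_def incidence.even_theta_def)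
  have two: "i + 2 \<le> j" if "i < j" "even i" "even j" for i j :: nat using that by presburger
  consider "length p = l" "length q = m" "length r = n" | "length p < l" | "length q < m" | "length r < n" using less(3-5) by linarith
  then show ?case
  proof cases
    case 1
    then show ?thesis using less(2) by blast
  next
    case 2
    obtain F1 p1 where F1: "double_subdivide F F1" "spanning_theta F1 x y p1 q r" "length p1 = length p + 2"
      using spanning_theta_extend[OF less(2)] by blast
    have "length p1 \<le> l" using two[OF 2 ev(1) less(6)] F1(3) by simp
    moreover have "l + m + n - (length p1 + length q + length r) < l + m + n - (length p + length q + length r)"
      using F1(3) 2 less(3-5) by linarith
    ultimately show ?thesis using less(1)[OF _ F1(2) _ less(4-8)] F1(1)
      by (meson converse_rtranclp_into_rtranclp)
  next
    case 3
    obtain F1 q1 where F1: "double_subdivide F F1" "spanning_theta F1 x y q1 r p" "length q1 = length q + 2"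
      using spanning_theta_extend[OF spanning_theta_rotate[OF less(2)]] by blast
    have s: "spanning_theta F1 x y p q1 r" by (rule spanning_theta_rotate[OF spanning_theta_rotate[OF F1(2)]])
    have "length q1 \<le> m" using two[OF 3 ev(2) less(7)] F1(3) by simp
    moreover have "l + m + n - (length p + length q1 + length r) < l + m + n - (length p + length q + length r)"
      using F1(3) 3 less(3-5) by linarith
    ultimately show ?thesis using less(1)[OF _ s less(3) _ less(5-8)] F1(1)
      by (meson converse_rtranclp_into_rtranclp)
  next
    case 4
    obtain F1 r1 where F1: "double_subdivide F F1" "spanning_theta F1 x y r1 p q" "length r1 = length r + 2"
      using spanning_theta_extend[OF spanning_theta_rotate[OF spanning_theta_rotate[OF less(2)]]] by blast
    have s: "spanning_theta F1 x y p q r1" by (rule spanning_theta_rotate[OF F1(2)])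
    have "length r1 \<le> n" using two[OF 4 ev(3) less(8)] F1(3) by simp
    moreover have "l + m + n - (length p + length q + length r1) < l + m + n - (length p + length q + length r)"
      using F1(3) 4 less(3-5) by linarith
    ultimately show ?thesis using less(1)[OF _ s less(3,4) _ less(6-8)] F1(1)
      by (meson converse_rtranclp_into_rtranclp)
  qed
qed

lemma distinct_lists_bij:
  assumes "distinct L" "distinct L'" "length L = length L'"
  obtains f where "bij_betw f (set L) (set L')" "map f L = L'"
proof -
  define f where "f = the \<circ> map_of (zip L L')"
  have "f (L ! i) = L' ! i" if "i < length L" for i
    using that assms by (simp add: f_def map_of_zip_nth)
  then have m: "map f L = L'" using assms(3) by (auto intro: nth_equalityI)
  moreover have "inj_on f (set L)" using m assms(2) distinct_map by blast
  moreover have "f ` set L = set L'" using m by (metis set_map)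
  ultimately show thesis using that by (auto simp: bij_betw_def)
qed

lemma spanning_theta_lists:
  assumes "spanning_theta H x y p q r"
  shows "distinct (x # y # map fst (tl p) @ map fst (tl q) @ map fst (tl r))"
    "set (x # y # map fst (tl p) @ map fst (tl q) @ map fst (tl r)) = verts H"
    "distinct (edge_list p @ edge_list q @ edge_list r)"
    "set (edge_list p @ edge_list q @ edge_list r) = edges H"
    "s \<in> {p, q, r} \<Longrightarrow> gpath H x s y \<and> s \<noteq> []"
proof -
  interpret incidence "ends H" .
  have t: "even_theta (edges H) x y p q r" and V: "verts H = pverts p \<union> pverts q \<union> pverts r"
    and E: "edges H = pedges p \<union> pedges q \<union> pedges r" using assms by (auto simp: spanning_theta_def)
  have P: "path (edges H) x p y" "path (edges H) x q y" "path (edges H) x r y" "x \<noteq> y"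
    and D: "meet_in p q {x, y}" "meet_in p r {x, y}" "meet_in q r {x, y}"
    using t by (auto simp: even_theta_def)
  have ne: "p \<noteq> []" "q \<noteq> []" "r \<noteq> []" using path_Nil_iff[OF P(1)] path_Nil_iff[OF P(2)] path_Nil_iff[OF P(3)] P(4) by auto
  note p = path_inner[OF P(1) ne(1)] and q = path_inner[OF P(2) ne(2)] and r = path_inner[OF P(3) ne(3)]
  have dis: "fst ` set (tl p) \<inter> fst ` set (tl q) = {}" "fst ` set (tl p) \<inter> fst ` set (tl r) = {}" "fst ` set (tl q) \<inter> fst ` set (tl r) = {}"
  proof -
    have dj: "I \<inter> J = {}" if "A \<inter> B \<subseteq> {x, y}" "A = {x, y} \<union> I" "B = {x, y} \<union> J" "x \<notin> I" "y \<notin> I" for A B I J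
      using that by blast
    show "fst ` set (tl p) \<inter> fst ` set (tl q) = {}" by (rule dj[OF D(1) p(2) q(2) p(4,5)])
    show "fst ` set (tl p) \<inter> fst ` set (tl r) = {}" by (rule dj[OF D(2) p(2) r(2) p(4,5)])
    show "fst ` set (tl q) \<inter> fst ` set (tl r) = {}" by (rule dj[OF D(3) q(2) r(2) q(4,5)])
  qed
  show "distinct (x # y # map fst (tl p) @ map fst (tl q) @ map fst (tl r))"
    using P(4) dis p(3-5) q(3-5) r(3-5) by (simp add: Int_Un_distrib)
  show "set (x # y # map fst (tl p) @ map fst (tl q) @ map fst (tl r)) = verts H"
    unfolding V p(2) q(2) r(2) by auto
  show "distinct (edge_list p @ edge_list q @ edge_list r)"
    using even_theta_edge_disjoint[OF t] path_distinct[OF P(1)] path_distinct[OF P(2)] path_distinct[OF P(3)]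
    by (simp add: pedges_def Int_Un_distrib)
  show "set (edge_list p @ edge_list q @ edge_list r) = edges H"
    unfolding E pedges_def by auto
  show "gpath H x s y \<and> s \<noteq> []" if "s \<in> {p, q, r}" using that P ne by auto
qed

text \<open>The vertex lists and the edge lists of the two thetas are matched position by position.
  This respects incidence, as each edge joins neighbouring positions of its path.\<close>

lemma spanning_theta_unique:
  assumes s: "spanning_theta G x y p q r" and s': "spanning_theta H x' y' p' q' r'"
    and l: "length p = length p'" "length q = length q'" "length r = length r'"
  shows "isomorphic G H"
proof -
  note L = spanning_theta_lists[OF s] and L' = spanning_theta_lists[OF s']
  have len: "length (x # y # map fst (tl p) @ map fst (tl q) @ map fst (tl r)) = length (x' # y' # map fst (tl p') @ map fst (tl q') @ map fst (tl r'))" "length (edge_list p @ edge_list q @ edge_list r) = length (edge_list p' @ edge_list q' @ edge_list r')"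
    using l by simp_all
  obtain f where f: "bij_betw f (verts G) (verts H)" and fm:
    "map f (x # y # map fst (tl p) @ map fst (tl q) @ map fst (tl r)) = x' # y' # map fst (tl p') @ map fst (tl q') @ map fst (tl r')"
    by (rule distinct_lists_bij[OF L(1) L'(1) len(1), unfolded L(2) L'(2)])
  obtain g where g: "bij_betw g (edges G) (edges H)" and gm:
    "map g (edge_list p @ edge_list q @ edge_list r) = edge_list p' @ edge_list q' @ edge_list r'"
    by (rule distinct_lists_bij[OF L(3) L'(3) len(2), unfolded L(4) L'(4)])
  have fxy: "f x = x'" "f y = y'" and fi: "map f (map fst (tl p)) = map fst (tl p')" "map f (map fst (tl q)) = map fst (tl q')" "map f (map fst (tl r)) = map fst (tl r')"
    using fm l by simp_all
  have gi: "map g (edge_list p) = edge_list p'" "map g (edge_list q) = edge_list q'" "map g (edge_list r) = edge_list r'"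
    using gm l by simp_all
  have main: "ends H (g e) = f ` ends G e" if e: "e \<in> pedges u" and u: "gpath G x u y" "u \<noteq> []" and u': "gpath H x' u' y'" "u' \<noteq> []"
    and fu: "map f (map fst (tl u)) = map fst (tl u')" and gu: "map g (edge_list u) = edge_list u'" for e u u'
  proof -
    have len: "length u = length u'" using gu by (metis length_map)
    obtain i where i: "i < length u" "fst (snd (u ! i)) = e" using e unfolding pedges_def by (auto simp: in_set_conv_nth)
    have "map f (map fst u) = map fst u'" using incidence.path_inner(1)[OF u] incidence.path_inner(1)[OF u'] fu fxy by simp
    then have "map f (map fst u) ! i = map fst u' ! i" by simp
    then have 1: "f (fst (u ! i)) = fst (u' ! i)" using i(1) len by simp
    have "map f (map (snd \<circ> snd) u) = map (snd \<circ> snd) u'" using incidence.path_targets[OF u] incidence.path_targets[OF u'] fu fxy by simp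
    then have "map f (map (snd \<circ> snd) u) ! i = map (snd \<circ> snd) u' ! i" by simp
    then have 2: "f (snd (snd (u ! i))) = snd (snd (u' ! i))" using i(1) len by simp
    have "map g (edge_list u) ! i = edge_list u' ! i" using gu by simp
    then have 3: "g e = fst (snd (u' ! i))" using i len by simp
    have "ends G e = {fst (u ! i), snd (snd (u ! i))}"
      by (rule incidence.dart_ends[OF incidence.path_walk[OF u(1)]]) (use i in \<open>metis nth_mem prod.collapse\<close>)
    moreover have "ends H (g e) = {fst (u' ! i), snd (snd (u' ! i))}"
      by (rule incidence.dart_ends[OF incidence.path_walk[OF u'(1)]]) (use i len 3 in \<open>metis nth_mem prod.collapse\<close>)
    ultimately show ?thesis using 1 2 by simp
  qed
  have "ends H (g e) = f ` ends G e" if "e \<in> edges G" for e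
  proof -
    have "e \<in> pedges p \<or> e \<in> pedges q \<or> e \<in> pedges r" using that s by (auto simp: spanning_theta_def)
    then show ?thesis
      using main[of e p p'] main[of e q q'] main[of e r r'] L(5) L'(5) fi gi by blast
  qed
  then show ?thesis using f g unfolding isomorphic_def by blast
qed

lemma even_subdivision_spanning_theta:
  assumes s: "spanning_theta H x y p q r"
  shows "even_subdivision (complete_bipartite 2 3) H"
proof -
  obtain F0 :: "(nat, nat) mgraph" where F0: "isomorphic (complete_bipartite 2 3) F0" using nat_copy_K23 by blast
  obtain x0 y0 p0 q0 r0 where t0: "spanning_theta F0 x0 y0 p0 q0 r0" "length p0 = 2" "length q0 = 2" "length r0 = 2"
    using spanning_theta_isomorphic[OF K23_spanning_theta F0] by auto
  have "2 \<le> length u \<and> even (length u)" if "u \<in> {p, q, r}" for u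
  proof -
    have "u \<noteq> []" using spanning_theta_lists(5)[OF s that] by simp
    moreover have "even (length u)" using that s by (auto simp: spanning_theta_def incidence.even_theta_def)
    ultimately show ?thesis by (cases u; cases "tl u") auto
  qed
  then obtain F1 p1 q1 r1 where F1: "double_subdivide\<^sup>*\<^sup>* F0 F1" "spanning_theta F1 x0 y0 p1 q1 r1"
    "length p1 = length p" "length q1 = length q" "length r1 = length r"
    using spanning_theta_reachable[OF t0(1), of "length p" "length q" "length r"] t0(2-4) by auto
  have "isomorphic F1 H" by (rule spanning_theta_unique[OF F1(2) s F1(3-5)])
  then show ?thesis unfolding even_subdivision_def using F0 F1(1) by blast
qed

section \<open>From obstructions to subgraphs\<close>

definition support :: "('v, 'e) mgraph \<Rightarrow> ('v, 'e) dart list \<Rightarrow> ('v, 'e) mgraph" where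
  "support G p = \<lparr>verts = pverts p, edges = pedges p, ends = ends G\<rparr>"

lemma subgraph_support:
  assumes G: "finite_mgraph G" and d: "\<And>a e b. (a, e, b) \<in> set p \<Longrightarrow> e \<in> edges G \<and> ends G e = {a, b}"
  shows "subgraph (support G p) G"
proof -
  have "pverts p \<subseteq> verts G"
  proof
    fix z assume "z \<in> pverts p"
    then obtain a e b where m: "(a, e, b) \<in> set p" "z \<in> {a, b}" unfolding pverts_def by force
    have "\<exists>u\<in>verts G. \<exists>v\<in>verts G. ends G e = {u, v}" using G d[OF m(1)] unfolding finite_mgraph_def by blast
    then have "ends G e \<subseteq> verts G" by auto
    then have "{a, b} \<subseteq> verts G" using d[OF m(1)] by simp
    then show "z \<in> verts G" using m(2) by blast
  qed
  moreover have "\<exists>u\<in>pverts p. \<exists>v\<in>pverts p. ends G e = {u, v}" if e: "e \<in> pedges p" for e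
  proof -
    obtain a b where m: "(a, e, b) \<in> set p" using e by (auto simp: pedges_def)
    then show ?thesis using d[OF m] dart_pverts[OF m] by blast
  qed
  moreover have "pedges p \<subseteq> edges G" using d by (auto simp: pedges_def)
  moreover have "finite (pverts p)" "finite (pedges p)" by (auto simp: pverts_def pedges_def)
  ultimately show ?thesis by (simp add: subgraph_def finite_mgraph_def support_def)
qed

lemma path_darts:
  assumes "incidence.path en E x p y" "(a, e, b) \<in> set p"
  shows "e \<in> E \<and> en e = {a, b}"
proof -
  have "e \<in> pedges p" using assms(2) by (force simp: pedges_def)
  then show ?thesis using incidence.path_pedges[OF assms(1)] incidence.dart_ends[OF incidence.path_walk[OF assms(1)] assms(2)] by auto
qed

lemma even_theta_subgraph:
  assumes G: "finite_mgraph G" and t: "incidence.even_theta (ends G) (edges G) x y p q r"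
  shows "\<exists>K. subgraph K G \<and> even_subdivision (complete_bipartite 2 3) K"
proof -
  interpret incidence "ends G" .
  let ?K = "support G (p @ q @ r)"
  have P: "path (edges G) x p y" "path (edges G) x q y" "path (edges G) x r y" using t by (auto simp: even_theta_def)
  have "e \<in> edges G \<and> ends G e = {a, b}" if "(a, e, b) \<in> set (p @ q @ r)" for a e b
    using that path_darts[OF P(1)] path_darts[OF P(2)] path_darts[OF P(3)] by auto
  then have "subgraph ?K G" by (rule subgraph_support[OF G])
  moreover have K: "edges ?K = pedges p \<union> pedges q \<union> pedges r" "verts ?K = pverts p \<union> pverts q \<union> pverts r" "ends ?K = ends G"
    by (auto simp: support_def)
  have "path (edges ?K) x s y" if "s \<in> {p, q, r}" for s
    using that P K by (auto intro: path_restrict)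
  then have "even_theta (edges ?K) x y p q r" using t by (simp add: even_theta_def)
  then have "spanning_theta ?K x y p q r" using K by (simp add: spanning_theta_def)
  then have "even_subdivision (complete_bipartite 2 3) ?K" by (rule even_subdivision_spanning_theta)
  ultimately show ?thesis by blast
qed

text \<open>The contracted circuit is the triangle \<open>f @ g @ h\<close>, odd as a sum of three
  odd lengths. Its vertices merge into \<open>W\<close>, and the even paths \<open>p\<close>,
  \<open>q\<close>, \<open>r\<close> become the three paths of a theta from \<open>{w}\<close> to
  \<open>W\<close>.\<close>

lemma star_K4_subgraph:
  assumes G: "finite_mgraph G" and t: "incidence.star_K4 (ends G) (edges G) w a b c p q r f g h"
  shows "\<exists>K A. subgraph K G \<and> odd_circuit K A \<and> even_subdivision (complete_bipartite 2 3) (contract K A)"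
proof -
  interpret incidence "ends G" .
  note k = t[unfolded star_K4_def]
  have dist: "w \<noteq> a" "w \<noteq> b" "w \<noteq> c" "a \<noteq> b" "a \<noteq> c" "b \<noteq> c" using k by simp_all
  have P: "path (edges G) w p a" "path (edges G) w q b" "path (edges G) w r c" "path (edges G) a f b" "path (edges G) b g c" "path (edges G) c h a"
    using k by simp_all
  have l: "even (length p)" "even (length q)" "even (length r)" "odd (length f)" "odd (length g)" "odd (length h)" using k by simp_all
  have D: "meet_in p q {w}" "meet_in p r {w}" "meet_in q r {w}"
    "meet_in f g {b}" "meet_in g h {c}" "meet_in h f {a}" using k by simp_all
  have W: "pverts p \<inter> (pverts f \<union> pverts g \<union> pverts h) \<subseteq> {a}" "pverts q \<inter> (pverts f \<union> pverts g \<union> pverts h) \<subseteq> {b}"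
    "pverts r \<inter> (pverts f \<union> pverts g \<union> pverts h) \<subseteq> {c}" using k by auto
  let ?L = "p @ q @ r @ f @ g @ h"
  define K where "K = support G ?L"
  have "e \<in> edges G \<and> ends G e = {a, b}" if "(a, e, b) \<in> set ?L" for a e b
    using that path_darts[OF P(1)] path_darts[OF P(2)] path_darts[OF P(3)] path_darts[OF P(4)] path_darts[OF P(5)] path_darts[OF P(6)]
    by auto
  then have sub: "subgraph K G" unfolding K_def by (rule subgraph_support[OF G])
  then have finK: "finite_mgraph K" by (simp add: subgraph_def)
  have K: "edges K = pedges ?L" "verts K = pverts ?L" "ends K = ends G"
    by (simp_all add: K_def support_def)
  have PK: "path (edges K) w p a" "path (edges K) w q b" "path (edges K) w r c" "path (edges K) a f b" "path (edges K) b g c" "path (edges K) c h a"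
    unfolding K(1) by (auto intro: path_restrict P)
  have ef: "a \<in> pverts f" "b \<in> pverts f" "b \<in> pverts g" "c \<in> pverts g" "c \<in> pverts h" "a \<in> pverts h"
    "w \<in> pverts p" "a \<in> pverts p" "w \<in> pverts q" "b \<in> pverts q" "w \<in> pverts r" "c \<in> pverts r"
    using P[THEN path_ends] P[THEN path_Nil_iff] dist by auto
  define W where "W = pverts f \<union> pverts g \<union> pverts h"
  define C where "C = f @ g @ h"
  have fg: "path (edges K) a (f @ g) c" by (rule path_append[OF PK(4,5) D(4)])
  have CW: "closed_path (edges K) a C"
  proof -
    have e: "a \<noteq> c" "length (f @ g) = length (f @ g)" using dist by auto
    have d: "meet_in (f @ g) h {a, c}" using D(5,6) by auto
    have "walk (edges K) a C a" using walk_append[of _ a "f @ g" h a] path_walk[OF fg] path_walk[OF PK(6)] unfolding C_def append_assoc by blast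
    moreover have "distinct (map fst C)"
    proof -
      have "fst ` set (f @ g) \<inter> fst ` set h = {}"
      proof (rule equals0I)
        fix z assume z: "z \<in> fst ` set (f @ g) \<inter> fst ` set h"
        then have "z \<in> pverts (f @ g) \<inter> pverts h" unfolding pverts_def by blast
        then have "z = a \<or> z = c" using d by blast
        then show False using z path_distinct[OF fg] path_distinct[OF PK(6)] by auto
      qed
      then show ?thesis using path_distinct[OF fg] path_distinct[OF PK(6)] by (auto simp: C_def)
    qed
    \<comment> \<open>The path \<open>f @ g\<close> has even length, so it cannot coincide with a
      single edge shared with \<open>h\<close>.\<close>
    moreover have "pedges (f @ g) \<inter> pedges h = {}"
      using even_paths_edge_disjoint[OF fg path_reverse[OF PK(6)]] l d
      by (simp only: pverts_reverse pedges_reverse length_append even_add simp_thms)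
    then have "distinct (edge_list C)" using path_distinct[OF fg] path_distinct[OF PK(6)] by (auto simp: C_def pedges_def)
    moreover have "C \<noteq> []" using l by (auto simp: C_def)
    ultimately show ?thesis by (simp add: closed_path_def)
  qed
  define A where "A = pedges C"
  have "gclosed K a C" using CW K(3) by simp
  from closed_path_traversal(1)[OF finK this] have tr: "traversal K (map fst C) (edge_list C)" .
  have A: "set (edge_list C) = A" by (simp add: A_def pedges_def)
  have "card A = length C" using CW distinct_card[of "edge_list C"] unfolding A[symmetric] by (simp add: closed_path_def)
  then have "odd (card A)" using l by (simp add: C_def)
  then have oddA: "odd_circuit K A" using tr A unfolding odd_circuit_def circuit_def by blast
  have WA: "(\<Union>e\<in>A. ends K e) = W"
  proof -
    have "walk (edges K) a C a" using CW by (simp add: closed_path_def)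
    then have "(\<Union>e\<in>A. ends G e) = pverts C" unfolding A_def by (rule walk_ends)
    then show ?thesis using K(3) by (simp add: C_def W_def Un_assoc)
  qed
  let ?c = "contract_map W"
  let ?H = "contract K A"
  have H: "verts ?H = ?c ` verts K" "edges ?H = edges K - A" "ends ?H = (\<lambda>e. ?c ` ends K e)"
    using contract_simps[of K A] WA by auto
  have aW: "a \<in> W" "b \<in> W" "c \<in> W" using ef by (auto simp: W_def)
  have wW: "w \<notin> W" using W ef dist unfolding W_def by blast
  have ca: "?c a = W" "?c b = W" "?c c = W" "?c w = {w}" using aW wW by (auto simp: contract_map_def)
  \<comment> \<open>An edge of \<open>A\<close> has both ends in \<open>W\<close>, where the path
    \<open>s\<close> has no vertex but \<open>z\<close>; a path contains no loop.\<close>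
  have pd: "pedges s \<inter> A = {}" if s: "path (edges K) w s z" "pverts s \<inter> W \<subseteq> {z}" for s z
  proof (rule ccontr)
    assume "pedges s \<inter> A \<noteq> {}"
    then obtain e where e: "e \<in> pedges s" "e \<in> A" by auto
    then obtain a' b' where m: "(a', e, b') \<in> set s" by (auto simp: pedges_def)
    have "ends G e = {a', b'}" using path_darts[OF s(1) m] by simp
    moreover have "ends G e \<subseteq> W" using WA e(2) K(3) by auto
    ultimately have "a' = z" "b' = z" using s(2) dart_pverts[OF m] by auto
    moreover obtain s1 s2 where "s = s1 @ (a', e, b') # s2" using m split_list by metis
    ultimately show False using s(1) path_appendD by fastforce
  qed
  have pW: "pverts p \<inter> W \<subseteq> {a}" "pverts q \<inter> W \<subseteq> {b}" "pverts r \<inter> W \<subseteq> {c}" using W by (simp_all add: W_def)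
  note pd' = pd[OF PK(1) pW(1)] pd[OF PK(2) pW(2)] pd[OF PK(3) pW(3)]
  have EH: "edges ?H = pedges p \<union> pedges q \<union> pedges r"
    unfolding H(2) K(1) using pd' by (auto simp: A_def C_def)
  \<comment> \<open>Contraction identifies only vertices of \<open>W\<close>, and each of the three
    paths has at most one of these.\<close>
  have inj: "inj_on ?c (pverts s)" if "pverts s \<inter> W \<subseteq> {z}" for s :: "('a, 'b) dart list" and z
    unfolding inj_on_def contract_map_eq using that by blast
  have PH: "gpath ?H {w} (map_darts ?c id p) W" "gpath ?H {w} (map_darts ?c id q) W" "gpath ?H {w} (map_darts ?c id r) W"
    using path_map[OF PK(1) inj[OF pW(1)], of id "edges ?H" "ends ?H"] path_map[OF PK(2) inj[OF pW(2)], of id "edges ?H" "ends ?H"]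
      path_map[OF PK(3) inj[OF pW(3)], of id "edges ?H" "ends ?H"] EH H(3) K(3) ca by auto
  have DH: "?c ` pverts s \<inter> ?c ` pverts s' \<subseteq> {{w}, W}" if s: "meet_in s s' {w}" for s s' :: "('a, 'b) dart list"
  proof
    fix Z assume "Z \<in> ?c ` pverts s \<inter> ?c ` pverts s'"
    then obtain z z' where z: "z \<in> pverts s" "z' \<in> pverts s'" "Z = ?c z" "?c z = ?c z'" by auto
    show "Z \<in> {{w}, W}"
    proof (cases "z \<in> W")
      case False
      then have "z = z'" using z(4) contract_map_eq by metis
      then show ?thesis using s z ca by auto
    qed (use z(3) in \<open>simp add: contract_map_def\<close>)
  qed
  have "{w} \<noteq> W" using aW(1) wW by auto
  then have "incidence.even_theta (ends ?H) (edges ?H) {w} W (map_darts ?c id p) (map_darts ?c id q) (map_darts ?c id r)"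
    unfolding incidence.even_theta_def using PH l DH D by simp
  moreover have "verts ?H = ?c ` pverts p \<union> ?c ` pverts q \<union> ?c ` pverts r"
  proof -
    have "?c ` W \<subseteq> {W}" by (auto simp: contract_map_def)
    moreover have "verts ?H = ?c ` pverts p \<union> ?c ` pverts q \<union> ?c ` pverts r \<union> ?c ` W"
      unfolding H(1) K(2) W_def by auto
    moreover have "W \<in> ?c ` pverts p" using imageI[OF ef(8), of ?c] ca(1) by simp
    then have "{W} \<subseteq> ?c ` pverts p \<union> ?c ` pverts q \<union> ?c ` pverts r" by simp
    ultimately show ?thesis using Un_absorb2[OF order_trans] by metis
  qed
  ultimately have "spanning_theta ?H {w} W (map_darts ?c id p) (map_darts ?c id q) (map_darts ?c id r)"
    using EH by (simp add: spanning_theta_def)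
  then have "even_subdivision (complete_bipartite 2 3) ?H" by (rule even_subdivision_spanning_theta)
  then show ?thesis using sub oddA by blast
qed

theorem corollary1:
  fixes G :: "('v, 'e) mgraph"
  assumes "finite_mgraph G"
  shows "\<not> (\<exists>D. orientation G D \<and> (\<forall>A. even_circuit G A \<longrightarrow> clockwise_odd G D A)) \<longleftrightarrow>
    (\<exists>K. subgraph K G \<and>
      (even_subdivision (complete_bipartite 2 3) K \<or>
       (\<exists>A. odd_circuit K A \<and> even_subdivision (complete_bipartite 2 3) (contract K A))))"
  unfolding orientable_iff_good[OF assms]
proof
  assume no: "\<not> (\<exists>D. ggood G D)"
  have "\<exists>a b. ends G e = {a, b}" if "e \<in> edges G" for e using assms that unfolding finite_mgraph_def by blast
  then have "(\<exists>x y p q r. incidence.even_theta (ends G) (edges G) x y p q r) \<or>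
    (\<exists>w a b c p q r f g h. incidence.star_K4 (ends G) (edges G) w a b c p q r f g h)"
    using incidence.exists_good_orientation[of "edges G" "ends G"] assms no unfolding finite_mgraph_def by blast
  then show "\<exists>K. subgraph K G \<and> (even_subdivision (complete_bipartite 2 3) K \<or>
      (\<exists>A. odd_circuit K A \<and> even_subdivision (complete_bipartite 2 3) (contract K A)))"
    using even_theta_subgraph[OF assms] star_K4_subgraph[OF assms] by metis
next
  assume "\<exists>K. subgraph K G \<and> (even_subdivision (complete_bipartite 2 3) K \<or>
      (\<exists>A. odd_circuit K A \<and> even_subdivision (complete_bipartite 2 3) (contract K A)))"
  then obtain K where K: "subgraph K G" "even_subdivision (complete_bipartite 2 3) K \<or>
      (\<exists>A. odd_circuit K A \<and> even_subdivision (complete_bipartite 2 3) (contract K A))" by blast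
  have fK: "finite_mgraph K" using K(1) by (simp add: subgraph_def)
  show "\<not> (\<exists>D. ggood G D)"
  proof
    assume "\<exists>D. ggood G D"
    then obtain D where D: "ggood K D" using good_subgraph[OF K(1)] by blast
    then show False using K(2) good_contract[OF fK _ D] even_subdivision_K23_not_good by metis
  qed
qed

end
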